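(* Let $m\ge1/2$ and let $E_{2m}=\{z\in\mathbb{C}^n:|z_1|^{2m}+|z_2|^2+\dots+|z_n|^2<1\}$. For $0<p<1$ and $(v_1,\dots,v_n)\in\mathbb{C}^n\setminus\{0\}$, the (infinitesimal) Kobayashi metric of $E_{2m}$ is given by $$K_{E_{2m}}\big((p,0,\dots,0),(v_1,\dots,v_n)\big)=\begin{cases}\left(\dfrac{m^2p^{2m-2}|v_1|^2}{(1-p^{2m})^2}+\dfrac{|v_2|^2}{1-p^{2m}}+\dots+\dfrac{|v_n|^2}{1-p^{2m}}\right)^{1/2} & \text{for } u\le p,\\[3mm] \dfrac{m\,\alpha(1-t)|v_1|}{p(1-\alpha^2)\big(m(1-t)+t\big)} & \text{for } u>p,\end{cases}$$ where $$u=\left(\frac{m^2|v_1|^2}{|v_2|^2+\dots+|v_n|^2}\right)^{1/2},\qquad t=\frac{2m^2p^2}{u^2+2m(m-1)p^2+u\big(u^2+4m(m-1)p^2\big)^{1/2}},$$ and $\alpha$ is the unique positive solution of $$\alpha^{2m}-t\alpha^{2m-2}-(1-t)p^{2m}=0 .$$ Moreover, $K_{E_{2m}}$ is $C^1$-smooth on $E_{2m}\times(\mathbb{C}^n\setminus\{0\})$ for $m>1/2$.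
   Context: $K_D(z,v)=\inf\{1/r:\ \exists f\in\mathcal{O}(\Delta_r,D),\ f(0)=z,\ df(0)=v\}$, where $\Delta_r\subset\mathbb{C}$ is the open disc of radius $r$ centred at $0$. When $v_2=\dots=v_n=0$ (and $v_1\neq0$) the formulas are read with $u=+\infty$, $t=0$. Here $m$ is real, not necessarily an integer. *)

theory Defs
  imports "HOL-Complex_Analysis.Complex_Analysis"
begin

definition holomorphic_map_on :: "(complex \<Rightarrow> complex ^ 'n) \<Rightarrow> complex set \<Rightarrow> bool"
  where "holomorphic_map_on f S \<longleftrightarrow> (\<forall>i. (\<lambda>\<zeta>. f \<zeta> $ i) holomorphic_on S)"

text \<open>
  The infimum is taken in the reals. For \<open>D\<close> open and \<open>z \<in> D\<close> the set is nonempty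
  (affine discs) and bounded below by \<open>0\<close>, so it is the usual infimum.
\<close>

definition kobayashi_metric ::
    "(complex ^ 'n) set \<Rightarrow> complex ^ 'n \<Rightarrow> complex ^ 'n \<Rightarrow> real"
  where "kobayashi_metric D z v =
    Inf {1 / r | r. r > 0 \<and>
      (\<exists>f. holomorphic_map_on f (ball 0 r) \<and> f ` ball 0 r \<subseteq> D \<and>
           f 0 = z \<and> (\<forall>i. deriv (\<lambda>\<zeta>. f \<zeta> $ i) 0 = v $ i))}"

text \<open>
  The coordinates of \<open>\<complex>\<^sup>n\<close> are indexed by a finite type; the distinguished index \<open>k\<close>
  plays the role of the first coordinate.
\<close>

definition tail_norm_sq :: "'n::finite \<Rightarrow> complex ^ 'n \<Rightarrow> real"
  where "tail_norm_sq k v = (\<Sum>j \<in> UNIV - {k}. (cmod (v $ j))\<^sup>2)"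

definition ellipsoid :: "'n::finite \<Rightarrow> real \<Rightarrow> (complex ^ 'n) set"
  where "ellipsoid k m = {z. cmod (z $ k) powr (2 * m) + tail_norm_sq k z < 1}"

definition u_param :: "'n::finite \<Rightarrow> real \<Rightarrow> complex ^ 'n \<Rightarrow> ereal"
  where "u_param k m v =
    (if tail_norm_sq k v = 0 then \<infinity>
     else ereal (sqrt (m\<^sup>2 * (cmod (v $ k))\<^sup>2 / tail_norm_sq k v)))"

definition t_param :: "real \<Rightarrow> real \<Rightarrow> ereal \<Rightarrow> real"
  where "t_param m p u =
    (if u = \<infinity> then 0
     else let s = real_of_ereal u
          in 2 * m\<^sup>2 * p\<^sup>2 /
             (s\<^sup>2 + 2 * m * (m - 1) * p\<^sup>2 + s * sqrt (s\<^sup>2 + 4 * m * (m - 1) * p\<^sup>2)))"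

text \<open>Continuous differentiability over the reals, meant for open \<open>U\<close>.\<close>

definition C1_smooth_on ::
    "'a::real_normed_vector set \<Rightarrow> ('a \<Rightarrow> 'b::real_normed_vector) \<Rightarrow> bool"
  where "C1_smooth_on U f \<longleftrightarrow>
    (\<exists>f' :: 'a \<Rightarrow> 'a \<Rightarrow>\<^sub>L 'b.
       (\<forall>x\<in>U. (f has_derivative blinfun_apply (f' x)) (at x)) \<and> continuous_on U f')"

end

theory Submission
  imports Defs
begin

text \<open>
  The ellipsoid is convex for \<open>m \<ge> 1/2\<close>, so discs are extremal as soon as they are stationary: if \<open>h\<close> is
  holomorphic and a positive multiple of \<open>\<zeta>\<close> times the complex normal along \<open>f\<close>, then for any disc \<open>g\<close> the
  harmonic function \<open>Re \<langle>h, g - f\<rangle> / \<zeta>\<close> is negative on the circle, hence at the origin. This yields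
  the linear inequality \<open>Re (\<langle>h' 0, g 0 - f 0\<rangle> + \<langle>h 0, g' 0 - f' 0\<rangle>) < 0\<close>. Explicit stationary discs through
  \<open>(p, 0, ..., 0)\<close> give the formulas.

  The same inequality bounds \<open>K\<close> from below near \<open>(f 0, f' 0)\<close> by a smooth function. If \<open>m > 1/2\<close>, perturbations
  \<open>f + \<phi>\<close> with \<open>Re (cnj \<zeta> * \<langle>h, \<phi>\<rangle>)\<close> constant on the circle give the matching upper bound, so \<open>K\<close> is
  differentiable there; automorphisms move every point to \<open>(p, 0, ..., 0)\<close>. Since averages of discs are discs, the
  sublevel sets of \<open>K\<close> in \<open>(z, v)\<close> are convex, and differentiability of a homogeneous
  function with convex sublevel sets implies continuity of its derivative.
\<close>

subsection \<open>The defining function of the ellipsoid\<close>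

text \<open>The two cases of the formula record where the first component of the extremal disc
  vanishes. Divided by its Blaschke factor, if it has one, and raised to the power \<open>m\<close>,
  this component is a multiple of
  \<open>(1 + \<sigma> * \<zeta>) / (1 + A * \<sigma> * \<zeta>)\<close>, as for geodesics of the
  ball. For \<open>u < p\<close> there is no Blaschke factor and the zero
  \<open>-1 / \<sigma>\<close> lies outside the closed disc (at infinity if
  \<open>\<sigma> = 0\<close>). For \<open>u > p\<close> a Blaschke factor puts a zero at
  \<open>-\<sigma>\<close>, and \<alpha> is this \<sigma>. At \<open>u = p\<close> the zero sits at
  \<open>-1\<close>, where the \<open>m\<close>-th root has a branch point on the circle. Smoothness
  is not read off the formulas, which would mean following \<alpha> implicitly and gluing along
  \<open>u = p\<close>. The argument asks only for a continuous gradient and for a map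
  \<open>b\<close> in the disc algebra with \<langle>h, b\<rangle> = 1; with \<open>b\<close>, a
  perturbation can be given any prescribed pairing with \<open>h\<close>. At
  \<open>m = 1 / 2\<close> the gradient jumps on \<open>z $ k = 0\<close>. Hence differentiability
  is argued for \<open>m > 1 / 2\<close> only, and \<open>u = p\<close> is reached by a limit when
  \<open>m = 1 / 2\<close>.\<close>

lemma powr_above_tangent:
  fixes x y q :: real
  assumes "0 \<le> x" "0 \<le> y" "1 \<le> q"
  shows "y powr q \<ge> x powr q + q * x powr (q - 1) * (y - x)"
proof (cases "x = 0 \<or> y = 0")
  case True
  show ?thesis
  proof (cases "x = 0")
    case True
    \<comment> \<open>By the convention \<open>0 powr a = 0\<close>, also for \<open>a = 0\<close>,
      the right-hand side is 0 here; for \<open>q = 1\<close> this selects the horizontal support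
      line at the endpoint.\<close>
    then show ?thesis by simp
  next
    case False
    then have y: "y = 0" "x > 0" using True assms by auto
    have "x powr q = x powr (q - 1) * x"
      using y(2) by (simp add: powr_mult_base powr_diff)
    then show ?thesis using y assms by simp
  qed
next
  case False
  then have pos: "0 < x" "0 < y" using assms by auto
  have "y powr q - x powr q \<ge> (q * x powr (q - 1)) * (y - x)"
    proof (rule convex_on_imp_above_tangent[where A = "{0<..}"])
      show "convex_on {0<..} (\<lambda>x. x powr q)" by (rule powr_convex[OF assms(3)])
      show "((\<lambda>x. x powr q) has_real_derivative q * x powr (q - 1)) (at x within {0<..})"
        using pos by (auto intro!: derivative_eq_intros)
    qed (use pos in \<open>auto simp: interior_open\<close>)
  then show ?thesis by (simp add: algebra_simps)
qed

text \<open>Bilinear rather than Hermitian, so that the pairing of two holomorphic maps is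
  holomorphic.\<close>

definition cdot :: "complex ^ 'n::finite \<Rightarrow> complex ^ 'n \<Rightarrow> complex"
  where "cdot h w = (\<Sum>i\<in>UNIV. h $ i * w $ i)"

lemma cdot_add_right: "cdot h (v + w) = cdot h v + cdot h w"
  by (simp add: cdot_def algebra_simps sum.distrib)

lemma cdot_diff_right: "cdot h (v - w) = cdot h v - cdot h w"
  by (simp add: cdot_def algebra_simps sum_subtractf)

lemma cdot_diff_left: "cdot (g - h) w = cdot g w - cdot h w"
  by (simp add: cdot_def algebra_simps sum_subtractf)

lemma cdot_scaleR_right: "cdot h (r *\<^sub>R w) = of_real r * cdot h w"
  unfolding cdot_def sum_distrib_left vector_scaleR_component by (simp add: scaleR_conv_of_real algebra_simps)

lemma cdot_smult_right: "cdot h (c *s w) = c * cdot h w"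
  by (simp add: cdot_def sum_distrib_left algebra_simps)

lemma cdot_smult_left: "cdot (c *s h) w = c * cdot h w"
  by (simp add: cdot_def sum_distrib_left algebra_simps)

lemma cdot_zero [simp]: "cdot h 0 = 0" "cdot 0 w = 0"
  by (simp_all add: cdot_def)

lemma norm_cdot_le: "cmod (cdot h w) \<le> norm h * norm w"
proof -
  have "cmod (cdot h w) \<le> (\<Sum>i\<in>UNIV. \<bar>cmod (h $ i)\<bar> * \<bar>cmod (w $ i)\<bar>)"
    unfolding cdot_def by (rule order_trans[OF norm_sum]) (simp add: norm_mult)
  also have "\<dots> \<le> norm h * norm w"
    unfolding norm_vec_def by (rule L2_set_mult_ineq)
  finally show ?thesis .
qed

lemma sum_UNIV_remove:
  fixes g :: "'n::finite \<Rightarrow> 'a::comm_monoid_add"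
  shows "(\<Sum>i\<in>UNIV. g i) = g k + (\<Sum>i\<in>UNIV - {k}. g i)"
  by (simp add: sum.remove)

definition defining_fun :: "'n::finite \<Rightarrow> real \<Rightarrow> complex ^ 'n \<Rightarrow> real"
  where "defining_fun k m w = cmod (w $ k) powr (2 * m) + tail_norm_sq k w"

lemma in_ellipsoid_iff: "w \<in> ellipsoid k m \<longleftrightarrow> defining_fun k m w < 1"
  by (simp add: ellipsoid_def defining_fun_def)

text \<open>The subgradient of the defining function, as a complex-linear form; at \<open>w $ k = 0\<close> the
  convention \<open>0 powr a = 0\<close> selects the zero subgradient.\<close>

definition defining_grad :: "'n::finite \<Rightarrow> real \<Rightarrow> complex ^ 'n \<Rightarrow> complex ^ 'n"
  where "defining_grad k m w =
    (\<chi> i. if i = k then of_real (m * cmod (w $ k) powr (2 * m - 1)) * cnj (sgn (w $ k))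
          else cnj (w $ i))"

lemma norm_sq_above_tangent: "(cmod w)\<^sup>2 \<ge> (cmod z)\<^sup>2 + 2 * Re (cnj z * (w - z))"
proof -
  have "(cmod w)\<^sup>2 = (cmod z)\<^sup>2 + 2 * Re (cnj z * (w - z)) + (cmod (w - z))\<^sup>2"
    unfolding cmod_power2 by (simp add: power2_eq_square algebra_simps)
  then show ?thesis by simp
qed

lemma cnj_sgn_mult_self: "cnj (sgn z) * z = of_real (cmod z)"
proof (cases "z = 0")
  case False
  have "cnj z * z = of_real (cmod z) * of_real (cmod z)"
    by (metis complex_norm_square mult.commute of_real_power power2_eq_square)
  then show ?thesis using False by (simp add: sgn_eq field_simps)
qed simp

lemma cmod_powr_above_tangent:
  assumes "m \<ge> 1 / 2"
  shows "cmod w powr (2 * m) \<ge> cmod z powr (2 * m) +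
    2 * Re (of_real (m * cmod z powr (2 * m - 1)) * cnj (sgn z) * (w - z))"
proof -
  have "Re (cnj (sgn z) * w) \<le> cmod w"
    by (rule order_trans[OF complex_Re_le_cmod])
       (simp add: norm_mult norm_sgn)
  then have "Re (cnj (sgn z) * (w - z)) \<le> cmod w - cmod z"
    by (simp only: right_diff_distrib cnj_sgn_mult_self) simp
  then have "(2 * m * cmod z powr (2 * m - 1)) * Re (cnj (sgn z) * (w - z)) \<le>
      (2 * m * cmod z powr (2 * m - 1)) * (cmod w - cmod z)"
    using assms by (intro mult_left_mono) auto
  moreover have "cmod w powr (2 * m) \<ge> cmod z powr (2 * m) +
      2 * m * cmod z powr (2 * m - 1) * (cmod w - cmod z)"
    using powr_above_tangent[of "cmod z" "cmod w" "2 * m"] assms by simp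
  ultimately show ?thesis
    by (simp add: mult.assoc)
qed

text \<open>All convexity used below comes from this inequality. It asks only for a subgradient, so
  it covers \<open>m = 1 / 2\<close>, where the defining function has a corner at
  \<open>z $ k = 0\<close>.\<close>

lemma defining_fun_above_tangent:
  assumes "m \<ge> 1 / 2"
  shows "defining_fun k m w \<ge> defining_fun k m z + 2 * Re (cdot (defining_grad k m z) (w - z))"
proof -
  have "cdot (defining_grad k m z) (w - z) =
      of_real (m * cmod (z $ k) powr (2 * m - 1)) * cnj (sgn (z $ k)) * (w $ k - z $ k) +
      (\<Sum>i\<in>UNIV - {k}. cnj (z $ i) * (w $ i - z $ i))"
    unfolding cdot_def by (subst sum_UNIV_remove[of _ k]) (simp add: defining_grad_def)
  moreover have "tail_norm_sq k w \<ge> tail_norm_sq k z +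
      2 * Re (\<Sum>i\<in>UNIV - {k}. cnj (z $ i) * (w $ i - z $ i))"
    unfolding tail_norm_sq_def Re_sum sum_distrib_left sum.distrib[symmetric]
    by (intro sum_mono norm_sq_above_tangent)
  moreover note cmod_powr_above_tangent[OF assms, of "z $ k" "w $ k"]
  ultimately show ?thesis
    by (simp add: defining_fun_def)
qed

text \<open>The tangent inequalities at the intermediate point are averaged; their linear terms
  cancel.\<close>

lemma defining_fun_convex:
  assumes "m \<ge> 1 / 2" "0 \<le> s" "s \<le> 1"
  shows "defining_fun k m ((1 - s) *\<^sub>R v + s *\<^sub>R w) \<le>
    (1 - s) * defining_fun k m v + s * defining_fun k m w"
proof -
  define z where "z = (1 - s) *\<^sub>R v + s *\<^sub>R w"
  let ?G = "cdot (defining_grad k m z)"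
  have "(1 - s) * (defining_fun k m z + 2 * Re (?G (v - z))) +
      s * (defining_fun k m z + 2 * Re (?G (w - z))) \<le>
    (1 - s) * defining_fun k m v + s * defining_fun k m w"
    using assms by (intro add_mono mult_left_mono defining_fun_above_tangent) auto
  moreover have "(1 - s) * Re (?G (v - z)) + s * Re (?G (w - z)) = 0"
  proof -
    have "(1 - s) *\<^sub>R (v - z) + s *\<^sub>R (w - z) = 0"
      by (simp add: z_def algebra_simps)
    then have "Re (?G ((1 - s) *\<^sub>R (v - z) + s *\<^sub>R (w - z))) = 0"
      by simp
    then show ?thesis by (simp add: cdot_add_right cdot_scaleR_right)
  qed
  ultimately show ?thesis
    unfolding z_def[symmetric] by (simp add: algebra_simps)
qed

lemma continuous_on_defining_fun:
  assumes "m > 0" shows "continuous_on UNIV (defining_fun k m)"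
  unfolding defining_fun_def[abs_def] tail_norm_sq_def
  using assms by (intro continuous_intros continuous_on_powr') auto

lemma open_ellipsoid: "m > 0 \<Longrightarrow> open (ellipsoid k m)"
  using open_Collect_less[OF continuous_on_defining_fun continuous_on_const]
  by (simp add: ellipsoid_def defining_fun_def)

lemma convex_ellipsoid:
  assumes m: "m \<ge> 1 / 2"
  shows "convex (ellipsoid k m)"
  unfolding convex_alt
proof (intro ballI allI impI)
  fix v w s
  assume vw: "v \<in> ellipsoid k m" "w \<in> ellipsoid k m" and s: "0 \<le> (s::real) \<and> s \<le> 1"
  have "(1 - s) * defining_fun k m v + s * defining_fun k m w < 1"
    using vw s by (intro convex_bound_lt) (auto simp: in_ellipsoid_iff)
  then show "(1 - s) *\<^sub>R v + s *\<^sub>R w \<in> ellipsoid k m"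
    using defining_fun_convex[OF m, of s k v w] s by (simp add: in_ellipsoid_iff)
qed

text \<open>The factor \<open>cmod z powr (2 * m - 1)\<close> tends to 0 at the origin and so
  suppresses the jump of \<open>sgn\<close>. At \<open>m = 1 / 2\<close> its exponent is 0 and the
  jump persists.\<close>

lemma continuous_on_defining_grad:
  assumes "m > 1 / 2"
  shows "continuous_on UNIV (defining_grad k m)"
proof -
  have "continuous_on UNIV (\<lambda>z. of_real (m * cmod z powr (2 * m - 1)) * cnj (sgn z))" (is "continuous_on _ ?g")
  proof (rule continuous_at_imp_continuous_on, rule ballI)
    fix z :: complex
    show "isCont ?g z"
    proof (cases "z = 0")
      case True
      have "(?g \<longlongrightarrow> 0) (at 0)"
      proof (rule Lim_null_comparison)
        show "eventually (\<lambda>z. norm (?g z) \<le> m * cmod z powr (2 * m - 1)) (at 0)"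
          using assms by (auto simp: norm_mult norm_sgn intro!: always_eventually)
        have "isCont (\<lambda>z::complex. m * cmod z powr (2 * m - 1)) 0"
          using assms by (intro continuous_intros) auto
        then show "((\<lambda>z::complex. m * cmod z powr (2 * m - 1)) \<longlongrightarrow> 0) (at 0)"
          by (simp add: isCont_def)
      qed
      then show ?thesis using True by (simp add: isCont_def)
    next
      case False
      then show ?thesis unfolding sgn_eq
        by (intro continuous_intros) auto
    qed
  qed
  from continuous_on_compose2[OF this continuous_on_component[OF continuous_on_id, of UNIV k]]
  have k: "continuous_on UNIV (\<lambda>w. of_real (m * cmod (w $ k) powr (2 * m - 1)) * cnj (sgn (w $ k)))"
    by simp
  show ?thesis
    unfolding defining_grad_def[abs_def]
  proof (rule continuous_on_vec_lambda)
    fix i show "continuous_on UNIV (\<lambda>w. if i = k then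
        of_real (m * cmod (w $ k) powr (2 * m - 1)) * cnj (sgn (w $ k)) else cnj (w $ i))"
      using k by (cases "i = k") (auto intro!: continuous_intros)
  qed
qed

subsection \<open>The disc algebra and the Kobayashi metric\<close>

definition disc_algebra :: "(complex \<Rightarrow> complex) \<Rightarrow> bool"
  where "disc_algebra \<phi> \<longleftrightarrow> continuous_on (cball 0 1) \<phi> \<and> \<phi> holomorphic_on ball 0 1"

named_theorems disc_algebra_intros

lemma disc_algebra_const [disc_algebra_intros]: "disc_algebra (\<lambda>_. c)"
  by (simp add: disc_algebra_def)

lemma disc_algebra_ident [disc_algebra_intros]: "disc_algebra (\<lambda>\<zeta>. \<zeta>)"
  by (simp add: disc_algebra_def)

lemma disc_algebra_add [disc_algebra_intros]:
  "disc_algebra f \<Longrightarrow> disc_algebra g \<Longrightarrow> disc_algebra (\<lambda>\<zeta>. f \<zeta> + g \<zeta>)"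
  by (auto simp: disc_algebra_def intro!: continuous_intros holomorphic_intros)

lemma disc_algebra_diff [disc_algebra_intros]:
  "disc_algebra f \<Longrightarrow> disc_algebra g \<Longrightarrow> disc_algebra (\<lambda>\<zeta>. f \<zeta> - g \<zeta>)"
  by (auto simp: disc_algebra_def intro!: continuous_intros holomorphic_intros)

lemma disc_algebra_mult [disc_algebra_intros]:
  "disc_algebra f \<Longrightarrow> disc_algebra g \<Longrightarrow> disc_algebra (\<lambda>\<zeta>. f \<zeta> * g \<zeta>)"
  by (auto simp: disc_algebra_def intro!: continuous_intros holomorphic_intros)

lemma disc_algebra_power [disc_algebra_intros]:
  "disc_algebra f \<Longrightarrow> disc_algebra (\<lambda>\<zeta>. f \<zeta> ^ n)"
  by (auto simp: disc_algebra_def intro!: continuous_intros holomorphic_intros)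

lemma disc_algebra_sum [disc_algebra_intros]:
  "(\<And>i. i \<in> I \<Longrightarrow> disc_algebra (f i)) \<Longrightarrow> disc_algebra (\<lambda>\<zeta>. \<Sum>i\<in>I. f i \<zeta>)"
  by (auto simp: disc_algebra_def intro!: continuous_intros holomorphic_intros)

lemma disc_algebra_divide [disc_algebra_intros]:
  "disc_algebra f \<Longrightarrow> disc_algebra g \<Longrightarrow> (\<And>\<zeta>. cmod \<zeta> \<le> 1 \<Longrightarrow> g \<zeta> \<noteq> 0) \<Longrightarrow>
    disc_algebra (\<lambda>\<zeta>. f \<zeta> / g \<zeta>)"
  by (auto simp: disc_algebra_def intro!: continuous_intros holomorphic_intros)

lemma disc_algebra_exp [disc_algebra_intros]:
  "disc_algebra f \<Longrightarrow> disc_algebra (\<lambda>\<zeta>. exp (f \<zeta>))"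
  by (auto simp: disc_algebra_def intro!: continuous_intros holomorphic_intros)

lemma disc_algebra_Ln [disc_algebra_intros]:
  assumes "disc_algebra f" "\<And>\<zeta>. cmod \<zeta> \<le> 1 \<Longrightarrow> Re (f \<zeta>) > 0"
  shows "disc_algebra (\<lambda>\<zeta>. Ln (f \<zeta>))"
  unfolding disc_algebra_def
proof
  have "f \<zeta> \<notin> \<real>\<^sub>\<le>\<^sub>0" if "cmod \<zeta> \<le> 1" for \<zeta>
    using assms(2)[OF that] by (auto simp: complex_nonpos_Reals_iff)
  then show "continuous_on (cball 0 1) (\<lambda>\<zeta>. Ln (f \<zeta>))" "(\<lambda>\<zeta>. Ln (f \<zeta>)) holomorphic_on ball 0 1"
    using assms(1) by (auto simp: disc_algebra_def intro!: continuous_intros holomorphic_intros)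
qed

lemma disc_algebra_differentiable:
  "disc_algebra f \<Longrightarrow> cmod \<zeta> < 1 \<Longrightarrow> f field_differentiable at \<zeta>"
  unfolding disc_algebra_def by (meson holomorphic_on_imp_differentiable_at open_ball mem_ball_0)

lemma disc_algebra_DERIV:
  "disc_algebra f \<Longrightarrow> cmod \<zeta> < 1 \<Longrightarrow> (f has_field_derivative deriv f \<zeta>) (at \<zeta>)"
  using disc_algebra_differentiable field_differentiable_derivI by blast

text \<open>Inside the disc this is removal of a singularity; near the circle \<zeta> stays away
  from 0, so continuity up to the boundary survives the division.\<close>

lemma disc_algebra_quotient:
  assumes "disc_algebra f"
  shows "disc_algebra (\<lambda>\<zeta>. if \<zeta> = 0 then deriv f 0 else (f \<zeta> - f 0) / \<zeta>)" (is "disc_algebra ?g")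
proof -
  have f: "continuous_on (cball 0 1) f" "f holomorphic_on ball 0 1"
    using assms by (simp_all add: disc_algebra_def)
  have "(\<lambda>\<zeta>. if \<zeta> = 0 then deriv f 0 else (f \<zeta> - f 0) / (\<zeta> - 0)) holomorphic_on ball 0 1"
    using f(2) open_ball by (rule pole_lemma_open)
  then have hol: "?g holomorphic_on ball 0 1" by (simp only: diff_zero)
  have "continuous_on (cball 0 1) ?g"
  proof (rule continuous_on_eq_continuous_within[THEN iffD2], rule ballI)
    fix \<zeta> :: complex assume \<zeta>: "\<zeta> \<in> cball 0 1"
    show "continuous (at \<zeta> within cball 0 1) ?g"
    proof (cases "\<zeta> = 0")
      case True
      have "continuous_on (ball 0 1) ?g"
        using hol by (rule holomorphic_on_imp_continuous_on)
      then have "isCont ?g \<zeta>"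
        by (rule continuous_on_interior) (simp add: True interior_open)
      then show ?thesis by (rule continuous_at_imp_continuous_at_within)
    next
      case False
      have "continuous_on (cball 0 1 - {0}) ?g"
      proof (subst continuous_on_cong[OF refl])
        show "continuous_on (cball 0 1 - {0}) (\<lambda>\<zeta>. (f \<zeta> - f 0) / \<zeta>)"
          by (intro continuous_intros continuous_on_subset[OF f(1)]) auto
      qed simp
      then have "continuous (at \<zeta> within (cball 0 1 - {0})) ?g"
        using \<zeta> False by (simp add: continuous_on_eq_continuous_within)
      moreover have "at \<zeta> within (cball 0 1 - {0}) = at \<zeta> within cball 0 1"
        using False by (intro at_within_nhd[of _ "- {0}"]) auto
      ultimately show ?thesis by simp
    qed
  qed
  with hol show ?thesis by (simp add: disc_algebra_def)
qed

text \<open>Strictness survives the maximum principle because the maximum over the compact circle is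
  attained there.\<close>

lemma disc_algebra_Re_negative:
  assumes "disc_algebra f" "\<And>\<zeta>. cmod \<zeta> = 1 \<Longrightarrow> Re (f \<zeta>) < 0" "cmod \<xi> \<le> 1"
  shows "Re (f \<xi>) < 0"
proof -
  have cont: "continuous_on (sphere 0 1) (\<lambda>\<zeta>. Re (f \<zeta>))"
    using assms(1) unfolding disc_algebra_def
    by (intro continuous_intros) (auto intro: continuous_on_subset)
  have "(1::complex) \<in> sphere 0 1" by simp
  then obtain \<zeta>0 where \<zeta>0: "\<zeta>0 \<in> sphere 0 1" "\<And>\<zeta>. \<zeta> \<in> sphere 0 1 \<Longrightarrow> Re (f \<zeta>) \<le> Re (f \<zeta>0)"
    using continuous_attains_sup[OF compact_sphere _ cont] by blast
  have "Re (f \<xi>) \<le> Re (f \<zeta>0)"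
    by (rule maximum_real_frontier[of f "cball 0 1"])
       (use assms \<zeta>0(2) in \<open>auto simp: disc_algebra_def\<close>)
  also have "\<dots> < 0" using \<zeta>0(1) by (intro assms(2)) auto
  finally show ?thesis .
qed

section \<open>Vector-valued discs continuous up to the circle\<close>

definition vec_disc_algebra :: "(complex \<Rightarrow> complex ^ 'n) \<Rightarrow> bool"
  where "vec_disc_algebra f \<longleftrightarrow> (\<forall>i. disc_algebra (\<lambda>\<zeta>. f \<zeta> $ i))"

lemma disc_algebra_cdot [disc_algebra_intros]:
  "vec_disc_algebra h \<Longrightarrow> vec_disc_algebra f \<Longrightarrow> disc_algebra (\<lambda>\<zeta>. cdot (h \<zeta>) (f \<zeta>))"
  unfolding cdot_def vec_disc_algebra_def by (intro disc_algebra_intros) auto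

lemma vec_disc_algebra_const [disc_algebra_intros]: "vec_disc_algebra (\<lambda>_. c)"
  by (simp add: vec_disc_algebra_def disc_algebra_const)

lemma vec_disc_algebra_add [disc_algebra_intros]:
  "vec_disc_algebra f \<Longrightarrow> vec_disc_algebra g \<Longrightarrow> vec_disc_algebra (\<lambda>\<zeta>. f \<zeta> + g \<zeta>)"
  by (simp add: vec_disc_algebra_def disc_algebra_add)

lemma vec_disc_algebra_diff [disc_algebra_intros]:
  "vec_disc_algebra f \<Longrightarrow> vec_disc_algebra g \<Longrightarrow> vec_disc_algebra (\<lambda>\<zeta>. f \<zeta> - g \<zeta>)"
  by (simp add: vec_disc_algebra_def disc_algebra_diff)

lemma vec_disc_algebra_smult [disc_algebra_intros]:
  "disc_algebra f \<Longrightarrow> vec_disc_algebra g \<Longrightarrow> vec_disc_algebra (\<lambda>\<zeta>. f \<zeta> *s g \<zeta>)"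
  by (simp add: vec_disc_algebra_def disc_algebra_mult)

lemma vec_disc_algebra_bounded:
  fixes f :: "complex \<Rightarrow> complex ^ 'n::finite"
  assumes "vec_disc_algebra f"
  obtains B where "B > 0" "\<And>\<zeta>. cmod \<zeta> \<le> 1 \<Longrightarrow> norm (f \<zeta>) \<le> B"
proof -
  have "continuous_on (cball 0 1) (\<lambda>\<zeta>. \<chi> i. f \<zeta> $ i)"
    using assms by (intro continuous_on_vec_lambda) (auto simp: vec_disc_algebra_def disc_algebra_def)
  then have "compact (f ` cball 0 1)"
    by (intro compact_continuous_image) auto
  then obtain B where "B > 0" "\<forall>x\<in>f ` cball 0 1. norm x \<le> B"
    using compact_imp_bounded bounded_pos by blast
  then show ?thesis by (intro that[of B]) auto
qed

text \<open>A maximum principle from convexity: if \<open>g \<xi>\<close> were outside, pairing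
  \<open>g \<zeta> - g \<xi>\<close> with the subgradient at \<open>g \<xi>\<close> would give a
  function whose real part is negative on the circle but 0 at \<xi>.\<close>

lemma vec_disc_algebra_in_ellipsoid:
  assumes m: "m \<ge> 1 / 2" and g: "vec_disc_algebra g"
    and bdry: "\<And>\<zeta>. cmod \<zeta> = 1 \<Longrightarrow> g \<zeta> \<in> ellipsoid k m"
    and \<xi>: "cmod \<xi> \<le> 1"
  shows "g \<xi> \<in> ellipsoid k m"
proof (rule ccontr)
  assume "g \<xi> \<notin> ellipsoid k m"
  then have ge: "defining_fun k m (g \<xi>) \<ge> 1" by (simp add: in_ellipsoid_iff)
  let ?q = "\<lambda>\<zeta>. cdot (defining_grad k m (g \<xi>)) (g \<zeta> - g \<xi>)"
  have "Re (?q \<xi>) < 0"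
  proof (rule disc_algebra_Re_negative[where f = ?q, OF _ _ \<xi>])
    show "disc_algebra ?q" by (intro disc_algebra_intros g)
    fix \<zeta> :: complex assume "cmod \<zeta> = 1"
    with bdry have "defining_fun k m (g \<zeta>) < 1" by (simp add: in_ellipsoid_iff)
    with ge defining_fun_above_tangent[OF m, of k "g \<xi>" "g \<zeta>"] show "Re (?q \<zeta>) < 0"
      by simp
  qed
  then show False by simp
qed

section \<open>Competing discs and elementary properties of the metric\<close>

definition kobayashi_disc ::
    "(complex ^ 'n) set \<Rightarrow> complex ^ 'n \<Rightarrow> complex ^ 'n \<Rightarrow> (complex \<Rightarrow> complex ^ 'n) \<Rightarrow> real \<Rightarrow> bool"
  where "kobayashi_disc D z v f r \<longleftrightarrow> holomorphic_map_on f (ball 0 r) \<and> f ` ball 0 r \<subseteq> D \<and>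
    f 0 = z \<and> (\<forall>i. deriv (\<lambda>\<zeta>. f \<zeta> $ i) 0 = v $ i)"

lemma kobayashi_metric_eq_Inf:
  "kobayashi_metric D z v = Inf {1 / r | r. r > 0 \<and> (\<exists>f. kobayashi_disc D z v f r)}"
  by (simp add: kobayashi_metric_def kobayashi_disc_def)

lemma kobayashi_disc_DERIV:
  fixes v :: "complex ^ 'n"
  assumes "kobayashi_disc D z v f r" "r > 0"
  shows "((\<lambda>\<zeta>. f \<zeta> $ i) has_field_derivative v $ i) (at 0)"
proof -
  have "(\<lambda>\<zeta>. f \<zeta> $ i) holomorphic_on ball 0 r" "deriv (\<lambda>\<zeta>. f \<zeta> $ i) 0 = v $ i"
    using assms(1) by (simp_all add: kobayashi_disc_def holomorphic_map_on_def)
  then show ?thesis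
    using assms(2) by (metis centre_in_ball holomorphic_derivI open_ball)
qed

lemma kobayashi_discI:
  fixes f :: "complex \<Rightarrow> complex ^ 'n" and v :: "complex ^ 'n"
  assumes "\<And>i. (\<lambda>\<zeta>. f \<zeta> $ i) holomorphic_on ball 0 r" "\<And>\<zeta>. cmod \<zeta> < r \<Longrightarrow> f \<zeta> \<in> D" "f 0 = z"
    "\<And>i. ((\<lambda>\<zeta>. f \<zeta> $ i) has_field_derivative v $ i) (at 0)"
  shows "kobayashi_disc D z v f r"
  using assms by (auto simp: kobayashi_disc_def holomorphic_map_on_def intro: DERIV_imp_deriv)

lemma kobayashi_disc_mono:
  assumes "kobayashi_disc D z v f r" "s \<le> r"
  shows "kobayashi_disc D z v f s"
proof -
  have "ball 0 s \<subseteq> ball (0::complex) r" using assms(2) by (simp add: subset_ball)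
  then show ?thesis using assms(1)
    unfolding kobayashi_disc_def holomorphic_map_on_def
    by (meson holomorphic_on_subset image_mono order_trans)
qed

lemma kobayashi_metric_le:
  assumes "kobayashi_disc D z v f r" "r > 0"
  shows "kobayashi_metric D z v \<le> 1 / r"
  unfolding kobayashi_metric_eq_Inf
  by (rule cInf_lower) (use assms in \<open>auto intro!: bdd_belowI[of _ 0]\<close>)

lemma norm_smult: "norm (c *s v) = cmod c * norm (v :: complex ^ 'n::finite)"
  by (simp add: norm_vec_def norm_mult L2_set_right_distrib)

lemma kobayashi_disc_exists:
  fixes z v :: "complex ^ 'n::finite"
  assumes "open D" "z \<in> D"
  shows "\<exists>r>0. \<exists>f. kobayashi_disc D z v f r"
proof -
  obtain e where e: "e > 0" "ball z e \<subseteq> D"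
    using assms openE by blast
  define r where "r = e / (norm v + 1)"
  have r: "r > 0" using e(1) by (auto simp: r_def intro!: divide_pos_pos add_nonneg_pos)
  have "kobayashi_disc D z v (\<lambda>\<zeta>. z + \<zeta> *s v) r"
  proof (rule kobayashi_discI)
    fix \<zeta> :: complex assume "cmod \<zeta> < r"
    then have "cmod \<zeta> * (norm v + 1) < e"
      unfolding r_def by (subst (asm) pos_less_divide_eq) (auto intro: add_nonneg_pos)
    moreover have "cmod \<zeta> * norm v \<le> cmod \<zeta> * (norm v + 1)"
      by (intro mult_left_mono) auto
    ultimately have "norm (\<zeta> *s v) < e" by (simp add: norm_smult)
    then show "z + \<zeta> *s v \<in> D" using e(2) by (auto simp: dist_norm)
  qed (auto intro!: holomorphic_intros derivative_eq_intros)
  with r show ?thesis by blast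
qed

lemma kobayashi_metric_greatest:
  fixes z v :: "complex ^ 'n::finite"
  assumes "open D" "z \<in> D" "\<And>f r. kobayashi_disc D z v f r \<Longrightarrow> r > 0 \<Longrightarrow> c \<le> 1 / r"
  shows "c \<le> kobayashi_metric D z v"
  unfolding kobayashi_metric_eq_Inf
proof (rule cInf_greatest)
  \<comment> \<open>The real infimum of the empty set carries no information, so an affine disc has
    to be supplied before the lower bound can be used.\<close>
  show "{1 / r | r. r > 0 \<and> (\<exists>f. kobayashi_disc D z v f r)} \<noteq> {}"
    using kobayashi_disc_exists[OF assms(1,2), of v] by auto
qed (use assms(3) in auto)

lemma kobayashi_metric_nonneg:
  fixes z v :: "complex ^ 'n::finite"
  assumes "open D" "z \<in> D" shows "0 \<le> kobayashi_metric D z v"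
  by (rule kobayashi_metric_greatest[OF assms]) auto

lemma kobayashi_metric_lessD:
  fixes z v :: "complex ^ 'n::finite"
  assumes "open D" "z \<in> D" "kobayashi_metric D z v < c"
  obtains f r where "kobayashi_disc D z v f r" "r > 1 / c" "c > 0"
proof -
  have "\<exists>x\<in>{1 / r | r. r > 0 \<and> (\<exists>f. kobayashi_disc D z v f r)}. x < c"
    using assms(3) unfolding kobayashi_metric_eq_Inf
    by (rule cInf_lessD[rotated]) (use kobayashi_disc_exists[OF assms(1,2), of v] in auto)
  then obtain r f where rf: "r > 0" "kobayashi_disc D z v f r" "1 / r < c" by auto
  then have "0 < 1 / r" by simp
  with rf(3) have "c > 0" by (rule less_trans[rotated])
  with rf have "r > 1 / c" by (simp add: field_simps)
  with rf \<open>c > 0\<close> show ?thesis by (intro that)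
qed

lemma kobayashi_metric_zero:
  fixes z :: "complex ^ 'n::finite"
  assumes "open D" "z \<in> D" shows "kobayashi_metric D z 0 = 0"
proof (rule antisym)
  have *: "kobayashi_metric D z 0 \<le> 1 / r" if "r > 0" for r
    using assms that by (intro kobayashi_metric_le[of _ _ _ "\<lambda>_. z"] kobayashi_discI) auto
  have "kobayashi_metric D z 0 \<le> e" if "e > 0" for e
    by (rule order_trans[OF *[of "1 / e"]]) (use that in simp_all)
  then show "kobayashi_metric D z 0 \<le> 0" by (rule field_le_epsilon) simp
qed (rule kobayashi_metric_nonneg[OF assms])

lemma kobayashi_disc_rescale:
  assumes "kobayashi_disc D z v f r" "r > 0" "c \<noteq> 0"
  shows "kobayashi_disc D z (c *s v) (\<lambda>\<zeta>. f (c * \<zeta>)) (r / cmod c)"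
proof (rule kobayashi_discI)
  have sub: "(\<lambda>\<zeta>. c * \<zeta>) ` ball 0 (r / cmod c) \<subseteq> ball 0 r"
    using assms(3) by (auto simp: norm_mult field_simps)
  fix i
  have hol: "(\<lambda>\<zeta>. f \<zeta> $ i) holomorphic_on ball 0 r"
    using assms(1) by (simp add: kobayashi_disc_def holomorphic_map_on_def)
  show "(\<lambda>\<zeta>. f (c * \<zeta>) $ i) holomorphic_on ball 0 (r / cmod c)"
    using holomorphic_on_compose_gen[OF _ hol sub] by (auto simp: o_def intro!: holomorphic_intros)
  show "((\<lambda>\<zeta>. f (c * \<zeta>) $ i) has_field_derivative (c *s v) $ i) (at 0)"
  proof -
    have "((\<lambda>\<zeta>. f \<zeta> $ i) has_field_derivative v $ i) (at (c * 0))"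
      using kobayashi_disc_DERIV[OF assms(1,2), of i] by simp
    from DERIV_chain2[OF this DERIV_cmult_Id[of c 0 UNIV]]
    show ?thesis by (simp only: vector_smult_component mult.commute[of c])
  qed
next
  fix \<zeta> assume "cmod \<zeta> < r / cmod c"
  then have "c * \<zeta> \<in> ball 0 r" using assms(3) by (auto simp: norm_mult field_simps)
  then show "f (c * \<zeta>) \<in> D" using assms(1) by (auto simp: kobayashi_disc_def)
next
  show "f (c * 0) = z" using assms(1) by (simp add: kobayashi_disc_def)
qed

lemma kobayashi_metric_smult:
  fixes z v :: "complex ^ 'n::finite"
  assumes D: "open D" "z \<in> D"
  shows "kobayashi_metric D z (c *s v) = cmod c * kobayashi_metric D z v"
proof (cases "c = 0")
  case True
  then show ?thesis using kobayashi_metric_zero[OF D] by simp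
next
  case False
  have le: "kobayashi_metric D z (c *s v) \<le> cmod c * kobayashi_metric D z v" if "c \<noteq> 0" for c v
  proof -
    have "kobayashi_metric D z (c *s v) / cmod c \<le> kobayashi_metric D z v"
    proof (rule kobayashi_metric_greatest[OF D])
      fix f r assume f: "kobayashi_disc D z v f r" "r > 0"
      then have "kobayashi_metric D z (c *s v) \<le> 1 / (r / cmod c)"
        using that by (intro kobayashi_metric_le[OF kobayashi_disc_rescale[OF f]]) auto
      then show "kobayashi_metric D z (c *s v) / cmod c \<le> 1 / r"
        using that f by (simp add: field_simps)
    qed
    then show ?thesis using that by (simp add: field_simps)
  qed
  have "kobayashi_metric D z (inverse c *s (c *s v)) \<le>
      cmod (inverse c) * kobayashi_metric D z (c *s v)"
    using False by (intro le) auto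
  moreover have "inverse c *s (c *s v) = v"
    using False by (simp add: vector_smult_assoc)
  ultimately have "kobayashi_metric D z v \<le> inverse (cmod c) * kobayashi_metric D z (c *s v)"
    by (simp add: norm_inverse)
  then have "cmod c * kobayashi_metric D z v \<le> kobayashi_metric D z (c *s v)"
    using False by (simp add: field_simps)
  with le[OF False, of v] show ?thesis by simp
qed

lemma kobayashi_metric_scaleR:
  fixes z v :: "complex ^ 'n::finite"
  assumes D: "open D" "z \<in> D" and c: "0 \<le> c"
  shows "kobayashi_metric D z (c *\<^sub>R v) = c * kobayashi_metric D z v"
proof -
  have "c *\<^sub>R v = of_real c *s v"
    by (simp add: vec_eq_iff) (simp add: scaleR_conv_of_real)
  then show ?thesis using kobayashi_metric_smult[OF D, of "of_real c" v] c by simp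
qed

text \<open>A value below \<open>c\<close> yields a disc of radius larger than \<open>1 / c\<close>,
  so both discs can be cut to the common radius \<open>1 / c\<close> before averaging. The infimum
  may fail to be attained, hence strict hypotheses and a weak conclusion. Base point and direction
  vary together, as the continuity of the derivative on the product requires.\<close>

lemma kobayashi_metric_quasiconvex:
  fixes z v w u :: "complex ^ 'n::finite"
  assumes D: "open D" "convex D" "z \<in> D" "w \<in> D" and s: "0 \<le> s" "s \<le> 1"
    and less: "kobayashi_metric D z v < c" "kobayashi_metric D w u < c"
  shows "kobayashi_metric D ((1 - s) *\<^sub>R z + s *\<^sub>R w) ((1 - s) *\<^sub>R v + s *\<^sub>R u) \<le> c"
proof -
  obtain f r where f: "kobayashi_disc D z v f r" "r > 1 / c" "c > 0"
    using kobayashi_metric_lessD[OF D(1,3) less(1)] .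
  obtain g r' where g: "kobayashi_disc D w u g r'" "r' > 1 / c"
    using kobayashi_metric_lessD[OF D(1,4) less(2)] .
  have f': "kobayashi_disc D z v f (1 / c)" and g': "kobayashi_disc D w u g (1 / c)"
    using f g kobayashi_disc_mono less_imp_le by blast+
  have c: "1 / c > 0" using f(3) by simp
  have scale: "(r *\<^sub>R x) = of_real r * x" for r :: real and x :: complex
    by (rule scaleR_conv_of_real)
  have "kobayashi_disc D ((1 - s) *\<^sub>R z + s *\<^sub>R w) ((1 - s) *\<^sub>R v + s *\<^sub>R u)
      (\<lambda>\<zeta>. (1 - s) *\<^sub>R f \<zeta> + s *\<^sub>R g \<zeta>) (1 / c)"
  proof (rule kobayashi_discI)
    fix i
    show "(\<lambda>\<zeta>. ((1 - s) *\<^sub>R f \<zeta> + s *\<^sub>R g \<zeta>) $ i) holomorphic_on ball 0 (1 / c)"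
      using f' g' unfolding kobayashi_disc_def holomorphic_map_on_def vector_add_component
        vector_scaleR_component scale
      by (intro holomorphic_intros) auto
    show "((\<lambda>\<zeta>. ((1 - s) *\<^sub>R f \<zeta> + s *\<^sub>R g \<zeta>) $ i) has_field_derivative
        ((1 - s) *\<^sub>R v + s *\<^sub>R u) $ i) (at 0)"
      unfolding vector_add_component vector_scaleR_component scale
      by (intro DERIV_add DERIV_cmult kobayashi_disc_DERIV[OF f' c] kobayashi_disc_DERIV[OF g' c])
  next
    fix \<zeta> :: complex assume "cmod \<zeta> < 1 / c"
    then have "f \<zeta> \<in> D" "g \<zeta> \<in> D" using f' g' by (auto simp: kobayashi_disc_def)
    then show "(1 - s) *\<^sub>R f \<zeta> + s *\<^sub>R g \<zeta> \<in> D"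
      using D(2) s by (simp add: convex_alt)
  qed (use f' g' in \<open>auto simp: kobayashi_disc_def\<close>)
  from kobayashi_metric_le[OF this c] show ?thesis using f(3) by simp
qed

subsection \<open>Stationary discs\<close>

lemma scaleR_eq_smult: "r *\<^sub>R w = of_real r *s (w :: complex ^ 'n)"
  unfolding vec_eq_iff vector_scaleR_component vector_smult_component
  by (simp add: scaleR_conv_of_real)

text \<open>\<open>h\<close> is the dual map of the disc: a holomorphic lift of the conormal
  direction twisted by \<zeta>. The uniform bound \<open>M\<close> on the multipliers stands in for
  their continuity and makes the estimate in \<open>kobayashi_metric_perturb\<close> uniform over
  the circle.\<close>

definition stationary_disc ::
    "'n::finite \<Rightarrow> real \<Rightarrow> (complex \<Rightarrow> complex ^ 'n) \<Rightarrow> (complex \<Rightarrow> complex ^ 'n) \<Rightarrow> bool"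
  where "stationary_disc k m f h \<longleftrightarrow> vec_disc_algebra f \<and> vec_disc_algebra h \<and>
    (\<exists>M. \<forall>\<zeta>. cmod \<zeta> = 1 \<longrightarrow> defining_fun k m (f \<zeta>) = 1 \<and>
      (\<exists>\<mu>>0. \<mu> \<le> M \<and> h \<zeta> = (of_real \<mu> * \<zeta>) *s defining_grad k m (f \<zeta>)))"

definition vec_deriv :: "(complex \<Rightarrow> complex ^ 'n) \<Rightarrow> complex \<Rightarrow> complex ^ 'n"
  where "vec_deriv f \<zeta> = (\<chi> i. deriv (\<lambda>\<zeta>. f \<zeta> $ i) \<zeta>)"

text \<open>The real part of the derivative at 0 of \<open>cdot (h \<zeta>) (g \<zeta>)\<close>, for
  any \<open>g\<close> with value \<open>fst X\<close> and derivative \<open>snd X\<close> at 0.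
  Divided by its value at \<open>(0, vec_deriv f 0)\<close> it becomes the derivative of the metric
  when \<open>m > 1 / 2\<close> and a suitable \<open>b\<close> exists.\<close>

definition disc_functional ::
    "(complex \<Rightarrow> complex ^ 'n::finite) \<Rightarrow> (complex ^ 'n) \<times> (complex ^ 'n) \<Rightarrow> real"
  where "disc_functional h X = Re (cdot (vec_deriv h 0) (fst X) + cdot (h 0) (snd X))"

lemma vec_disc_algebra_DERIV:
  fixes f :: "complex \<Rightarrow> complex ^ 'n"
  shows "vec_disc_algebra f \<Longrightarrow> cmod \<zeta> < 1 \<Longrightarrow>
    ((\<lambda>\<zeta>. f \<zeta> $ i) has_field_derivative vec_deriv f \<zeta> $ i) (at \<zeta>)"
  by (simp add: vec_deriv_def vec_disc_algebra_def disc_algebra_DERIV)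

lemma cdot_DERIV:
  fixes f h :: "complex \<Rightarrow> complex ^ 'n::finite" and f' h' :: "complex ^ 'n"
  assumes "\<And>i. ((\<lambda>\<zeta>. h \<zeta> $ i) has_field_derivative h' $ i) (at \<zeta>)"
    and "\<And>i. ((\<lambda>\<zeta>. f \<zeta> $ i) has_field_derivative f' $ i) (at \<zeta>)"
  shows "((\<lambda>\<zeta>. cdot (h \<zeta>) (f \<zeta>)) has_field_derivative cdot h' (f \<zeta>) + cdot (h \<zeta>) f') (at \<zeta>)"
proof -
  have "((\<lambda>\<zeta>. \<Sum>i\<in>UNIV. h \<zeta> $ i * f \<zeta> $ i) has_field_derivative
      (\<Sum>i\<in>UNIV. h' $ i * f \<zeta> $ i + f' $ i * h \<zeta> $ i)) (at \<zeta>)"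
    by (intro DERIV_sum DERIV_mult assms)
  then show ?thesis by (simp add: cdot_def sum.distrib mult.commute)
qed

lemma cnj_mult_self_unit: "cmod \<zeta> = 1 \<Longrightarrow> cnj \<zeta> * \<zeta> = 1"
  by (metis complex_norm_square mult.commute of_real_1 power_one)

text \<open>The factor \<open>cnj \<zeta>\<close> undoes the twist in \<open>h\<close>, leaving a
  positive multiple of the gradient at the boundary point \<open>f \<zeta>\<close>, which supports
  the ellipsoid there.\<close>

lemma stationary_disc_support:
  assumes m: "m \<ge> 1 / 2" and st: "stationary_disc k m f h" and w: "w \<in> ellipsoid k m"
    and \<zeta>: "cmod \<zeta> = 1"
  shows "Re (cnj \<zeta> * cdot (h \<zeta>) (w - f \<zeta>)) < 0"
proof -
  obtain \<mu> where \<mu>: "\<mu> > 0" "h \<zeta> = (of_real \<mu> * \<zeta>) *s defining_grad k m (f \<zeta>)"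
    and f: "defining_fun k m (f \<zeta>) = 1"
    using st \<zeta> unfolding stationary_disc_def by blast
  have "cnj \<zeta> * \<zeta> = 1" by (rule cnj_mult_self_unit[OF \<zeta>])
  then have "cnj \<zeta> * cdot (h \<zeta>) (w - f \<zeta>) = of_real \<mu> * cdot (defining_grad k m (f \<zeta>)) (w - f \<zeta>)"
    unfolding \<mu>(2) cdot_smult_left by (metis (no_types, lifting) mult.assoc mult.commute mult_1)
  moreover have "Re (cdot (defining_grad k m (f \<zeta>)) (w - f \<zeta>)) < 0"
    using defining_fun_above_tangent[OF m, of k "f \<zeta>" w] w f by (simp add: in_ellipsoid_iff)
  ultimately show ?thesis using \<mu>(1) by (simp add: mult_less_0_iff)
qed

text \<open>The simple pole of \<open>\<langle>h, g - f\<rangle> / \<zeta>\<close> at the origin is cancelled by \<open>\<beta> / \<zeta> - cnj \<beta> * \<zeta>\<close>, whose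
  real part vanishes on the unit circle.\<close>

lemma stationary_disc_extremal:
  assumes m: "m \<ge> 1 / 2" and st: "stationary_disc k m f h"
    and g: "kobayashi_disc (ellipsoid k m) z v g r" and r: "r > 1"
  shows "disc_functional h (z - f 0, v - vec_deriv f 0) < 0"
proof -
  have f: "vec_disc_algebra f" and h: "vec_disc_algebra h"
    using st by (auto simp: stationary_disc_def)
  \<comment> \<open>Since \<open>r > 1\<close>, the competitor is holomorphic across the unit circle
    and keeps it inside the open domain, so it lies in the disc algebra without further boundary
    regularity.\<close>
  have sub: "cball 0 1 \<subseteq> ball (0::complex) r" "ball 0 1 \<subseteq> ball (0::complex) r" using r by auto
  have g': "vec_disc_algebra g"
    using g sub unfolding kobayashi_disc_def holomorphic_map_on_def vec_disc_algebra_def disc_algebra_def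
    by (meson holomorphic_on_imp_continuous_on holomorphic_on_subset)
  have gE: "g \<zeta> \<in> ellipsoid k m" if "cmod \<zeta> = 1" for \<zeta>
    using g that r by (auto simp: kobayashi_disc_def)
  have g0: "g 0 = z" using g by (simp add: kobayashi_disc_def)
  let ?q = "\<lambda>\<zeta>. cdot (h \<zeta>) (g \<zeta> - f \<zeta>)"
  let ?Q = "\<lambda>\<zeta>. ?q \<zeta> + cnj (?q 0) * \<zeta>\<^sup>2"
  have Q: "disc_algebra ?Q" by (intro disc_algebra_intros f g' h)
  define R where "R = (\<lambda>\<zeta>. if \<zeta> = 0 then deriv ?Q 0 else (?Q \<zeta> - ?Q 0) / \<zeta>)"
  have "Re (R 0) < 0"
  proof (rule disc_algebra_Re_negative[where f = R])
    show "disc_algebra R" unfolding R_def by (rule disc_algebra_quotient[OF Q])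
    fix \<zeta> :: complex assume \<zeta>: "cmod \<zeta> = 1"
    have z0: "\<zeta> \<noteq> 0" using \<zeta> by auto
    then have inv: "1 / \<zeta> = cnj \<zeta>"
      using cnj_mult_self_unit[OF \<zeta>] by (simp add: divide_eq_eq)
    have "R \<zeta> = cnj \<zeta> * ?q \<zeta> + (cnj (?q 0) * \<zeta> - cnj (cnj (?q 0) * \<zeta>))"
    proof -
      have "R \<zeta> = (1 / \<zeta>) * ?q \<zeta> + (cnj (?q 0) * \<zeta> - (1 / \<zeta>) * ?q 0)"
        using z0 by (simp add: R_def field_simps power2_eq_square)
      then show ?thesis unfolding inv by simp
    qed
    then have "Re (R \<zeta>) = Re (cnj \<zeta> * ?q \<zeta>)" by simp
    also have "\<dots> < 0" by (rule stationary_disc_support[OF m st gE[OF \<zeta>] \<zeta>])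
    finally show "Re (R \<zeta>) < 0" .
  qed simp
  moreover have "(?q has_field_derivative
      cdot (vec_deriv h 0) (g 0 - f 0) + cdot (h 0) (v - vec_deriv f 0)) (at 0)"
  proof (rule cdot_DERIV)
    fix i
    show "((\<lambda>\<zeta>. h \<zeta> $ i) has_field_derivative vec_deriv h 0 $ i) (at 0)"
      by (rule vec_disc_algebra_DERIV[OF h]) simp
    have "((\<lambda>\<zeta>. f \<zeta> $ i) has_field_derivative vec_deriv f 0 $ i) (at 0)"
      by (rule vec_disc_algebra_DERIV[OF f]) simp
    moreover have "((\<lambda>\<zeta>. g \<zeta> $ i) has_field_derivative v $ i) (at 0)"
      using kobayashi_disc_DERIV[OF g] r by simp
    ultimately show "((\<lambda>\<zeta>. (g \<zeta> - f \<zeta>) $ i) has_field_derivative (v - vec_deriv f 0) $ i) (at 0)"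
      by (simp add: DERIV_diff)
  qed
  then have "(?Q has_field_derivative
      cdot (vec_deriv h 0) (z - f 0) + cdot (h 0) (v - vec_deriv f 0) + cnj (?q 0) * 0) (at 0)"
    unfolding g0 by (rule DERIV_add) (auto intro!: derivative_eq_intros)
  then have "R 0 = cdot (vec_deriv h 0) (z - f 0) + cdot (h 0) (v - vec_deriv f 0)"
    by (simp add: R_def DERIV_imp_deriv)
  ultimately show ?thesis by (simp add: disc_functional_def)
qed

lemma disc_functional_linear: "linear (disc_functional h)"
  by (rule linearI) (auto simp: disc_functional_def cdot_add_right cdot_scaleR_right algebra_simps)

text \<open>Extremality is tested against the constant disc at \<open>f 0\<close>, whose direction
  is 0; every radius larger than 1 would do.\<close>

lemma stationary_disc_positive:
  assumes m: "m \<ge> 1 / 2" and st: "stationary_disc k m f h" and z: "f 0 \<in> ellipsoid k m"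
  shows "disc_functional h (0, vec_deriv f 0) > 0"
proof -
  have "kobayashi_disc (ellipsoid k m) (f 0) 0 (\<lambda>_. f 0) 2"
    using z by (intro kobayashi_discI) auto
  from stationary_disc_extremal[OF m st this]
  show ?thesis by (simp add: disc_functional_def cdot_diff_right del: diff_0)
qed

text \<open>A disc of radius larger than \<open>1 / c\<close> is reparametrised to radius larger
  than 1, which divides its direction by \<open>c\<close>. Thus one real hyperplane supports the
  sublevel set of level 1 in the base point and the direction jointly.\<close>

lemma kobayashi_metric_support:
  assumes m: "m \<ge> 1 / 2" and st: "stationary_disc k m f h" and z: "z \<in> ellipsoid k m"
    and less: "kobayashi_metric (ellipsoid k m) z v < c"
  shows "disc_functional h (z - f 0, (1 / c) *\<^sub>R v - vec_deriv f 0) < 0"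
proof -
  have "open (ellipsoid k m)" using m by (intro open_ellipsoid) simp
  from kobayashi_metric_lessD[OF this z less]
  obtain g r where g: "kobayashi_disc (ellipsoid k m) z v g r" "r > 1 / c" "c > 0" .
  then have r: "r > 0" "r * c > 1" by (auto simp: field_simps intro: less_trans[of 0 "1 / c"])
  from kobayashi_disc_rescale[OF g(1) r(1), of "of_real (1 / c)"]
  have "kobayashi_disc (ellipsoid k m) z (of_real (1 / c) *s v) (\<lambda>\<zeta>. g (of_real (1 / c) * \<zeta>)) (r * c)"
    using g(3) by (simp add: norm_divide)
  from stationary_disc_extremal[OF m st this r(2)] show ?thesis
    by (simp only: scaleR_eq_smult)
qed

text \<open>If the value were below 1, the support inequality would read \<open>0 < 0\<close>. For
  the upper bound, \<open>f\<close> lies on the boundary along the circle, so it is contracted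
  towards the interior point \<open>f 0\<close>; the contractions are admissible and their
  directions \<open>(1 - \<epsilon>) *\<^sub>R vec_deriv f 0\<close> approach the given one.\<close>

lemma stationary_disc_kobayashi_eq_1:
  assumes m: "m \<ge> 1 / 2" and st: "stationary_disc k m f h" and z: "f 0 \<in> ellipsoid k m"
  shows "kobayashi_metric (ellipsoid k m) (f 0) (vec_deriv f 0) = 1"
proof -
  let ?E = "ellipsoid k m" and ?v = "vec_deriv f 0"
  let ?K = "kobayashi_metric ?E (f 0) ?v"
  have op: "open ?E" using m by (intro open_ellipsoid) simp
  have f: "vec_disc_algebra f" using st by (simp add: stationary_disc_def)
  have "1 \<le> ?K"
  proof (rule ccontr)
    assume "\<not> 1 \<le> ?K"
    then have "?K < 1" by simp
    from kobayashi_metric_support[OF m st z this] show False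
      by (simp add: disc_functional_def)
  qed
  moreover have bound: "(1 - \<epsilon>) * ?K \<le> 1" if \<epsilon>: "0 < \<epsilon>" "\<epsilon> < 1" for \<epsilon> :: real
  proof -
    let ?g = "\<lambda>\<zeta>. (of_real (1 - \<epsilon>)) *s f \<zeta> + (of_real \<epsilon>) *s f 0"
    note conv = scaleR_eq_smult[symmetric]
    have g: "vec_disc_algebra ?g" by (intro disc_algebra_intros f)
    have gE: "?g \<zeta> \<in> ?E" if "cmod \<zeta> \<le> 1" for \<zeta>
    proof (rule vec_disc_algebra_in_ellipsoid[OF m g _ that])
      fix \<zeta> :: complex assume "cmod \<zeta> = 1"
      then have "defining_fun k m (f \<zeta>) = 1" using st by (auto simp: stationary_disc_def)
      then have "defining_fun k m ((1 - \<epsilon>) *\<^sub>R f \<zeta> + \<epsilon> *\<^sub>R f 0) \<le> (1 - \<epsilon>) + \<epsilon> * defining_fun k m (f 0)"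
        using defining_fun_convex[OF m, of \<epsilon> k "f \<zeta>" "f 0"] \<epsilon> by simp
      also have "\<dots> < (1 - \<epsilon>) + \<epsilon> * 1"
        using z \<epsilon> by (intro add_strict_left_mono mult_strict_left_mono) (auto simp: in_ellipsoid_iff)
      finally show "?g \<zeta> \<in> ?E" unfolding conv by (simp add: in_ellipsoid_iff)
    qed
    have "kobayashi_disc ?E (f 0) ((1 - \<epsilon>) *\<^sub>R ?v) ?g 1"
    proof (rule kobayashi_discI)
      fix i
      show "(\<lambda>\<zeta>. ?g \<zeta> $ i) holomorphic_on ball 0 1"
        using g by (simp add: vec_disc_algebra_def disc_algebra_def)
      have fd: "((\<lambda>\<zeta>. f \<zeta> $ i) has_field_derivative ?v $ i) (at 0)"
        by (rule vec_disc_algebra_DERIV[OF f]) simp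
      show "((\<lambda>\<zeta>. ?g \<zeta> $ i) has_field_derivative ((1 - \<epsilon>) *\<^sub>R ?v) $ i) (at 0)"
        unfolding conv[symmetric] vector_add_component vector_smult_component
        using DERIV_add[OF DERIV_cmult[OF fd, of "of_real (1 - \<epsilon>)"] DERIV_const[of "of_real \<epsilon> * f 0 $ i"]]
        by simp
    next
      show "?g 0 = f 0" unfolding conv by (simp add: algebra_simps)
    qed (use gE in auto)
    then have "kobayashi_metric ?E (f 0) ((1 - \<epsilon>) *\<^sub>R ?v) \<le> 1"
      using kobayashi_metric_le[of ?E "f 0" _ ?g 1] by simp
    then show ?thesis using kobayashi_metric_scaleR[OF op z, of "1 - \<epsilon>"] \<epsilon> by simp
  qed
  have "?K \<le> 1"
  proof (rule ccontr)
    assume "\<not> ?K \<le> 1"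
    then have K: "?K > 1" by simp
    \<comment> \<open>This choice makes \<open>(1 - \<epsilon>) * K\<close> the midpoint of 1 and
      \<open>K\<close>, contradicting \<open>bound\<close>.\<close>
    define \<epsilon> where "\<epsilon> = (?K - 1) / (2 * ?K)"
    have "0 < \<epsilon>" "\<epsilon> < 1" using K by (auto simp: \<epsilon>_def field_simps)
    from bound[OF this] have "?K - \<epsilon> * ?K \<le> 1" by (simp add: algebra_simps)
    moreover have "\<epsilon> * ?K = (?K - 1) / 2" using K by (simp add: \<epsilon>_def)
    ultimately have "?K - (?K - 1) / 2 \<le> 1" by simp
    then have "?K \<le> 1" by (simp only: diff_divide_distrib)
    with K show False by simp
  qed
  ultimately show ?thesis by simp
qed

subsection \<open>Differentiability of homogeneous functions with convex sublevel sets\<close>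

text \<open>By homogeneity, comparing \<open>K (z, v)\<close> with \<open>k\<close> is comparing
  \<open>K (z, v / k)\<close> with 1. The displacement \<open>Y\<close> of the rescaled point
  satisfies \<open>L Y = L X - (k - 1) * L (0, v0)\<close> up to an error quadratic in
  \<open>X\<close>. Taking for \<open>k\<close> the first-order prediction plus or minus
  \<open>e * norm X\<close> therefore fixes the sign of \<open>L Y\<close>. Hypothesis
  \<open>lower\<close> confines the set where \<open>K\<close> is below 1 to a half-space, and
  \<open>upper\<close> says that narrower cones locally lie in the set where \<open>K\<close> is at
  most 1.\<close>

lemma homogeneous_has_derivative:
  fixes K :: "'a::real_normed_vector \<times> 'b::real_normed_vector \<Rightarrow> real"
  assumes D: "open D" "z0 \<in> D" and L: "bounded_linear L" and \<kappa>: "L (0, v0) > 0"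
    and hom: "\<And>z v c. z \<in> D \<Longrightarrow> c > 0 \<Longrightarrow> K (z, c *\<^sub>R v) = c * K (z, v)"
    and K0: "K (z0, v0) = 1"
    and lower: "\<And>z v c. z \<in> D \<Longrightarrow> c > 0 \<Longrightarrow> K (z, v) < c \<Longrightarrow> L (z - z0, (1 / c) *\<^sub>R v - v0) \<le> 0"
    and upper: "\<And>\<delta>. \<delta> > 0 \<Longrightarrow> \<exists>\<eta>>0. \<forall>X. norm X < \<eta> \<and> L X \<le> - \<delta> * norm X \<longrightarrow> K ((z0, v0) + X) \<le> 1"
  shows "(K has_derivative (\<lambda>X. L X / L (0, v0))) (at (z0, v0))"
proof -
  define \<kappa> where "\<kappa> = L (0, v0)"
  have \<kappa>0: "\<kappa> > 0" using \<kappa> by (simp add: \<kappa>_def)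
  interpret L: bounded_linear L by (rule L)
  obtain B where B: "B > 0" "\<And>X. \<bar>L X\<bar> \<le> norm X * B"
    using L.pos_bounded by auto
  have "\<exists>d>0. \<forall>y. norm (y - (z0, v0)) < d \<longrightarrow>
      norm (K y - K (z0, v0) - L (y - (z0, v0)) / \<kappa>) \<le> e * norm (y - (z0, v0))" if e: "e > 0" for e
  proof -
    \<comment> \<open>\<open>C3 * n\<close> bounds the distance from \<open>k\<close> to 1,
      \<open>C2 * n\<^sup>2\<close> the error in \<open>L Y\<close>, and \<open>C1 * n\<close> the
      norm of \<open>Y\<close>. The opening \<delta> of the cone is such that
      \<open>\<delta> * norm Y\<close> is at most the half of \<open>e * \<kappa> * n\<close> that
      remains after the quadratic error.\<close>
    define C3 where "C3 = B / \<kappa> + e"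
    define C2 where "C2 = 2 * C3 * (\<kappa> * C3 + B)"
    define C1 where "C1 = 3 + 2 * C3 * norm v0"
    define \<delta> where "\<delta> = e * \<kappa> / (2 * C1)"
    have C3: "C3 > 0" using B(1) e \<kappa>0 by (simp add: C3_def add_pos_pos)
    have C2: "C2 > 0" using C3 B(1) \<kappa>0 by (simp add: C2_def add_pos_pos)
    have C1: "C1 > 0" using C3 by (simp add: C1_def add_pos_nonneg)
    have \<delta>: "\<delta> > 0" "\<delta> * C1 = e * \<kappa> / 2" using e \<kappa>0 C1 by (auto simp: \<delta>_def)
    obtain \<eta> where \<eta>: "\<eta> > 0" "\<And>X. norm X < \<eta> \<Longrightarrow> L X \<le> - \<delta> * norm X \<Longrightarrow> K ((z0, v0) + X) \<le> 1"
      using upper[OF \<delta>(1)] by blast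
    obtain d0 where d0: "d0 > 0" "ball z0 d0 \<subseteq> D" using D openE by blast
    \<comment> \<open>The four bounds keep the base point in \<open>D\<close>, keep \<open>k\<close>
      at least \<open>1 / 2\<close>, make the quadratic error at most
      \<open>e * \<kappa> * n / 2\<close>, and keep \<open>Y\<close> in the range where
      \<open>upper\<close> applies.\<close>
    define d where "d = Min {d0, 1 / (2 * C3), e * \<kappa> / (2 * C2), \<eta> / C1}"
    have d: "d > 0" "d \<le> d0" "d \<le> 1 / (2 * C3)" "d \<le> e * \<kappa> / (2 * C2)" "d \<le> \<eta> / C1"
      using d0 C1 C2 C3 e \<kappa>0 \<eta> by (auto simp: d_def)
    have main: "\<bar>K ((z0, v0) + X) - 1 - L X / \<kappa>\<bar> \<le> e * norm X" if X: "norm X < d" "X \<noteq> 0" for X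
    proof -
      define n where "n = norm X"
      have n: "n > 0" "n < d" using X by (auto simp: n_def)
      obtain a b where ab: "X = (a, b)" by (cases X)
      have na: "norm a \<le> n" "norm b \<le> n" unfolding n_def ab by (auto intro: norm_fst_le norm_snd_le)
      have aD: "z0 + a \<in> D" using na(1) n(2) d(2) d0(2) by (auto simp: dist_norm)
      have LX: "\<bar>L X\<bar> \<le> B * n" using B(2)[of X] by (simp add: n_def mult.commute)
      have C3n: "C3 * n \<le> 1 / 2"
        using mult_left_mono[of n "1 / (2 * C3)" C3] n(2) d(3) C3 by simp
      have C2n: "C2 * n\<^sup>2 \<le> e * \<kappa> * n / 2"
      proof -
        have "C2 * n \<le> e * \<kappa> / 2"
          using mult_left_mono[of n "e * \<kappa> / (2 * C2)" C2] n(2) d(4) C2 by simp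
        from mult_right_mono[OF this, of n] n(1) show ?thesis by (simp add: power2_eq_square algebra_simps)
      qed
      have Y: "k > 0" "\<bar>L Y - (L X - (k - 1) * \<kappa>)\<bar> \<le> C2 * n\<^sup>2" "norm Y \<le> C1 * n"
        if k: "\<bar>k - 1\<bar> \<le> C3 * n" and Y: "Y = (a, (1 / k) *\<^sub>R (v0 + b) - v0)" for k Y
      proof -
        have k2: "k \<ge> 1 / 2" using k C3n by linarith
        then show k0: "k > 0" by simp
        have LY: "L Y = L X + (1 / k - 1) * (\<kappa> + L (0, b))"
        proof -
          have "Y = X + (1 / k - 1) *\<^sub>R ((0, v0) + (0, b))"
            unfolding Y ab by (simp add: algebra_simps)
          then show ?thesis by (simp only: L.add L.scaleR \<kappa>_def real_scaleR_def)
        qed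
        have "L Y - (L X - (k - 1) * \<kappa>) = ((k - 1) * ((k - 1) * \<kappa> - L (0, b))) / k"
          unfolding LY using k0 by (simp add: field_simps)
        then have "\<bar>L Y - (L X - (k - 1) * \<kappa>)\<bar> = \<bar>k - 1\<bar> * \<bar>(k - 1) * \<kappa> - L (0, b)\<bar> / k"
          using k0 by (simp add: abs_mult)
        also have "\<dots> \<le> (C3 * n) * (C3 * n * \<kappa> + B * n) / (1 / 2)"
        proof (intro frac_le mult_mono)
          have "\<bar>L (0, b)\<bar> \<le> B * n"
          proof -
            have "\<bar>L (0, b)\<bar> \<le> norm b * B" using B(2)[of "(0, b)"] by (simp add: norm_Pair)
            also have "\<dots> \<le> n * B" using na B(1) by (intro mult_right_mono) auto
            finally show ?thesis by (simp add: mult.commute)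
          qed
          moreover have "\<bar>(k - 1) * \<kappa>\<bar> \<le> C3 * n * \<kappa>"
            using k \<kappa>0 by (simp add: abs_mult mult_right_mono)
          ultimately show "\<bar>(k - 1) * \<kappa> - L (0, b)\<bar> \<le> C3 * n * \<kappa> + B * n" by linarith
        qed (use k k2 C3 n B(1) \<kappa>0 in auto)
        also have "\<dots> = C2 * n\<^sup>2" by (simp add: C2_def power2_eq_square algebra_simps)
        finally show "\<bar>L Y - (L X - (k - 1) * \<kappa>)\<bar> \<le> C2 * n\<^sup>2" .
        have "(1 / k) *\<^sub>R (v0 + b) - v0 = (1 / k) *\<^sub>R (b - (k - 1) *\<^sub>R v0)"
          using k0 by (simp add: algebra_simps)
        then have "norm ((1 / k) *\<^sub>R (v0 + b) - v0) = (1 / k) * norm (b - (k - 1) *\<^sub>R v0)"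
          using k0 by simp
        also have "\<dots> \<le> 2 * (n + C3 * n * norm v0)"
        proof (rule mult_mono)
          have "norm (b - (k - 1) *\<^sub>R v0) \<le> norm b + \<bar>k - 1\<bar> * norm v0"
            by (rule order_trans[OF norm_triangle_ineq4]) simp
          also have "\<dots> \<le> n + C3 * n * norm v0"
            using na k by (intro add_mono mult_right_mono) auto
          finally show "norm (b - (k - 1) *\<^sub>R v0) \<le> n + C3 * n * norm v0" .
        qed (use k2 k0 in \<open>auto simp: field_simps\<close>)
        finally have "norm ((1 / k) *\<^sub>R (v0 + b) - v0) \<le> 2 * (n + C3 * n * norm v0)" .
        moreover have "norm Y \<le> norm a + norm ((1 / k) *\<^sub>R (v0 + b) - v0)"
          unfolding Y by (rule norm_Pair_le)
        ultimately show "norm Y \<le> C1 * n"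
          using na(1) by (simp add: C1_def algebra_simps)
      qed
      have kbound: "\<bar>L X / \<kappa> + s\<bar> \<le> C3 * n" if "\<bar>s\<bar> \<le> e * n" for s
      proof -
        have "\<bar>L X / \<kappa>\<bar> \<le> B / \<kappa> * n" using LX \<kappa>0 by (simp add: field_simps)
        then show ?thesis using that unfolding C3_def distrib_right by linarith
      qed
      have "K ((z0, v0) + X) \<le> 1 + L X / \<kappa> + e * n"
      proof -
        define k where "k = 1 + L X / \<kappa> + e * n"
        define Y where "Y = (a, (1 / k) *\<^sub>R (v0 + b) - v0)"
        have "\<bar>k - 1\<bar> \<le> C3 * n" using kbound[of "e * n"] e n by (simp add: k_def)
        note Yk = Y[OF this Y_def]
        have "(k - 1) * \<kappa> = L X + e * n * \<kappa>" using \<kappa>0 by (simp add: k_def field_simps)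
        then have "L Y \<le> - (e * \<kappa> * n / 2)" using Yk(2) C2n by (simp add: algebra_simps)
        also have "\<dots> \<le> - \<delta> * norm Y"
          using mult_left_mono[OF Yk(3), of \<delta>] \<delta> by (simp add: mult.assoc[symmetric])
        finally have "L Y \<le> - \<delta> * norm Y" .
        moreover have "norm Y < \<eta>"
        proof -
          have "C1 * n < \<eta>"
            using mult_strict_left_mono[of n "\<eta> / C1" C1] n(2) d(5) C1 by simp
          with Yk(3) show ?thesis by simp
        qed
        ultimately have "K ((z0, v0) + Y) \<le> 1" using \<eta>(2) by blast
        then have "k * K (z0 + a, (1 / k) *\<^sub>R (v0 + b)) \<le> k"
          using Yk(1) by (simp add: Y_def)
        moreover have "K (z0 + a, k *\<^sub>R ((1 / k) *\<^sub>R (v0 + b))) = k * K (z0 + a, (1 / k) *\<^sub>R (v0 + b))"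
          by (rule hom[OF aD Yk(1)])
        ultimately show ?thesis using Yk(1) by (simp add: ab k_def)
      qed
      moreover have "K ((z0, v0) + X) \<ge> 1 + L X / \<kappa> - e * n"
      proof (rule ccontr)
        assume neg: "\<not> ?thesis"
        define k where "k = 1 + L X / \<kappa> - e * n"
        define Y where "Y = (a, (1 / k) *\<^sub>R (v0 + b) - v0)"
        have less: "K (z0 + a, v0 + b) < k" using neg by (simp add: k_def ab)
        have "\<bar>k - 1\<bar> \<le> C3 * n" using kbound[of "- (e * n)"] e n by (simp add: k_def)
        note Yk = Y[OF this Y_def]
        have "(k - 1) * \<kappa> = L X - e * n * \<kappa>" using \<kappa>0 by (simp add: k_def field_simps)
        then have "L Y \<ge> e * \<kappa> * n / 2" using Yk(2) C2n by (simp add: algebra_simps)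
        moreover have "L Y \<le> 0" using lower[OF aD Yk(1) less] by (simp add: Y_def)
        moreover have "e * \<kappa> * n > 0" using e \<kappa>0 n by simp
        ultimately show False by linarith
      qed
      ultimately show ?thesis unfolding n_def by linarith
    qed
    show ?thesis
    proof (intro exI conjI allI impI)
      fix y assume y: "norm (y - (z0, v0)) < d"
      show "norm (K y - K (z0, v0) - L (y - (z0, v0)) / \<kappa>) \<le> e * norm (y - (z0, v0))"
      proof (cases "y = (z0, v0)")
        case False
        then show ?thesis using main[OF y] K0 by simp
      qed (simp add: L.zero)
    qed (rule d(1))
  qed
  moreover have "bounded_linear (\<lambda>X. L X / \<kappa>)"
    by (rule bounded_linear_compose[OF bounded_linear_divide L])
  ultimately show ?thesis
    unfolding has_derivative_at_alt \<kappa>_def by blast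
qed

lemma has_derivative_directional:
  fixes f :: "'a::real_normed_vector \<Rightarrow> real"
  assumes "(f has_derivative f') (at x)"
  shows "((\<lambda>s. f (x + s *\<^sub>R h)) has_real_derivative f' h) (at 0)"
proof -
  have "((\<lambda>s::real. x + s *\<^sub>R h) has_derivative (\<lambda>s. s *\<^sub>R h)) (at 0)"
    by (auto intro!: derivative_eq_intros)
  from has_derivative_compose[OF this] assms
  have "((\<lambda>s. f (x + s *\<^sub>R h)) has_derivative (\<lambda>s. f' (s *\<^sub>R h))) (at 0)" by simp
  moreover have "(\<lambda>s. f' (s *\<^sub>R h)) = (*) (f' h)"
    by (rule ext) (simp add: linear_scale[OF has_derivative_linear[OF assms]])
  ultimately show ?thesis by (simp add: has_field_derivative_def)
qed

lemma quasiconvex_support: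
  fixes K :: "'a::real_normed_vector \<Rightarrow> real"
  assumes K': "(K has_derivative K') (at x)"
    and le: "\<And>s. 0 < s \<Longrightarrow> s \<le> 1 \<Longrightarrow> K (x + s *\<^sub>R h) \<le> K x"
  shows "K' h \<le> 0"
proof (rule ccontr)
  assume "\<not> K' h \<le> 0"
  then obtain d where d: "d > 0" "\<And>s. 0 < s \<Longrightarrow> s < d \<Longrightarrow> K (x + 0 *\<^sub>R h) < K (x + (0 + s) *\<^sub>R h)"
    using DERIV_pos_inc_right[OF has_derivative_directional[OF K', of h]] by auto
  have "0 < min 1 (d / 2)" "min 1 (d / 2) < d" "min 1 (d / 2) \<le> 1" using d(1) by auto
  with d(2)[of "min 1 (d / 2)"] le[of "min 1 (d / 2)"] show False by simp
qed

text \<open>A differentiable convex function is continuously differentiable because its difference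
  quotients dominate its derivatives. Here \<open>K\<close> is only quasiconvex, but scaling the
  second component of \<open>y\<close> moves it to the level of \<open>x\<close>, and the support
  inequality there becomes \<open>semiconvex\<close>: convexity up to a locally uniform quadratic
  error. That is enough for the same comparison of difference quotients at neighbouring
  points.\<close>

lemma quasiconvex_homogeneous_continuous_derivative:
  fixes K :: "'a::real_normed_vector \<times> 'b::real_normed_vector \<Rightarrow> real"
  assumes D: "open D"
    and K': "\<And>x. x \<in> D \<times> (UNIV - {0}) \<Longrightarrow> (K has_derivative blinfun_apply (K' x)) (at x)"
    and hom: "\<And>z v c. z \<in> D \<Longrightarrow> c > 0 \<Longrightarrow> K (z, c *\<^sub>R v) = c * K (z, v)"
    and pos: "\<And>z v. z \<in> D \<Longrightarrow> v \<noteq> 0 \<Longrightarrow> K (z, v) > 0"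
    and quasi: "\<And>x y c s. fst x \<in> D \<Longrightarrow> fst y \<in> D \<Longrightarrow> K x < c \<Longrightarrow> K y < c \<Longrightarrow> 0 \<le> s \<Longrightarrow> s \<le> 1 \<Longrightarrow>
      K ((1 - s) *\<^sub>R x + s *\<^sub>R y) \<le> c"
  shows "continuous_on (D \<times> (UNIV - {0})) K'"
proof -
  define U where "U = D \<times> (UNIV - {0 :: 'b})"
  have openU: "open U" unfolding U_def using D by (intro open_Times) auto
  note K' = K'[folded U_def]
  have contK: "isCont K x" if "x \<in> U" for x
    using K'[OF that] by (rule has_derivative_continuous)
  have posU: "K x > 0" if "x \<in> U" for x
    using pos that by (cases x) (auto simp: U_def)
  have supp: "K' x (y - x) \<le> 0" if x: "x \<in> U" and y: "fst y \<in> D" "K y \<le> K x" for x y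
  proof (rule quasiconvex_support[OF K'[OF x]])
    fix s :: real assume s: "0 < s" "s \<le> 1"
    have "K (x + s *\<^sub>R (y - x)) \<le> K x + e" if "e > 0" for e
      using quasi[of x y "K x + e" s] x y s that by (auto simp: U_def algebra_simps)
    then show "K (x + s *\<^sub>R (y - x)) \<le> K x" by (rule field_le_epsilon)
  qed
  have euler: "K' x (0, snd x) = K x" if x: "x \<in> U" for x
  proof -
    obtain z v where zv: "x = (z, v)" by (cases x)
    have "((\<lambda>s. (1 + s) * K x) has_real_derivative K' x (0, snd x)) (at 0)"
    proof (rule has_field_derivative_transform_within_open)
      show "((\<lambda>s. K (x + s *\<^sub>R (0, snd x))) has_real_derivative K' x (0, snd x)) (at 0)"
        by (rule has_derivative_directional[OF K'[OF x]])
      show "open {-1 <..< (1::real)}" "0 \<in> {-1 <..< (1::real)}" by auto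
      fix s :: real assume "s \<in> {-1 <..< 1}"
      then have "K (z, (1 + s) *\<^sub>R v) = (1 + s) * K (z, v)"
        using x by (intro hom) (auto simp: zv U_def)
      then show "K (x + s *\<^sub>R (0, snd x)) = (1 + s) * K x"
        by (simp add: zv algebra_simps)
    qed
    moreover have "((\<lambda>s. (1 + s) * K x) has_real_derivative K x) (at 0)"
      by (auto intro!: derivative_eq_intros)
    ultimately show ?thesis by (rule DERIV_unique)
  qed
  have "isCont K' x0" if x0: "x0 \<in> U" for x0
  proof -
    define z0 v0 where "z0 = fst x0" and "v0 = snd x0"
    have x0eq: "x0 = (z0, v0)" by (simp add: z0_def v0_def)
    define k0 where "k0 = K x0"
    have k0: "k0 > 0" using posU[OF x0] by (simp add: k0_def)
    \<comment> \<open>Halving the vector halves \<open>K\<close>, and the threshold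
      \<open>2 / 3 * k0\<close> separates the values near \<open>y0\<close> from those near
      \<open>x0\<close>. So a fixed ball around \<open>y0\<close> lies in the sublevel set of every
      \<open>x\<close> near \<open>x0\<close>; together with the Euler identity the support
      inequality then bounds \<open>K' x\<close> uniformly.\<close>
    define y0 where "y0 = (z0, (1 / 2) *\<^sub>R v0)"
    have y0U: "y0 \<in> U" using x0 by (auto simp: y0_def U_def x0eq)
    have "K y0 = k0 / 2" using hom[of z0 "1 / 2" v0] x0 by (simp add: y0_def k0_def x0eq U_def)
    have "eventually (\<lambda>x. x \<in> U \<and> 2 / 3 * k0 < K x \<and> K x < 2 * k0) (nhds x0)"
      using openU x0 k0 contK[OF x0] unfolding isCont_def tendsto_at_iff_tendsto_nhds
      by (intro eventually_conj eventually_nhds_in_open order_tendstoD[where f = K and y = "K x0"])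
         (auto simp: k0_def)
    then obtain r1 where r1: "r1 > 0"
      "\<And>x. dist x x0 < r1 \<Longrightarrow> x \<in> U \<and> 2 / 3 * k0 < K x \<and> K x < 2 * k0"
      unfolding eventually_nhds_metric by blast
    have "eventually (\<lambda>y. y \<in> U \<and> K y < 2 / 3 * k0) (nhds y0)"
      using openU y0U k0 contK[OF y0U] \<open>K y0 = k0 / 2\<close> unfolding isCont_def tendsto_at_iff_tendsto_nhds
      by (intro eventually_conj eventually_nhds_in_open order_tendstoD[where f = K and y = "K y0"])
         auto
    then obtain r2 where r2: "r2 > 0" "\<And>y. dist y y0 < r2 \<Longrightarrow> y \<in> U \<and> K y < 2 / 3 * k0"
      unfolding eventually_nhds_metric by blast
    define r where "r = min r1 (r2 / 2)"
    have r: "r > 0" "r \<le> r1" "2 * r \<le> r2" using r1 r2 by (auto simp: r_def)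
    define M where "M = 2 * k0 / r"
    have M0: "M > 0" using k0 r by (simp add: M_def)
    have inball: "x \<in> U" "2 / 3 * k0 < K x" "K x < 2 * k0" if "dist x x0 < r" for x
      using r1(2)[of x] that r by auto
    have bound: "norm (K' x) \<le> M" if x: "dist x x0 < r" for x
    proof (rule norm_blinfun_bound)
      fix h
      have small: "K' x h \<le> k0" if h: "norm h < r" for h
      proof -
        define y where "y = (fst x, (1 / 2) *\<^sub>R snd x) + h"
        have "y - y0 = (fst x - z0, (1 / 2) *\<^sub>R (snd x - v0)) + h"
          by (simp add: y_def y0_def algebra_simps)
        then have "norm (y - y0) \<le> norm (fst x - z0, (1 / 2) *\<^sub>R (snd x - v0)) + norm h"
          by (metis norm_triangle_ineq)
        also have "norm (fst x - z0, (1 / 2) *\<^sub>R (snd x - v0)) \<le> norm (fst x - z0, snd x - v0)"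
          unfolding norm_Pair by (intro real_sqrt_le_mono add_mono power_mono) auto
        also have "(fst x - z0, snd x - v0) = x - x0" by (simp add: z0_def v0_def prod_eq_iff)
        finally have "dist y y0 < r2" using x h r by (simp add: dist_norm)
        then have y: "y \<in> U" "K y < 2 / 3 * k0" using r2(2) by auto
        have "K' x (y - x) \<le> 0"
          using y inball[OF x] by (intro supp) (auto simp: U_def)
        moreover have "y - x = h - (1 / 2) *\<^sub>R (0, snd x)"
        proof -
          have "(1 / 2) *\<^sub>R snd x - snd x = (1 / 2 - 1) *\<^sub>R snd x"
            by (simp only: scaleR_left_diff_distrib scaleR_one)
          then have "(1 / 2) *\<^sub>R snd x - snd x = - ((1 / 2) *\<^sub>R snd x)" by simp
          then show ?thesis
            unfolding y_def by (simp add: prod_eq_iff)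
        qed
        ultimately have "K' x h - 1 / 2 * K' x (0, snd x) \<le> 0"
          by (simp only: blinfun.diff_right blinfun.scaleR_right real_scaleR_def)
        then have "K' x h \<le> K x / 2"
          using euler[OF inball(1)[OF x]] by simp
        then show ?thesis using inball(3)[OF x] by simp
      qed
      show "norm (K' x h) \<le> M * norm h"
      proof (cases "h = 0")
        case False
        define c where "c = r / (2 * norm h)"
        have c: "c > 0" "norm (c *\<^sub>R h) < r" "norm (c *\<^sub>R (- h)) < r"
          using False r by (auto simp: c_def)
        have "c * K' x h \<le> k0" "- (c * K' x h) \<le> k0"
          using small[OF c(2)] small[OF c(3)]
          by (auto simp: blinfun.scaleR_right blinfun.minus_right)
        then have "c * \<bar>K' x h\<bar> \<le> k0" using c(1) by (simp add: abs_if split: if_splits)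
        then have "\<bar>K' x h\<bar> \<le> k0 / c" using c(1) by (simp add: field_simps)
        also have "k0 / c = M * norm h" using False r by (simp add: c_def M_def)
        finally show ?thesis by simp
      qed (simp add: blinfun.zero_right)
    qed (use M0 in simp)
    have lip: "\<bar>K y - K x\<bar> \<le> M * norm (y - x)" if "dist x x0 < r" "dist y x0 < r" for x y
    proof -
      have "norm (K y - K x) \<le> M * norm (y - x)"
      proof (rule differentiable_bound[of "ball x0 r" K "\<lambda>x. blinfun_apply (K' x)"])
        fix x assume x: "x \<in> ball x0 r"
        then have "dist x x0 < r" by (simp add: dist_commute)
        then show "(K has_derivative blinfun_apply (K' x)) (at x within ball x0 r)"
          using has_derivative_at_withinI[OF K'[OF inball(1)]] by blast
        show "onorm (blinfun_apply (K' x)) \<le> M"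
          using bound[of x] \<open>dist x x0 < r\<close> by (simp add: norm_blinfun.rep_eq)
      qed (use that in \<open>auto simp: dist_commute\<close>)
      then show ?thesis by simp
    qed
    define C where "C = 2 * M\<^sup>2 / (2 / 3 * k0)"
    have C0: "C > 0" using M0 k0 by (simp add: C_def)
    have semiconvex: "K' x (y - x) \<le> K y - K x + C * (norm (y - x))\<^sup>2"
      if x: "dist x x0 < r" and y: "dist y x0 < r" for x y
    proof -
      \<comment> \<open>With this factor \<open>y'\<close> has the same value as \<open>x\<close>.
        The correction from \<open>y'\<close> back to \<open>y\<close> is of first order; by the
        Euler identity its main part is \<open>K y - K x\<close>, and the rest is quadratic.\<close>
      define l where "l = K x / K y"
      define y' where "y' = (fst y, l *\<^sub>R snd y)"
      have Ky: "K y > 2 / 3 * k0" "K y > 0" "K x > 0" using inball[OF y] inball[OF x] k0 by auto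
      then have "l > 0" by (simp add: l_def)
      have "K y' = K x"
        using hom[of "fst y" l "snd y"] inball(1)[OF y] \<open>l > 0\<close> Ky
        by (auto simp: y'_def U_def l_def)
      then have "K' x (y' - x) \<le> 0"
        using inball(1)[OF y] by (intro supp inball(1)[OF x]) (auto simp: y'_def U_def)
      moreover have "y - x = (y' - x) + (1 - l) *\<^sub>R ((0, snd x) + (0, snd y - snd x))"
        by (simp add: y'_def prod_eq_iff algebra_simps)
      ultimately have "K' x (y - x) \<le> (1 - l) * (K x + K' x (0, snd y - snd x))"
        by (simp only: blinfun.add_right blinfun.scaleR_right euler[OF inball(1)[OF x]]
          real_scaleR_def)
      also have "\<dots> = (K y - K x) + (K y - K x) * (K x - K y + K' x (0, snd y - snd x)) / K y"
        using Ky by (simp add: l_def field_simps)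
      also have "(K y - K x) * (K x - K y + K' x (0, snd y - snd x)) / K y \<le>
          (M * norm (y - x)) * (2 * M * norm (y - x)) / (2 / 3 * k0)"
      proof -
        have "\<bar>K' x (0, snd y - snd x)\<bar> \<le> M * norm (y - x)"
        proof -
          have "\<bar>K' x (0, snd y - snd x)\<bar> \<le> norm (K' x) * norm (0 :: 'a, snd y - snd x)"
            using norm_blinfun[of "K' x" "(0, snd y - snd x)"] by simp
          also have "\<dots> \<le> M * norm (y - x)"
          proof (intro mult_mono bound[OF x])
            show "norm (0 :: 'a, snd y - snd x) \<le> norm (y - x)"
              using norm_snd_le[of "snd y - snd x" "fst y - fst x"]
              by (simp add: norm_Pair1 minus_prod_def split: prod.split)
          qed (use M0 in auto)
          finally show ?thesis .
        qed
        with lip[OF x y] have "\<bar>K x - K y + K' x (0, snd y - snd x)\<bar> \<le> 2 * M * norm (y - x)"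
          by linarith
        then have "\<bar>K y - K x\<bar> * \<bar>K x - K y + K' x (0, snd y - snd x)\<bar> / K y \<le>
            (M * norm (y - x)) * (2 * M * norm (y - x)) / (2 / 3 * k0)"
          using lip[OF x y] Ky k0 M0 by (intro frac_le mult_mono) auto
        moreover have "(K y - K x) * (K x - K y + K' x (0, snd y - snd x)) / K y \<le>
            \<bar>K y - K x\<bar> * \<bar>K x - K y + K' x (0, snd y - snd x)\<bar> / K y"
          using Ky by (intro divide_right_mono) (auto simp flip: abs_mult)
        ultimately show ?thesis by linarith
      qed
      also have "(M * norm (y - x)) * (2 * M * norm (y - x)) / (2 / 3 * k0) = C * (norm (y - x))\<^sup>2"
        by (simp add: C_def power2_eq_square)
      finally show ?thesis by simp
    qed
    show "isCont K' x0"
      unfolding continuous_at_eps_delta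
    proof (intro allI impI)
      fix \<epsilon> :: real assume \<epsilon>: "\<epsilon> > 0"
      obtain d where d: "d > 0" "\<And>y. norm (y - x0) < d \<Longrightarrow>
          norm (K y - K x0 - K' x0 (y - x0)) \<le> \<epsilon> / 4 * norm (y - x0)"
        using K'[OF x0] \<epsilon> unfolding has_derivative_at_alt by (meson divide_pos_pos zero_less_numeral)
      \<comment> \<open>Three errors are each held to \<open>\<epsilon> / 4 * s\<close>: the
        quadratic term of \<open>semiconvex\<close>, the linearisation error at \<open>x0\<close>
        with step \<open>s\<close>, and, through the choice of \<open>t\<close>, the Lipschitz cost
        of replacing \<open>x\<close> by \<open>x0\<close>.\<close>
      define s where "s = Min {r / 2, \<epsilon> / (4 * C), d / 2}"
      have s: "s > 0" "s \<le> r / 2" "s \<le> \<epsilon> / (4 * C)" "s < d"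
        using r d \<epsilon> C0 by (auto simp: s_def min_less_iff_disj)
      have Cs: "C * s \<le> \<epsilon> / 4" using s(3) C0 by (simp add: field_simps)
      define t where "t = min (r / 2) (\<epsilon> * s / (8 * M))"
      have t: "t > 0" "t \<le> r / 2" "2 * M * t \<le> \<epsilon> / 4 * s"
        using r \<epsilon> s M0 by (auto simp: t_def min_def field_simps)
      have "dist (K' x) (K' x0) < \<epsilon>" if x: "dist x x0 < t" for x
      proof -
        have one: "(K' x - K' x0) e \<le> 3 / 4 * \<epsilon>" if e: "norm e = 1" for e
        proof -
          have xr: "dist x x0 < r" using x t r by linarith
          have x0r: "dist x0 x0 < r" using r by simp
          have "dist (x + s *\<^sub>R e) x0 \<le> dist x x0 + s"
            using norm_triangle_ineq[of "x - x0" "s *\<^sub>R e"] e s(1)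
            by (simp add: dist_norm algebra_simps)
          then have xs: "dist (x + s *\<^sub>R e) x0 < r" using x t s(2) by linarith
          have x0s: "dist (x0 + s *\<^sub>R e) x0 < r" using e s r by (simp add: dist_norm)
          have "s * K' x e \<le> K (x + s *\<^sub>R e) - K x + C * s\<^sup>2"
            using semiconvex[OF xr xs] e s(1) by (simp add: blinfun.scaleR_right)
          moreover have "K (x + s *\<^sub>R e) - K (x0 + s *\<^sub>R e) \<le> M * dist x x0"
            using lip[OF x0s xs] by (simp add: dist_norm)
          moreover have "K x0 - K x \<le> M * dist x x0"
            using lip[OF x0r xr] by (simp add: dist_norm)
          moreover have "M * dist x x0 \<le> M * t" using x M0 by simp
          moreover have "K (x0 + s *\<^sub>R e) - K x0 - s * K' x0 e \<le> \<epsilon> / 4 * s"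
          proof -
            have "\<bar>K (x0 + s *\<^sub>R e) - K x0 - s * K' x0 e\<bar> \<le> \<epsilon> / 4 * s"
              using d(2)[of "x0 + s *\<^sub>R e"] e s by (simp add: blinfun.scaleR_right)
            then show ?thesis by linarith
          qed
          moreover have "C * s\<^sup>2 \<le> \<epsilon> / 4 * s"
            using mult_right_mono[OF Cs, of s] s(1) by (simp add: power2_eq_square)
          ultimately have "s * K' x e \<le> s * K' x0 e + 3 / 4 * \<epsilon> * s" using t(3) by linarith
          then have "s * (K' x e - K' x0 e) \<le> s * (3 / 4 * \<epsilon>)" by (simp add: algebra_simps)
          then show ?thesis using s(1) by (simp add: blinfun.diff_left)
        qed
        have "norm (K' x - K' x0) \<le> 3 / 4 * \<epsilon>"
        proof (rule norm_blinfun_bound)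
          fix h
          show "norm ((K' x - K' x0) h) \<le> 3 / 4 * \<epsilon> * norm h"
          proof (cases "h = 0")
            case False
            define e where "e = (1 / norm h) *\<^sub>R h"
            have h: "h = norm h *\<^sub>R e" and e: "norm e = 1" "norm (- e) = 1" using False by (auto simp: e_def)
            have "\<bar>(K' x - K' x0) e\<bar> \<le> 3 / 4 * \<epsilon>"
              using one[OF e(1)] one[OF e(2)] by (simp only: blinfun.minus_right abs_le_iff)
            then have "norm h * \<bar>(K' x - K' x0) e\<bar> \<le> norm h * (3 / 4 * \<epsilon>)"
              by (rule mult_left_mono) simp
            moreover have "\<bar>(K' x - K' x0) h\<bar> = norm h * \<bar>(K' x - K' x0) e\<bar>"
              by (subst h) (simp only: blinfun.scaleR_right real_scaleR_def abs_mult abs_norm_cancel)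
            ultimately show ?thesis by (simp add: mult.commute)
          qed (simp add: blinfun.zero_right)
        qed (use \<epsilon> in simp)
        then show ?thesis using \<epsilon> by (simp add: dist_norm)
      qed
      then show "\<exists>d>0. \<forall>x'. dist x' x0 < d \<longrightarrow> dist (K' x') (K' x0) < \<epsilon>"
        using t(1) by blast
    qed
  qed
  then show ?thesis unfolding U_def[symmetric] by (intro continuous_at_imp_continuous_on) blast
qed

subsection \<open>Differentiability at stationary discs\<close>

text \<open>The affine disc with the prescribed value and derivative is corrected along
  \<open>b\<close>. As \<open>b\<close> pairs to 1 with \<open>h\<close>, the pairing of the
  corrected disc with \<open>h\<close> can be made any chosen function \<open>q\<close>; the
  construction is linear over the reals in \<open>X\<close>, whence the bound by
  \<open>C * norm X\<close>.\<close>

lemma vec_disc_algebra_perturbation: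
  fixes h b :: "complex \<Rightarrow> complex ^ 'n::finite"
  assumes h: "vec_disc_algebra h" and b: "vec_disc_algebra b"
    and hb: "\<And>\<zeta>. cmod \<zeta> \<le> 1 \<Longrightarrow> cdot (h \<zeta>) (b \<zeta>) = 1"
  obtains C and \<phi> :: "(complex ^ 'n) \<times> (complex ^ 'n) \<Rightarrow> complex \<Rightarrow> complex ^ 'n" where "C \<ge> 1" "\<And>X. vec_disc_algebra (\<phi> X)"
    "\<And>X \<zeta>. cmod \<zeta> \<le> 1 \<Longrightarrow> norm (\<phi> X \<zeta>) \<le> C * norm X"
    "\<And>X. \<phi> X 0 = fst X"
    "\<And>X i. ((\<lambda>\<zeta>. \<phi> X \<zeta> $ i) has_field_derivative snd X $ i) (at 0)"
    "\<And>X \<zeta>. cmod \<zeta> = 1 \<Longrightarrow> Re (cnj \<zeta> * cdot (h \<zeta>) (\<phi> X \<zeta>)) = disc_functional h X"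
proof -
  define \<beta> where "\<beta> X = cdot (h 0) (fst X)" for X :: "(complex ^ 'n) \<times> (complex ^ 'n)"
  define c where "c X = cdot (vec_deriv h 0) (fst X) + cdot (h 0) (snd X)"
    for X :: "(complex ^ 'n) \<times> (complex ^ 'n)"
  \<comment> \<open>To first order at 0, \<open>q\<close> agrees with the pairing of
    \<open>h\<close> and the affine disc, so the correction vanishes to second order there and
    leaves the 1-jet intact. The quadratic term makes \<open>cnj \<zeta> * q X \<zeta>\<close> equal
    to \<open>c X\<close> plus something purely imaginary on the circle.\<close>
  define q where "q X \<zeta> = \<beta> X - cnj (\<beta> X) * \<zeta>\<^sup>2 + c X * \<zeta>"
    for X :: "(complex ^ 'n) \<times> (complex ^ 'n)" and \<zeta>
  define lin where "lin X \<zeta> = fst X + \<zeta> *s snd X"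
    for X :: "(complex ^ 'n) \<times> (complex ^ 'n)" and \<zeta>
  define \<phi> where "\<phi> X \<zeta> = lin X \<zeta> + (q X \<zeta> - cdot (h \<zeta>) (lin X \<zeta>)) *s b \<zeta>"
    for X :: "(complex ^ 'n) \<times> (complex ^ 'n)" and \<zeta>
  have lin_da: "vec_disc_algebra (lin X)" for X
    unfolding lin_def[abs_def] by (intro disc_algebra_intros)
  have q_da: "disc_algebra (q X)" for X
    unfolding q_def[abs_def] by (intro disc_algebra_intros)
  obtain Bh where Bh: "Bh > 0" "\<And>\<zeta>. cmod \<zeta> \<le> 1 \<Longrightarrow> norm (h \<zeta>) \<le> Bh"
    using vec_disc_algebra_bounded[OF h] by blast
  obtain Bb where Bb: "Bb > 0" "\<And>\<zeta>. cmod \<zeta> \<le> 1 \<Longrightarrow> norm (b \<zeta>) \<le> Bb"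
    using vec_disc_algebra_bounded[OF b] by blast
  define Bd where "Bd = norm (vec_deriv h 0)"
  define C where "C = 2 + (Bh + Bh + (Bd + Bh) + Bh * 2) * Bb"
  have C: "C \<ge> 1" using Bh(1) Bb(1) by (simp add: C_def Bd_def)
  have bound: "norm (\<phi> X \<zeta>) \<le> C * norm X" if \<zeta>: "cmod \<zeta> \<le> 1" for X \<zeta>
  proof -
    have fs: "norm (fst X) \<le> norm X" "norm (snd X) \<le> norm X"
      by (metis norm_fst_le prod.collapse) (metis norm_snd_le prod.collapse)
    have "cmod \<zeta> * norm (snd X) \<le> 1 * norm X" using \<zeta> fs by (intro mult_mono) auto
    then have nlin: "norm (lin X \<zeta>) \<le> 2 * norm X"
      unfolding lin_def using fs(1) by (intro order_trans[OF norm_triangle_ineq]) (simp add: norm_smult)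
    have n\<beta>: "cmod (\<beta> X) \<le> Bh * norm X"
      unfolding \<beta>_def by (rule order_trans[OF norm_cdot_le]) (use Bh(1) Bh(2)[of 0] fs in \<open>auto intro!: mult_mono\<close>)
    have "cmod (c X) \<le> Bd * norm X + Bh * norm X"
      unfolding c_def
      by (rule order_trans[OF norm_triangle_ineq], rule add_mono; rule order_trans[OF norm_cdot_le])
         (use Bh(1) Bh(2)[of 0] fs in \<open>auto intro!: mult_mono simp: Bd_def\<close>)
    then have nc: "cmod (c X) \<le> (Bd + Bh) * norm X" by (simp add: algebra_simps)
    have "cmod (cnj (\<beta> X) * \<zeta>\<^sup>2) \<le> (Bh * norm X) * 1"
      unfolding norm_mult norm_power complex_mod_cnj using n\<beta> \<zeta> Bh(1)
      by (intro mult_mono power_le_one) auto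
    moreover have "cmod (c X * \<zeta>) \<le> ((Bd + Bh) * norm X) * 1"
      unfolding norm_mult using nc \<zeta> Bh(1) by (intro mult_mono) (auto simp: Bd_def)
    ultimately
    have nq: "cmod (q X \<zeta>) \<le> (Bh + Bh + (Bd + Bh)) * norm X"
      unfolding q_def using norm_triangle_ineq[of "\<beta> X - cnj (\<beta> X) * \<zeta>\<^sup>2" "c X * \<zeta>"]
        norm_triangle_ineq4[of "\<beta> X" "cnj (\<beta> X) * \<zeta>\<^sup>2"] n\<beta> by (simp add: algebra_simps)
    have "cmod (cdot (h \<zeta>) (lin X \<zeta>)) \<le> Bh * (2 * norm X)"
      by (rule order_trans[OF norm_cdot_le]) (use Bh(1) Bh(2)[OF \<zeta>] nlin in \<open>auto intro!: mult_mono\<close>)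
    with nq have "cmod (q X \<zeta> - cdot (h \<zeta>) (lin X \<zeta>)) \<le> (Bh + Bh + (Bd + Bh) + Bh * 2) * norm X"
      by (intro order_trans[OF norm_triangle_ineq4]) (simp add: algebra_simps)
    then have "cmod (q X \<zeta> - cdot (h \<zeta>) (lin X \<zeta>)) * norm (b \<zeta>) \<le>
        ((Bh + Bh + (Bd + Bh) + Bh * 2) * norm X) * Bb"
      using Bb(2)[OF \<zeta>] Bb(1) Bh(1) by (intro mult_mono) (auto simp: Bd_def)
    moreover have "norm (\<phi> X \<zeta>) \<le> norm (lin X \<zeta>) + cmod (q X \<zeta> - cdot (h \<zeta>) (lin X \<zeta>)) * norm (b \<zeta>)"
      unfolding \<phi>_def by (rule order_trans[OF norm_triangle_ineq]) (simp only: norm_smult order_refl)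
    ultimately show ?thesis using nlin by (simp add: C_def algebra_simps)
  qed
  have \<phi>0: "\<phi> X 0 = fst X" for X
    by (simp add: \<phi>_def lin_def q_def \<beta>_def)
  have der: "((\<lambda>\<zeta>. \<phi> X \<zeta> $ i) has_field_derivative snd X $ i) (at 0)" for X i
  proof -
    have lin': "((\<lambda>\<zeta>. lin X \<zeta> $ i) has_field_derivative snd X $ i) (at 0)" for i
      unfolding lin_def by (auto intro!: derivative_eq_intros)
    have "((\<lambda>\<zeta>. cdot (h \<zeta>) (lin X \<zeta>)) has_field_derivative
        cdot (vec_deriv h 0) (lin X 0) + cdot (h 0) (snd X)) (at 0)"
      by (rule cdot_DERIV) (auto intro!: vec_disc_algebra_DERIV h lin')
    then have "((\<lambda>\<zeta>. cdot (h \<zeta>) (lin X \<zeta>)) has_field_derivative c X) (at 0)"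
      by (simp add: c_def lin_def)
    moreover have "(q X has_field_derivative c X) (at 0)"
      unfolding q_def[abs_def] by (auto intro!: derivative_eq_intros)
    ultimately have "((\<lambda>\<zeta>. q X \<zeta> - cdot (h \<zeta>) (lin X \<zeta>)) has_field_derivative 0) (at 0)"
      using DERIV_diff by fastforce
    moreover have "((\<lambda>\<zeta>. b \<zeta> $ i) has_field_derivative vec_deriv b 0 $ i) (at 0)"
      by (rule vec_disc_algebra_DERIV[OF b]) simp
    ultimately have "((\<lambda>\<zeta>. (q X \<zeta> - cdot (h \<zeta>) (lin X \<zeta>)) * b \<zeta> $ i) has_field_derivative
        0 * b 0 $ i + vec_deriv b 0 $ i * (q X 0 - cdot (h 0) (lin X 0))) (at 0)"
      by (rule DERIV_mult)
    moreover have "q X 0 - cdot (h 0) (lin X 0) = 0"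
      by (simp add: q_def \<beta>_def lin_def)
    ultimately show ?thesis
      using DERIV_add[OF lin'[of i]]
      by (simp only: \<phi>_def vector_add_component vector_smult_component mult_zero_left mult_zero_right
          add_0_right) fastforce
  qed
  have bdry: "Re (cnj \<zeta> * cdot (h \<zeta>) (\<phi> X \<zeta>)) = disc_functional h X" if \<zeta>: "cmod \<zeta> = 1" for X \<zeta>
  proof -
    have "cdot (h \<zeta>) (\<phi> X \<zeta>) = q X \<zeta>"
      unfolding \<phi>_def cdot_add_right cdot_smult_right using hb[of \<zeta>] \<zeta> by simp
    moreover have "cnj \<zeta> * q X \<zeta> = cnj \<zeta> * \<beta> X - cnj (cnj \<zeta> * \<beta> X) + c X"
    proof -
      have "cnj \<zeta> * q X \<zeta> = cnj \<zeta> * \<beta> X - cnj (\<beta> X) * \<zeta> * (cnj \<zeta> * \<zeta>) + c X * (cnj \<zeta> * \<zeta>)"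
        by (simp add: q_def algebra_simps power2_eq_square)
      then show ?thesis unfolding cnj_mult_self_unit[OF \<zeta>] by (simp add: mult.commute)
    qed
    ultimately show ?thesis by (simp add: disc_functional_def c_def)
  qed
  have "vec_disc_algebra (\<phi> X)" for X
    unfolding \<phi>_def[abs_def] by (intro disc_algebra_intros lin_da q_da h b)
  from that[OF C this bound \<phi>0 der bdry] show ?thesis by blast
qed

text \<open>The tangent inequality is used at the perturbed point \<open>g \<zeta>\<close>, where it
  bounds the defining function from above. Replacing the gradient at \<open>g \<zeta>\<close> by
  that at \<open>f \<zeta>\<close> costs little by uniform continuity, so no second derivatives of
  the defining function enter; these can blow up at \<open>z $ k = 0\<close> for
  \<open>m < 1\<close>.\<close>

lemma kobayashi_metric_perturb:
  fixes f h b :: "complex \<Rightarrow> complex ^ 'n::finite"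
  assumes m: "m > 1 / 2" and st: "stationary_disc k m f h" and b: "vec_disc_algebra b"
    and hb: "\<And>\<zeta>. cmod \<zeta> \<le> 1 \<Longrightarrow> cdot (h \<zeta>) (b \<zeta>) = 1" and \<delta>: "\<delta> > 0"
  shows "\<exists>\<eta>>0. \<forall>X. X \<noteq> 0 \<and> norm X < \<eta> \<and> disc_functional h X \<le> - \<delta> * norm X \<longrightarrow>
    kobayashi_metric (ellipsoid k m) (f 0 + fst X) (vec_deriv f 0 + snd X) \<le> 1"
proof -
  have f: "vec_disc_algebra f" and h: "vec_disc_algebra h" using st by (auto simp: stationary_disc_def)
  obtain C and \<phi> :: "(complex ^ 'n) \<times> (complex ^ 'n) \<Rightarrow> complex \<Rightarrow> complex ^ 'n" where C: "C \<ge> 1" and \<phi>: "\<And>X. vec_disc_algebra (\<phi> X)"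
    "\<And>X \<zeta>. cmod \<zeta> \<le> 1 \<Longrightarrow> norm (\<phi> X \<zeta>) \<le> C * norm X" "\<And>X. \<phi> X 0 = fst X"
    "\<And>X i. ((\<lambda>\<zeta>. \<phi> X \<zeta> $ i) has_field_derivative snd X $ i) (at 0)"
    "\<And>X \<zeta>. cmod \<zeta> = 1 \<Longrightarrow> Re (cnj \<zeta> * cdot (h \<zeta>) (\<phi> X \<zeta>)) = disc_functional h X"
    using vec_disc_algebra_perturbation[OF h b hb] by blast
  obtain M0 where M0: "\<And>\<zeta>. cmod \<zeta> = 1 \<Longrightarrow> defining_fun k m (f \<zeta>) = 1 \<and>
      (\<exists>\<mu>>0. \<mu> \<le> M0 \<and> h \<zeta> = (of_real \<mu> * \<zeta>) *s defining_grad k m (f \<zeta>))"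
    using st unfolding stationary_disc_def by blast
  define M where "M = max M0 1"
  have M: "M > 0" "M0 \<le> M" by (auto simp: M_def)
  obtain Bf where Bf: "Bf > 0" "\<And>\<zeta>. cmod \<zeta> \<le> 1 \<Longrightarrow> norm (f \<zeta>) \<le> Bf"
    using vec_disc_algebra_bounded[OF f] by blast
  let ?G = "defining_grad k m"
  have "uniformly_continuous_on (cball 0 (Bf + 1)) ?G"
    by (rule compact_uniformly_continuous)
       (auto intro: continuous_on_subset[OF continuous_on_defining_grad[OF m]])
  \<comment> \<open>Pairing with the perturbation gains at least
    \<open>\<delta> * norm X / M\<close>. Half of this, divided by the bound
    \<open>C * norm X\<close> on the perturbation, is the permitted oscillation of the
    gradient.\<close>
  moreover have e: "\<delta> / (2 * M * C) > 0" using \<delta> M C by simp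
  ultimately obtain d where d: "d > 0" "\<And>x x'. x \<in> cball 0 (Bf + 1) \<Longrightarrow> x' \<in> cball 0 (Bf + 1) \<Longrightarrow>
      dist x' x < d \<Longrightarrow> dist (?G x') (?G x) < \<delta> / (2 * M * C)"
    unfolding uniformly_continuous_on_def by meson
  define \<eta> where "\<eta> = min 1 d / C"
  have \<eta>: "\<eta> > 0" using d C by (simp add: \<eta>_def)
  have "kobayashi_metric (ellipsoid k m) (f 0 + fst X) (vec_deriv f 0 + snd X) \<le> 1"
    if X: "X \<noteq> 0" "norm X < \<eta>" "disc_functional h X \<le> - \<delta> * norm X" for X
  proof -
    let ?g = "\<lambda>\<zeta>. f \<zeta> + \<phi> X \<zeta>"
    have small: "C * norm X < 1" "C * norm X < d"
      using X(2) C mult_strict_left_mono[of "norm X" \<eta> C] by (auto simp: \<eta>_def)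
    have g: "vec_disc_algebra ?g" by (intro disc_algebra_intros f \<phi>)
    have gE: "?g \<zeta> \<in> ellipsoid k m" if "cmod \<zeta> \<le> 1" for \<zeta>
    proof (rule vec_disc_algebra_in_ellipsoid[OF _ g _ that])
      fix \<zeta> :: complex assume \<zeta>: "cmod \<zeta> = 1"
      obtain \<mu> where \<mu>: "\<mu> > 0" "\<mu> \<le> M" "h \<zeta> = (of_real \<mu> * \<zeta>) *s ?G (f \<zeta>)"
        and f1: "defining_fun k m (f \<zeta>) = 1"
        using M0[OF \<zeta>] M(2) order_trans by blast
      have n\<phi>: "norm (\<phi> X \<zeta>) \<le> C * norm X" using \<zeta> by (intro \<phi>(2)) simp
      have "?g \<zeta> \<in> cball 0 (Bf + 1)"
        using norm_triangle_ineq[of "f \<zeta>" "\<phi> X \<zeta>"] n\<phi> small Bf(2)[of \<zeta>] \<zeta> by simp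
      moreover have "f \<zeta> \<in> cball 0 (Bf + 1)" using Bf(2)[of \<zeta>] \<zeta> by simp
      ultimately have "dist (?G (?g \<zeta>)) (?G (f \<zeta>)) < \<delta> / (2 * M * C)"
        using n\<phi> small d(2)[of "f \<zeta>" "?g \<zeta>"] by (simp add: dist_norm)
      then have diff: "norm (?G (?g \<zeta>) - ?G (f \<zeta>)) \<le> \<delta> / (2 * M * C)" by (simp add: dist_norm)
      have "Re (cdot (?G (?g \<zeta>) - ?G (f \<zeta>)) (\<phi> X \<zeta>)) \<le> \<delta> / (2 * M * C) * (C * norm X)"
      proof -
        have "Re (cdot (?G (?g \<zeta>) - ?G (f \<zeta>)) (\<phi> X \<zeta>)) \<le> norm (?G (?g \<zeta>) - ?G (f \<zeta>)) * norm (\<phi> X \<zeta>)"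
          by (rule order_trans[OF complex_Re_le_cmod norm_cdot_le])
        also have "\<dots> \<le> \<delta> / (2 * M * C) * (C * norm X)"
          using diff n\<phi> e by (intro mult_mono) auto
        finally show ?thesis .
      qed
      also have "\<dots> = \<delta> * norm X / (2 * M)" using C M by (simp add: field_simps)
      finally have 1: "Re (cdot (?G (?g \<zeta>) - ?G (f \<zeta>)) (\<phi> X \<zeta>)) \<le> \<delta> * norm X / (2 * M)" .
      have "cnj \<zeta> * cdot (h \<zeta>) (\<phi> X \<zeta>) = of_real \<mu> * (cnj \<zeta> * \<zeta>) * cdot (?G (f \<zeta>)) (\<phi> X \<zeta>)"
        unfolding \<mu>(3) cdot_smult_left by (simp add: mult_ac)
      then have "\<mu> * Re (cdot (?G (f \<zeta>)) (\<phi> X \<zeta>)) = disc_functional h X"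
        using \<phi>(5)[OF \<zeta>, of X] unfolding cnj_mult_self_unit[OF \<zeta>] by simp
      then have "Re (cdot (?G (f \<zeta>)) (\<phi> X \<zeta>)) = disc_functional h X / \<mu>" using \<mu>(1) by (simp add: field_simps)
      also have "\<dots> \<le> - \<delta> * norm X / \<mu>" using X(3) \<mu>(1) by (intro divide_right_mono) auto
      also have "\<dots> \<le> - \<delta> * norm X / M"
        using \<mu> \<delta> by (simp add: frac_le)
      finally have 2: "Re (cdot (?G (f \<zeta>)) (\<phi> X \<zeta>)) \<le> - (\<delta> * norm X / M)" by simp
      have "\<delta> * norm X / M > 0" using \<delta> X(1) M by simp
      then have "\<delta> * norm X / (2 * M) < \<delta> * norm X / M" by (simp add: field_simps)
      with 1 2 have "Re (cdot (?G (?g \<zeta>)) (\<phi> X \<zeta>)) < 0" by (simp add: cdot_diff_left)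
      moreover have "defining_fun k m (f \<zeta>) \<ge>
          defining_fun k m (?g \<zeta>) + 2 * Re (cdot (?G (?g \<zeta>)) (f \<zeta> - ?g \<zeta>))"
        using m by (intro defining_fun_above_tangent) simp
      moreover have "Re (cdot (?G (?g \<zeta>)) (f \<zeta> - ?g \<zeta>)) = - Re (cdot (?G (?g \<zeta>)) (\<phi> X \<zeta>))"
        by (simp only: cdot_diff_right cdot_add_right) simp
      ultimately show "?g \<zeta> \<in> ellipsoid k m" using f1 by (simp add: in_ellipsoid_iff)
    qed (use m in simp)
    have "kobayashi_disc (ellipsoid k m) (f 0 + fst X) (vec_deriv f 0 + snd X) ?g 1"
    proof (rule kobayashi_discI)
      fix i
      show "(\<lambda>\<zeta>. ?g \<zeta> $ i) holomorphic_on ball 0 1"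
        using g by (simp add: vec_disc_algebra_def disc_algebra_def)
      have "((\<lambda>\<zeta>. f \<zeta> $ i) has_field_derivative vec_deriv f 0 $ i) (at 0)"
        by (rule vec_disc_algebra_DERIV[OF f]) simp
      from DERIV_add[OF this \<phi>(4)[of X i]]
      show "((\<lambda>\<zeta>. ?g \<zeta> $ i) has_field_derivative (vec_deriv f 0 + snd X) $ i) (at 0)"
        by simp
    qed (use gE \<phi>(3) in auto)
    from kobayashi_metric_le[OF this] show ?thesis by simp
  qed
  then show ?thesis using \<eta> by blast
qed

lemma kobayashi_metric_differentiable_stationary:
  fixes f h b :: "complex \<Rightarrow> complex ^ 'n::finite"
  assumes m: "m > 1 / 2" and st: "stationary_disc k m f h" and z: "f 0 \<in> ellipsoid k m"
    and b: "vec_disc_algebra b" and hb: "\<And>\<zeta>. cmod \<zeta> \<le> 1 \<Longrightarrow> cdot (h \<zeta>) (b \<zeta>) = 1"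
  shows "(\<lambda>x. kobayashi_metric (ellipsoid k m) (fst x) (snd x)) differentiable (at (f 0, vec_deriv f 0))"
proof -
  have m': "m \<ge> 1 / 2" "m > 0" using m by auto
  have op: "open (ellipsoid k m)" using m'(2) by (rule open_ellipsoid)
  let ?K = "\<lambda>x. kobayashi_metric (ellipsoid k m) (fst x) (snd x)"
  have K1: "kobayashi_metric (ellipsoid k m) (f 0) (vec_deriv f 0) = 1"
    by (rule stationary_disc_kobayashi_eq_1[OF m'(1) st z])
  have "(?K has_derivative (\<lambda>X. disc_functional h X / disc_functional h (0, vec_deriv f 0)))
      (at (f 0, vec_deriv f 0))"
  proof (rule homogeneous_has_derivative[OF op z])
    show "bounded_linear (disc_functional h)"
      using disc_functional_linear by (simp add: linear_conv_bounded_linear)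
    show "disc_functional h (0, vec_deriv f 0) > 0"
      by (rule stationary_disc_positive[OF m'(1) st z])
    show "?K (f 0, vec_deriv f 0) = 1" using K1 by simp
    show "?K (z, c *\<^sub>R v) = c * ?K (z, v)" if "z \<in> ellipsoid k m" "c > 0" for z v c
      using kobayashi_metric_scaleR[OF op that(1)] that(2) by simp
    show "disc_functional h (z - f 0, (1 / c) *\<^sub>R v - vec_deriv f 0) \<le> 0"
      if "z \<in> ellipsoid k m" "c > 0" "?K (z, v) < c" for z v c
      using kobayashi_metric_support[OF m'(1) st that(1)] that(3) by (simp add: less_imp_le)
    fix \<delta> :: real assume "\<delta> > 0"
    from kobayashi_metric_perturb[OF m st b hb this] obtain \<eta> where \<eta>: "\<eta> > 0"
      "\<And>X. X \<noteq> 0 \<Longrightarrow> norm X < \<eta> \<Longrightarrow> disc_functional h X \<le> - \<delta> * norm X \<Longrightarrow>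
        kobayashi_metric (ellipsoid k m) (f 0 + fst X) (vec_deriv f 0 + snd X) \<le> 1" by blast
    have "?K ((f 0, vec_deriv f 0) + X) \<le> 1" if "norm X < \<eta>" "disc_functional h X \<le> - \<delta> * norm X" for X
      using \<eta>(2)[of X] that K1 by (cases "X = 0") auto
    then show "\<exists>\<eta>>0. \<forall>X. norm X < \<eta> \<and> disc_functional h X \<le> - \<delta> * norm X \<longrightarrow>
        ?K ((f 0, vec_deriv f 0) + X) \<le> 1" using \<eta>(1) by blast
  qed
  then show ?thesis unfolding differentiable_def by blast
qed

subsection \<open>Explicit stationary discs\<close>

text \<open>The map \<open>b\<close> witnesses that the dual map has no zero on the closed disc; it
  is given explicitly because the perturbation argument divides by \<open>h\<close> in this
  sense.\<close>

definition extremal_direction ::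
    "'n::finite \<Rightarrow> real \<Rightarrow> complex ^ 'n \<Rightarrow> complex ^ 'n \<Rightarrow> bool"
  where "extremal_direction k m z v \<longleftrightarrow> (\<exists>f h b. stationary_disc k m f h \<and> f 0 = z \<and> vec_deriv f 0 = v \<and>
    vec_disc_algebra b \<and> (\<forall>\<zeta>. cmod \<zeta> \<le> 1 \<longrightarrow> cdot (h \<zeta>) (b \<zeta>) = 1))"

lemma extremal_direction_eq_1:
  assumes "m \<ge> 1 / 2" "extremal_direction k m z v" "z \<in> ellipsoid k m"
  shows "kobayashi_metric (ellipsoid k m) z v = 1"
  using assms stationary_disc_kobayashi_eq_1 unfolding extremal_direction_def by blast

lemma extremal_direction_differentiable:
  assumes "m > 1 / 2" "extremal_direction k m z v" "z \<in> ellipsoid k m"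
  shows "(\<lambda>x. kobayashi_metric (ellipsoid k m) (fst x) (snd x)) differentiable (at (z, v))"
  using assms kobayashi_metric_differentiable_stationary unfolding extremal_direction_def by blast

lemma one_plus_mult_nonzero:
  assumes "cmod \<zeta> \<le> 1" "0 \<le> c" "c < 1"
  shows "Re (1 + of_real c * \<zeta>) > 0" "1 + of_real c * \<zeta> \<noteq> 0"
proof -
  have "\<bar>c * Re \<zeta>\<bar> \<le> c * 1"
    unfolding abs_mult using assms abs_Re_le_cmod[of \<zeta>] by (intro mult_mono) auto
  then show "Re (1 + of_real c * \<zeta>) > 0" using assms by simp
  then show "1 + of_real c * \<zeta> \<noteq> 0" by (metis less_irrefl zero_complex.sel(1))
qed

lemma cmod_one_plus_sq:
  assumes "cmod \<zeta> = 1"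
  shows "(cmod (1 + of_real c * \<zeta>))\<^sup>2 = 1 + c\<^sup>2 + 2 * c * Re \<zeta>"
proof -
  have "(Re \<zeta>)\<^sup>2 + (Im \<zeta>)\<^sup>2 = 1" using assms by (metis cmod_power2 one_power2)
  then have "c\<^sup>2 * ((Re \<zeta>)\<^sup>2 + (Im \<zeta>)\<^sup>2) = c\<^sup>2" by simp
  then show ?thesis unfolding cmod_power2 by (simp add: power2_eq_square algebra_simps)
qed

text \<open>Stationary discs of the ball \<open>|G|\<^sup>2 + |z'|\<^sup>2 < 1\<close> have \<open>|G| = \<surd>A |1 + \<sigma> \<zeta>| / |1 + A \<sigma> \<zeta>|\<close> on the circle;
  \<open>f1\<close> is the \<open>m\<close>-th root of the zero-free part of \<open>G\<close>, times a Blaschke factor or not.\<close>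

lemma extremal_direction_construct:
  fixes v :: "complex ^ 'n::finite"
  assumes m: "m \<ge> 1 / 2" and a: "0 \<le> a" and \<sigma>: "0 \<le> \<sigma>"
    and A: "A = a powr (2 * m)" and \<gamma>: "0 \<le> A * \<sigma>" "A * \<sigma> < 1"
    and tail: "tail_norm_sq k v = (1 - A) * (1 - A * \<sigma>\<^sup>2)"
    and f1: "disc_algebra f1" and h1: "disc_algebra h1"
    and abs_f1: "\<And>\<zeta>. cmod \<zeta> = 1 \<Longrightarrow>
      cmod (f1 \<zeta>) powr (2 * m) * (cmod (1 + of_real (A * \<sigma>) * \<zeta>))\<^sup>2 = A * (cmod (1 + of_real \<sigma> * \<zeta>))\<^sup>2"
    and h1f1: "\<And>\<zeta>. cmod \<zeta> = 1 \<Longrightarrow> h1 \<zeta> * f1 \<zeta> = of_real (m * A) * (1 + of_real \<sigma> * \<zeta>) * (\<zeta> + of_real \<sigma>)"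
    and h1_0: "\<And>\<zeta>. cmod \<zeta> = 1 \<Longrightarrow> f1 \<zeta> = 0 \<Longrightarrow> h1 \<zeta> = 0"
    and deriv: "(f1 has_field_derivative v $ k) (at 0)"
    and regular: "tail_norm_sq k v > 0 \<or> (\<forall>\<zeta>. cmod \<zeta> \<le> 1 \<longrightarrow> h1 \<zeta> \<noteq> 0)"
  shows "extremal_direction k m (axis k (f1 0)) v"
proof -
  define \<gamma> where "\<gamma> = A * \<sigma>"
  define d where "d \<zeta> = 1 + of_real \<gamma> * \<zeta>" for \<zeta> :: complex
  have d0: "d \<zeta> \<noteq> 0" if "cmod \<zeta> \<le> 1" for \<zeta>
    using one_plus_mult_nonzero[OF that, of \<gamma>] \<gamma> by (simp add: d_def \<gamma>_def)
  have d: "disc_algebra d" unfolding d_def[abs_def] by (intro disc_algebra_intros)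
  define f where "f \<zeta> = (\<chi> i. if i = k then f1 \<zeta> else v $ i * \<zeta> / d \<zeta>)" for \<zeta>
  define h where "h \<zeta> = (\<chi> i. if i = k then h1 \<zeta> else cnj (v $ i) * d \<zeta>)" for \<zeta>
  \<comment> \<open>When the tail is nonzero, the tail components of \<open>h\<close> are constants
    times the zero-free \<open>d\<close>, so \<open>b\<close> can be built from them alone even
    though \<open>h1\<close> may vanish. Otherwise \<open>h1\<close> itself has to be
    invertible.\<close>
  define b where "b \<zeta> = (\<chi> i. if tail_norm_sq k v > 0
      then (if i = k then 0 else v $ i / (of_real (tail_norm_sq k v) * d \<zeta>))
      else if i = k then 1 / h1 \<zeta> else 0)" for \<zeta>
  have f: "vec_disc_algebra f"
    unfolding vec_disc_algebra_def
  proof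
    fix i show "disc_algebra (\<lambda>\<zeta>. f \<zeta> $ i)"
      using f1 by (cases "i = k") (auto simp: f_def intro!: disc_algebra_intros d d0)
  qed
  have h: "vec_disc_algebra h"
    unfolding vec_disc_algebra_def
  proof
    fix i show "disc_algebra (\<lambda>\<zeta>. h \<zeta> $ i)"
      using h1 by (cases "i = k") (auto simp: h_def intro!: disc_algebra_intros d)
  qed
  have b: "vec_disc_algebra b"
    unfolding vec_disc_algebra_def
  proof
    fix i show "disc_algebra (\<lambda>\<zeta>. b \<zeta> $ i)"
      using h1 d0 regular
      by (cases "i = k"; cases "tail_norm_sq k v > 0") (auto simp: b_def intro!: disc_algebra_intros d)
  qed
  have hb: "cdot (h \<zeta>) (b \<zeta>) = 1" if \<zeta>: "cmod \<zeta> \<le> 1" for \<zeta>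
  proof (cases "tail_norm_sq k v > 0")
    case True
    have "cdot (h \<zeta>) (b \<zeta>) = (\<Sum>i\<in>UNIV - {k}. cnj (v $ i) * d \<zeta> * (v $ i / (of_real (tail_norm_sq k v) * d \<zeta>)))"
      unfolding cdot_def by (subst sum_UNIV_remove[of _ k]) (simp add: True h_def b_def)
    also have "\<dots> = (\<Sum>i\<in>UNIV - {k}. of_real ((cmod (v $ i))\<^sup>2) / of_real (tail_norm_sq k v))"
      using d0[OF \<zeta>] by (intro sum.cong refl) (simp add: field_simps complex_norm_square del: of_real_power)
    also have "\<dots> = of_real (tail_norm_sq k v) / of_real (tail_norm_sq k v)"
      by (simp only: sum_divide_distrib[symmetric] of_real_sum[symmetric] tail_norm_sq_def[of k v, symmetric])
    finally show ?thesis using True by simp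
  next
    case False
    have "cdot (h \<zeta>) (b \<zeta>) = h1 \<zeta> * (1 / h1 \<zeta>)"
      unfolding cdot_def by (subst sum_UNIV_remove[of _ k]) (simp add: False h_def b_def)
    with False regular \<zeta> show ?thesis by auto
  qed
  have f0: "f 0 = axis k (f1 0)"
    by (simp add: f_def axis_def vec_eq_iff)
  have f'0: "vec_deriv f 0 = v"
    unfolding vec_eq_iff
  proof
    fix i
    have "((\<lambda>\<zeta>. f \<zeta> $ i) has_field_derivative v $ i) (at 0)"
    proof (cases "i = k")
      case True then show ?thesis using deriv by (simp add: f_def)
    next
      case False
      then show ?thesis by (auto simp: f_def d_def intro!: derivative_eq_intros)
    qed
    then show "vec_deriv f 0 $ i = v $ i" by (simp add: vec_deriv_def DERIV_imp_deriv)
  qed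
  have "defining_fun k m (f \<zeta>) = 1 \<and>
      (\<exists>\<mu>>0. \<mu> \<le> 4 \<and> h \<zeta> = (of_real \<mu> * \<zeta>) *s defining_grad k m (f \<zeta>))" if \<zeta>: "cmod \<zeta> = 1" for \<zeta>
  proof -
    define \<mu> where "\<mu> = (cmod (d \<zeta>))\<^sup>2"
    have d0': "d \<zeta> \<noteq> 0" using d0 \<zeta> by simp
    have \<mu>0: "\<mu> > 0" using d0' by (simp add: \<mu>_def)
    have "cmod (d \<zeta>) \<le> 1 + \<gamma> * 1"
      unfolding d_def using \<gamma> \<zeta> by (intro order_trans[OF norm_triangle_ineq]) (simp add: norm_mult \<gamma>_def)
    then have "\<mu> \<le> 2\<^sup>2" unfolding \<mu>_def using \<gamma> by (intro power_mono) (auto simp: \<gamma>_def)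
    then have \<mu>4: "\<mu> \<le> 4" by simp
    have \<mu>: "complex_of_real \<mu> = d \<zeta> * cnj (d \<zeta>)"
      unfolding \<mu>_def by (rule complex_norm_square)
    have "tail_norm_sq k (f \<zeta>) = tail_norm_sq k v / \<mu>"
      unfolding tail_norm_sq_def sum_divide_distrib
      by (intro sum.cong) (auto simp: f_def norm_mult norm_divide \<zeta> \<mu>_def power_divide)
    moreover have "cmod (f1 \<zeta>) powr (2 * m) = A * (cmod (1 + of_real \<sigma> * \<zeta>))\<^sup>2 / \<mu>"
      using abs_f1[OF \<zeta>] \<mu>0 by (simp add: \<mu>_def d_def \<gamma>_def field_simps)
    \<comment> \<open>This identity is the origin of the prescribed tail norm: both squared moduli
      are affine in \<open>Re \<zeta>\<close> with the same slope \<open>2 * A * \<sigma>\<close>,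
      and their constant terms differ by
      \<open>(1 - A) * (1 - A * \<sigma>\<^sup>2)\<close>.\<close>
    moreover have "A * (cmod (1 + of_real \<sigma> * \<zeta>))\<^sup>2 + tail_norm_sq k v = \<mu>"
      unfolding tail \<mu>_def d_def cmod_one_plus_sq[OF \<zeta>] \<gamma>_def
      by (simp add: algebra_simps power2_eq_square)
    ultimately have "defining_fun k m (f \<zeta>) = 1"
      using \<mu>0 by (simp add: defining_fun_def f_def add_divide_distrib[symmetric])
    moreover have "h \<zeta> = (of_real \<mu> * \<zeta>) *s defining_grad k m (f \<zeta>)"
      unfolding vec_eq_iff
    proof
      fix i
      show "h \<zeta> $ i = ((of_real \<mu> * \<zeta>) *s defining_grad k m (f \<zeta>)) $ i"
      proof (cases "i = k")
        case False
        have "(of_real \<mu> * \<zeta>) * cnj (v $ i * \<zeta> / d \<zeta>) = cnj (v $ i) * d \<zeta> * (cnj \<zeta> * \<zeta>)"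
          unfolding \<mu> using d0' by (simp add: field_simps)
        then show ?thesis
          using False unfolding cnj_mult_self_unit[OF \<zeta>] by (simp add: h_def f_def defining_grad_def)
      next
        case True
        have "h1 \<zeta> = of_real \<mu> * \<zeta> * (of_real (m * cmod (f1 \<zeta>) powr (2 * m - 1)) * cnj (sgn (f1 \<zeta>)))"
        proof (cases "f1 \<zeta> = 0")
          case True then show ?thesis using h1_0[OF \<zeta>] by simp
        next
          case nz: False
          have pw: "cmod (f1 \<zeta>) powr (2 * m - 1) * cmod (f1 \<zeta>) = cmod (f1 \<zeta>) powr (2 * m)"
            using nz by (simp add: powr_diff)
          have "of_real \<mu> * \<zeta> * (of_real (m * cmod (f1 \<zeta>) powr (2 * m - 1)) * cnj (sgn (f1 \<zeta>))) * f1 \<zeta> =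
              of_real \<mu> * \<zeta> * of_real m * of_real (cmod (f1 \<zeta>) powr (2 * m - 1)) * (cnj (sgn (f1 \<zeta>)) * f1 \<zeta>)"
            by (simp add: mult_ac)
          also have "\<dots> = \<zeta> * of_real m * of_real (cmod (f1 \<zeta>) powr (2 * m) * \<mu>)"
            unfolding cnj_sgn_mult_self pw[symmetric] by (simp add: mult_ac)
          also have "cmod (f1 \<zeta>) powr (2 * m) * \<mu> = A * (cmod (1 + of_real \<sigma> * \<zeta>))\<^sup>2"
            using abs_f1[OF \<zeta>] by (simp add: \<mu>_def d_def \<gamma>_def)
          also have "\<zeta> * of_real m * of_real (A * (cmod (1 + of_real \<sigma> * \<zeta>))\<^sup>2) =
              of_real (m * A) * (1 + of_real \<sigma> * \<zeta>) * (\<zeta> + of_real \<sigma> * (cnj \<zeta> * \<zeta>))"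
            unfolding of_real_mult complex_norm_square by (simp add: algebra_simps)
          also have "\<dots> = h1 \<zeta> * f1 \<zeta>"
            unfolding cnj_mult_self_unit[OF \<zeta>] using h1f1[OF \<zeta>] by simp
          finally show ?thesis using nz by simp
        qed
        then show ?thesis using True by (simp add: h_def f_def defining_grad_def)
      qed
    qed
    ultimately show ?thesis using \<mu>0 \<mu>4 by blast
  qed
  then have "stationary_disc k m f h"
    unfolding stationary_disc_def using f h by blast
  with f0 f'0 b hb show ?thesis unfolding extremal_direction_def by blast
qed

section \<open>Explicit discs, by the position of the zero of the first component\<close>

definition root_quotient :: "real \<Rightarrow> real \<Rightarrow> real \<Rightarrow> complex \<Rightarrow> complex"
  where "root_quotient m \<sigma> \<gamma> \<zeta> = exp ((Ln (1 + of_real \<sigma> * \<zeta>) - Ln (1 + of_real \<gamma> * \<zeta>)) / of_real m)"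

text \<open>Each linear factor has positive real part on the closed disc, so the two principal
  logarithms are taken separately and no branch question arises for the quotient.\<close>

lemma disc_algebra_root_quotient:
  assumes "0 \<le> \<sigma>" "\<sigma> < 1" "0 \<le> \<gamma>" "\<gamma> < 1" "m \<noteq> 0"
  shows "disc_algebra (root_quotient m \<sigma> \<gamma>)"
  unfolding root_quotient_def[abs_def] using assms one_plus_mult_nonzero(1)
  by (intro disc_algebra_intros) auto

lemma cmod_root_quotient:
  assumes "cmod \<zeta> \<le> 1" "0 \<le> \<sigma>" "\<sigma> < 1" "0 \<le> \<gamma>" "\<gamma> < 1" "m \<noteq> 0"
  shows "cmod (root_quotient m \<sigma> \<gamma> \<zeta>) powr (2 * m) * (cmod (1 + of_real \<gamma> * \<zeta>))\<^sup>2 =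
    (cmod (1 + of_real \<sigma> * \<zeta>))\<^sup>2"
proof -
  have nz: "1 + of_real \<sigma> * \<zeta> \<noteq> 0" "1 + of_real \<gamma> * \<zeta> \<noteq> 0"
    using one_plus_mult_nonzero assms by blast+
  have sq: "exp (2 * ln x) = x\<^sup>2" if "x > 0" for x :: real
    using that by (simp add: exp_double)
  have "cmod (root_quotient m \<sigma> \<gamma> \<zeta>) powr (2 * m) =
      exp (2 * ln (cmod (1 + of_real \<sigma> * \<zeta>)) - 2 * ln (cmod (1 + of_real \<gamma> * \<zeta>)))"
    using nz assms(6) by (simp add: root_quotient_def powr_def Re_divide_of_real field_simps)
  then show ?thesis
    using nz by (simp add: exp_diff sq)
qed

lemma DERIV_root_quotient:
  "m \<noteq> 0 \<Longrightarrow> (root_quotient m \<sigma> \<gamma> has_field_derivative of_real ((\<sigma> - \<gamma>) / m)) (at 0)"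
  unfolding root_quotient_def[abs_def] by (auto intro!: derivative_eq_intros simp: field_simps)

lemma root_quotient_nonzero [simp]: "root_quotient m \<sigma> \<gamma> \<zeta> \<noteq> 0"
  by (simp add: root_quotient_def)

lemma root_quotient_0 [simp]: "root_quotient m \<sigma> \<gamma> 0 = 1"
  by (simp add: root_quotient_def)

lemma powr_minus_one_mult: "0 \<le> (a::real) \<Longrightarrow> a powr (q - 1) * a = a powr q"
  by (cases "a = 0") (auto simp: powr_diff)

lemma powr_less_1: "0 \<le> (a::real) \<Longrightarrow> a < 1 \<Longrightarrow> 0 < q \<Longrightarrow> a powr q < 1"
  using powr_less_mono2[of q a 1] by simp

text \<open>Since \<open>\<sigma> < 1\<close>, the first component has no zero on the closed disc.
  The dual component vanishes at \<open>-\<sigma>\<close>, but the tail is nonzero here and supplies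
  \<open>b\<close>.\<close>

lemma extremal_direction_nonvanishing:
  fixes v :: "complex ^ 'n::finite"
  assumes m: "m \<ge> 1 / 2" and a: "0 < a" "a < 1" and \<sigma>: "0 \<le> \<sigma>" "\<sigma> < 1"
    and A: "A = a powr (2 * m)"
    and vk: "v $ k = of_real (a * \<sigma> * (1 - A) / m)"
    and tail: "tail_norm_sq k v = (1 - A) * (1 - A * \<sigma>\<^sup>2)"
  shows "extremal_direction k m (axis k (of_real a)) v"
proof -
  have A1: "0 < A" "A < 1" using a m by (auto simp: A powr_less_1)
  have m0: "m \<noteq> 0" using m by auto
  have \<gamma>: "0 \<le> A * \<sigma>" "A * \<sigma> < 1" using A1 \<sigma> by (auto intro: le_less_trans[OF mult_left_le_one_le])
  define e where "e = root_quotient m \<sigma> (A * \<sigma>)"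
  have e: "disc_algebra e" unfolding e_def using \<sigma> \<gamma> m0 by (intro disc_algebra_root_quotient)
  have e0: "e \<zeta> \<noteq> 0" for \<zeta> by (simp add: e_def)
  have pw: "a powr (2 * m - 1) * a = A" using a by (simp add: A powr_minus_one_mult)
  have "A * \<sigma>\<^sup>2 < 1"
  proof -
    have "\<sigma>\<^sup>2 \<le> 1" using \<sigma> by (simp add: power_le_one)
    then show ?thesis using A1 by (smt (verit) mult_left_le)
  qed
  then have T: "tail_norm_sq k v > 0" using A1 by (simp add: tail)
  let ?f1 = "\<lambda>\<zeta>. of_real a * e \<zeta>"
  let ?h1 = "\<lambda>\<zeta>. of_real (m * a powr (2 * m - 1)) * (1 + of_real \<sigma> * \<zeta>) * (\<zeta> + of_real \<sigma>) / e \<zeta>"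
  have "extremal_direction k m (axis k (?f1 0)) v"
  proof (rule extremal_direction_construct[where ?h1.0 = ?h1 and ?f1.0 = ?f1 and a = a and \<sigma> = \<sigma> and A = A])
    show "disc_algebra ?f1" "disc_algebra ?h1" by (intro disc_algebra_intros e e0)+
    fix \<zeta> :: complex assume \<zeta>: "cmod \<zeta> = 1"
    show "cmod (?f1 \<zeta>) powr (2 * m) * (cmod (1 + of_real (A * \<sigma>) * \<zeta>))\<^sup>2 = A * (cmod (1 + of_real \<sigma> * \<zeta>))\<^sup>2"
      using cmod_root_quotient[of \<zeta> \<sigma> "A * \<sigma>" m] \<zeta> \<sigma> \<gamma> m0 a
      by (simp add: norm_mult powr_mult A e_def)
    show "?h1 \<zeta> * ?f1 \<zeta> = of_real (m * A) * (1 + of_real \<sigma> * \<zeta>) * (\<zeta> + of_real \<sigma>)"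
      using e0 by (simp add: pw[symmetric] field_simps)
  next
    have "(?f1 has_field_derivative of_real a * of_real ((\<sigma> - A * \<sigma>) / m)) (at 0)"
      unfolding e_def using m0 by (intro DERIV_cmult DERIV_root_quotient)
    then show "(?f1 has_field_derivative v $ k) (at 0)"
      using m0 by (simp add: vk field_simps)
  qed (use m a \<sigma> A \<gamma> tail T e0 in auto)
  then show ?thesis by (simp add: e_def)
qed

text \<open>The Blaschke factor inserts a zero at \<open>-\<sigma>\<close> without changing moduli
  on the circle, and multiplies the base point by \<sigma>. Division by it turns the factor
  \<open>\<zeta> + \<sigma>\<close> of the dual component into
  \<open>1 + \<sigma> * \<zeta>\<close>, so that component is zero-free whenever
  \<open>a > 0\<close>.\<close>

lemma extremal_direction_vanishing:
  fixes v :: "complex ^ 'n::finite"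
  assumes m: "m \<ge> 1 / 2" and a: "0 \<le> a" "a \<le> 1" and \<sigma>: "0 \<le> \<sigma>" "\<sigma> < 1"
    and A: "A = a powr (2 * m)"
    and vk: "v $ k = of_real (a * (1 - \<sigma>\<^sup>2 + \<sigma>\<^sup>2 * (1 - A) / m))"
    and tail: "tail_norm_sq k v = (1 - A) * (1 - A * \<sigma>\<^sup>2)"
  shows "extremal_direction k m (axis k (of_real (a * \<sigma>))) v"
proof -
  have A1: "0 \<le> A" "A \<le> 1" using a m by (auto simp: A powr_le1)
  have m0: "m \<noteq> 0" using m by auto
  have \<gamma>: "0 \<le> A * \<sigma>" "A * \<sigma> < 1" using A1 \<sigma> by (auto intro: le_less_trans[OF mult_left_le_one_le])
  define e where "e = root_quotient m \<sigma> (A * \<sigma>)"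
  have e: "disc_algebra e" unfolding e_def using \<sigma> \<gamma> m0 by (intro disc_algebra_root_quotient)
  have e0: "e \<zeta> \<noteq> 0" for \<zeta> by (simp add: e_def)
  have s0: "1 + of_real \<sigma> * \<zeta> \<noteq> 0" if "cmod \<zeta> \<le> 1" for \<zeta>
    using one_plus_mult_nonzero that \<sigma> by blast
  have pw: "a powr (2 * m - 1) * a = A" using a by (simp add: A powr_minus_one_mult)
  let ?f1 = "\<lambda>\<zeta>. of_real a * ((\<zeta> + of_real \<sigma>) / (1 + of_real \<sigma> * \<zeta>)) * e \<zeta>"
  let ?h1 = "\<lambda>\<zeta>. of_real (m * a powr (2 * m - 1)) * (1 + of_real \<sigma> * \<zeta>)\<^sup>2 / e \<zeta>"
  have "extremal_direction k m (axis k (?f1 0)) v"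
  proof (rule extremal_direction_construct[where ?h1.0 = ?h1 and ?f1.0 = ?f1 and a = a and \<sigma> = \<sigma> and A = A])
    show "disc_algebra ?f1" "disc_algebra ?h1" by (auto intro!: disc_algebra_intros e e0 s0)
    fix \<zeta> :: complex assume \<zeta>: "cmod \<zeta> = 1"
    have "cmod (\<zeta> + of_real \<sigma>) = cmod (1 + of_real \<sigma> * \<zeta>)"
    proof -
      have "\<zeta> + of_real \<sigma> = \<zeta> * cnj (1 + of_real \<sigma> * \<zeta>)"
        using cnj_mult_self_unit[OF \<zeta>] by (simp add: algebra_simps)
      then show ?thesis using \<zeta> by (simp only: norm_mult complex_mod_cnj; simp)
    qed
    moreover have "1 + of_real \<sigma> * \<zeta> \<noteq> 0" using s0 \<zeta> by simp
    ultimately have "cmod ((\<zeta> + of_real \<sigma>) / (1 + of_real \<sigma> * \<zeta>)) = 1" by (simp add: norm_divide)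
    then have "cmod (?f1 \<zeta>) = a * cmod (e \<zeta>)" using a by (simp only: norm_mult; simp)
    then show "cmod (?f1 \<zeta>) powr (2 * m) * (cmod (1 + of_real (A * \<sigma>) * \<zeta>))\<^sup>2 = A * (cmod (1 + of_real \<sigma> * \<zeta>))\<^sup>2"
      using cmod_root_quotient[of \<zeta> \<sigma> "A * \<sigma>" m] \<zeta> \<sigma> \<gamma> m0 a
      by (simp add: powr_mult A e_def)
    show h1f1: "?h1 \<zeta> * ?f1 \<zeta> = of_real (m * A) * (1 + of_real \<sigma> * \<zeta>) * (\<zeta> + of_real \<sigma>)"
    proof -
      have gen: "c * s\<^sup>2 / e' * (a' * (t / s) * e') = c * a' * s * t" if "s \<noteq> 0" "e' \<noteq> 0" for c s e' a' t :: complex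
        using that by (simp add: field_simps power2_eq_square)
      have s: "1 + of_real \<sigma> * \<zeta> \<noteq> 0" using s0 \<zeta> by simp
      have "?h1 \<zeta> * ?f1 \<zeta> = of_real (m * a powr (2 * m - 1)) * of_real a *
          (1 + of_real \<sigma> * \<zeta>) * (\<zeta> + of_real \<sigma>)"
        by (rule gen[OF s e0])
      then show ?thesis by (simp only: of_real_mult[symmetric] mult.assoc[of m] pw)
    qed
    assume z: "?f1 \<zeta> = 0"
    have "\<zeta> + of_real \<sigma> \<noteq> 0"
      using \<open>cmod (\<zeta> + of_real \<sigma>) = cmod (1 + of_real \<sigma> * \<zeta>)\<close> s0[of \<zeta>] \<zeta> by auto
    with z have "a = 0" using e0[of \<zeta>] s0[of \<zeta>] \<zeta> by auto
    then show "?h1 \<zeta> = 0" by simp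
  next
    have "(?f1 has_field_derivative
        of_real a * (of_real (1 - \<sigma>\<^sup>2)) * e 0 + of_real ((\<sigma> - A * \<sigma>) / m) * (of_real a * ((0 + of_real \<sigma>) / (1 + of_real \<sigma> * 0)))) (at 0)"
    proof (rule DERIV_mult)
      show "((\<lambda>\<zeta>. of_real a * ((\<zeta> + of_real \<sigma>) / (1 + of_real \<sigma> * \<zeta>))) has_field_derivative
          of_real a * of_real (1 - \<sigma>\<^sup>2)) (at 0)"
        by (auto intro!: derivative_eq_intros simp: power2_eq_square algebra_simps)
      show "(e has_field_derivative of_real ((\<sigma> - A * \<sigma>) / m)) (at 0)"
        unfolding e_def using m0 by (rule DERIV_root_quotient)
    qed
    moreover have "of_real a * (of_real (1 - \<sigma>\<^sup>2)) * e 0 +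
        of_real ((\<sigma> - A * \<sigma>) / m) * (of_real a * ((0 + of_real \<sigma>) / (1 + of_real \<sigma> * 0))) = v $ k"
      unfolding vk e_def using m0 by (simp add: field_simps power2_eq_square)
    ultimately show "(?f1 has_field_derivative v $ k) (at 0)" by simp
    show "tail_norm_sq k v > 0 \<or> (\<forall>\<zeta>. cmod \<zeta> \<le> 1 \<longrightarrow> ?h1 \<zeta> \<noteq> 0)"
    proof (cases "a = 1")
      \<comment> \<open>Here \<open>A = 1\<close> and the tail vanishes: the disc stays in the
        coordinate line, and \<open>b\<close> has to come from the zero-free
        \<open>h1\<close>.\<close>
      case True
      then show ?thesis using e0 s0 m0 by simp
    next
      case False
      then have "A < 1" using a m powr_less_mono2[of "2 * m" a 1] by (simp add: A)
      moreover have "A * \<sigma>\<^sup>2 \<le> A * 1" using A1 \<sigma> by (intro mult_left_mono power_le_one) auto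
      ultimately show ?thesis by (simp add: tail)
    qed
  qed (use m a \<sigma> A \<gamma> tail in auto)
  then show ?thesis by (simp add: e_def)
qed

text \<open>The limiting case \<open>\<sigma> = 1\<close>, in which the roots have a branch point at
  \<open>-1\<close>. Continuity there holds because powers with positive real exponent extend
  continuously by 0.\<close>

lemma extremal_direction_boundary_zero:
  fixes v :: "complex ^ 'n::finite"
  assumes m: "m > 1 / 2" and a: "0 < a" "a < 1"
    and A: "A = a powr (2 * m)"
    and vk: "v $ k = of_real (a * (1 - A) / m)"
    and tail: "tail_norm_sq k v = (1 - A)\<^sup>2"
  shows "extremal_direction k m (axis k (of_real a)) v"
proof -
  have A1: "0 < A" "A < 1" using a m by (auto simp: A powr_less_1)
  have m0: "m \<noteq> 0" "m > 0" using m by auto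
  define E where "E \<zeta> = exp (Ln (1 + of_real A * \<zeta>) / of_real m)" for \<zeta>
  have E: "disc_algebra E"
    unfolding E_def[abs_def] using A1 m0 one_plus_mult_nonzero(1) by (intro disc_algebra_intros) auto
  have E0: "E \<zeta> \<noteq> 0" for \<zeta> by (simp add: E_def)
  have pw: "a powr (2 * m - 1) * a = A" using a by (simp add: A powr_minus_one_mult)
  define P where "P r \<zeta> = (1 + \<zeta>) powr (of_real r)" for r :: real and \<zeta> :: complex
  have P: "disc_algebra (P r)" if "r > 0" for r
    unfolding disc_algebra_def
  proof
    have re: "Re (1 + \<zeta>) \<ge> 0" if "cmod \<zeta> \<le> 1" for \<zeta>
      using that abs_Re_le_cmod[of \<zeta>] by simp
    show "continuous_on (cball 0 1) (P r)"
      unfolding P_def[abs_def] using that re by (intro continuous_intros) auto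
    have "1 + \<zeta> \<notin> \<real>\<^sub>\<le>\<^sub>0" if "cmod \<zeta> < 1" for \<zeta>
      using that abs_Re_le_cmod[of \<zeta>] by (auto simp: complex_nonpos_Reals_iff)
    then show "P r holomorphic_on ball 0 1"
      unfolding P_def[abs_def] by (intro holomorphic_intros) auto
  qed
  \<comment> \<open>The second inequality is where \<open>m > 1 / 2\<close> enters: at
    \<open>m = 1 / 2\<close> the exponent would be 0, and the power would be 1 off the point
    \<open>-1\<close> but 0 at it.\<close>
  have exps: "1 / m > 0" "2 - 1 / m > 0" using m by (auto simp: field_simps)
  let ?f1 = "\<lambda>\<zeta>. of_real a * P (1 / m) \<zeta> / E \<zeta>"
  let ?h1 = "\<lambda>\<zeta>. of_real (m * a powr (2 * m - 1)) * P (2 - 1 / m) \<zeta> * E \<zeta>"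
  have "extremal_direction k m (axis k (?f1 0)) v"
  proof (rule extremal_direction_construct[where ?h1.0 = ?h1 and ?f1.0 = ?f1 and a = a and \<sigma> = 1 and A = A])
    show "disc_algebra ?f1" "disc_algebra ?h1" by (intro disc_algebra_intros P E E0 exps)+
    fix \<zeta> :: complex assume \<zeta>: "cmod \<zeta> = 1"
    have nz: "1 + of_real A * \<zeta> \<noteq> 0" using one_plus_mult_nonzero(2)[of \<zeta> A] \<zeta> A1 by simp
    have "cmod (E \<zeta>) powr (2 * m) = (cmod (1 + of_real A * \<zeta>))\<^sup>2"
    proof -
      have "cmod (E \<zeta>) powr (2 * m) = exp (2 * ln (cmod (1 + of_real A * \<zeta>)))"
        using nz m0 by (simp add: E_def powr_def Re_divide_of_real field_simps)
      then show ?thesis using nz by (simp add: exp_double)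
    qed
    moreover have "cmod (P (1 / m) \<zeta>) powr (2 * m) = (cmod (1 + \<zeta>))\<^sup>2"
      using m0 by (simp add: P_def norm_powr_real_powr' powr_powr)
    ultimately show "cmod (?f1 \<zeta>) powr (2 * m) * (cmod (1 + of_real (A * 1) * \<zeta>))\<^sup>2 = A * (cmod (1 + of_real 1 * \<zeta>))\<^sup>2"
      using nz a by (simp add: norm_mult norm_divide powr_mult powr_divide A)
    have PP: "P (2 - 1 / m) \<zeta> * P (1 / m) \<zeta> = (1 + \<zeta>)\<^sup>2"
    proof (cases "1 + \<zeta> = 0")
      case False
      have "P (2 - 1 / m) \<zeta> * P (1 / m) \<zeta> = (1 + \<zeta>) powr (of_nat 2)"
        unfolding P_def powr_add[symmetric] by simp
      also have "\<dots> = (1 + \<zeta>)\<^sup>2" by (subst powr_nat') auto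
      finally show ?thesis .
    qed (simp add: P_def)
    have "?h1 \<zeta> * ?f1 \<zeta> = of_real m * of_real (a powr (2 * m - 1) * a) * (P (2 - 1 / m) \<zeta> * P (1 / m) \<zeta>)"
      using E0[of \<zeta>] by (simp add: mult_ac)
    then show "?h1 \<zeta> * ?f1 \<zeta> = of_real (m * A) * (1 + of_real 1 * \<zeta>) * (\<zeta> + of_real 1)"
      unfolding PP pw by (simp add: power2_eq_square algebra_simps)
    assume "?f1 \<zeta> = 0"
    then have "1 + \<zeta> = 0" using a E0[of \<zeta>] by (auto simp: P_def)
    then show "?h1 \<zeta> = 0" by (simp add: P_def)
  next
    have "((\<lambda>\<zeta>. of_real a * exp (Ln (1 + \<zeta>) / of_real m) / E \<zeta>) has_field_derivative
        of_real a * of_real ((1 - A) / m)) (at 0)"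
      unfolding E_def[abs_def] using m0 by (auto intro!: derivative_eq_intros simp: field_simps)
    then have "(?f1 has_field_derivative of_real a * of_real ((1 - A) / m)) (at 0)"
    proof (rule has_field_derivative_transform_within_open)
      show "of_real a * exp (Ln (1 + \<zeta>) / of_real m) / E \<zeta> = ?f1 \<zeta>" if "\<zeta> \<in> ball 0 1" for \<zeta>
      proof -
        have "1 + \<zeta> \<noteq> 0" using one_plus_mult_nonzero(2)[of \<zeta> 1] that
          by (metis add.inverse_inverse add_eq_0_iff mem_ball_0 norm_minus_cancel norm_one order_less_irrefl)
        then show ?thesis by (simp add: P_def powr_def)
      qed
    qed auto
    then show "(?f1 has_field_derivative v $ k) (at 0)" by (simp add: vk)
    show "tail_norm_sq k v > 0 \<or> (\<forall>\<zeta>. cmod \<zeta> \<le> 1 \<longrightarrow> ?h1 \<zeta> \<noteq> 0)"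
      using A1 by (simp add: tail)
  qed (use m a A A1 tail in \<open>auto simp: power2_eq_square\<close>)
  then show ?thesis by (simp add: E_def P_def)
qed

subsection \<open>The formula for the metric\<close>

lemma phase_exists: "\<exists>u. cmod u = 1 \<and> u * z = of_real (cmod z)"
proof (cases "z = 0")
  case True
  then show ?thesis by (intro exI[of _ 1]) simp
next
  case False
  then show ?thesis
    by (intro exI[of _ "cnj (sgn z)"]) (simp add: cnj_sgn_mult_self norm_sgn)
qed

lemma tail_norm_sq_smult: "tail_norm_sq k (c *s v) = (cmod c)\<^sup>2 * tail_norm_sq k v"
  by (simp add: tail_norm_sq_def norm_mult power_mult_distrib sum_distrib_left)

lemma tail_norm_sq_nonneg: "tail_norm_sq k v \<ge> 0"
  by (simp add: tail_norm_sq_def sum_nonneg)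

lemma axis_in_ellipsoid:
  assumes "m > 0" "0 \<le> p" "p < 1"
  shows "axis k (complex_of_real p) \<in> ellipsoid k m"
proof -
  have "tail_norm_sq k (axis k (complex_of_real p)) = 0"
    by (simp add: tail_norm_sq_def axis_def)
  then show ?thesis
    using powr_less_1[of p "2 * m"] assms by (simp add: ellipsoid_def axis_def)
qed

lemma kobayashi_metric_scaled_extremal:
  assumes "m \<ge> 1 / 2" "z \<in> ellipsoid k m" "extremal_direction k m z (c *s v)" "cmod c = 1 / K" "K > 0"
  shows "kobayashi_metric (ellipsoid k m) z v = K"
proof -
  have "cmod c * kobayashi_metric (ellipsoid k m) z v = 1"
    using extremal_direction_eq_1[OF assms(1,3,2)] kobayashi_metric_smult[OF open_ellipsoid assms(2), of c v] assms(1)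
    by simp
  then show ?thesis using assms(4,5) by (simp add: field_simps)
qed

text \<open>The argument for Minkowski functionals: after division by \<open>A\<close> and
  \<open>B\<close> both vectors have metric below 1, and their convex combination with weights
  proportional to \<open>A\<close> and \<open>B\<close> is \<open>(v + w) / (A + B)\<close>.\<close>

lemma kobayashi_metric_subadditive:
  fixes z v w :: "complex ^ 'n::finite"
  assumes D: "open D" "convex D" "z \<in> D"
  shows "kobayashi_metric D z (v + w) \<le> kobayashi_metric D z v + kobayashi_metric D z w"
proof (rule field_le_epsilon)
  fix e :: real assume e: "e > 0"
  let ?K = "kobayashi_metric D z"
  define A where "A = ?K v + e / 2"
  define B where "B = ?K w + e / 2"
  have A: "A > 0" "?K v < A" and B: "B > 0" "?K w < B"
    using e kobayashi_metric_nonneg[OF D(1,3)] by (auto simp: A_def B_def add_nonneg_pos)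
  define s where "s = B / (A + B)"
  have s: "0 \<le> s" "s \<le> 1" using A B by (auto simp: s_def)
  have "?K ((1 / A) *\<^sub>R v) < 1" "?K ((1 / B) *\<^sub>R w) < 1"
    using A B kobayashi_metric_scaleR[OF D(1,3), of "1 / A" v] kobayashi_metric_scaleR[OF D(1,3), of "1 / B" w]
    by simp_all
  from kobayashi_metric_quasiconvex[OF D D(3) s this]
  have "?K ((1 - s) *\<^sub>R ((1 / A) *\<^sub>R v) + s *\<^sub>R ((1 / B) *\<^sub>R w)) \<le> 1"
    by (simp add: algebra_simps flip: scaleR_left_distrib)
  moreover have "1 - s = A / (A + B)" using A B by (simp add: s_def field_simps)
  then have "(1 - s) / A = 1 / (A + B)" "s / B = 1 / (A + B)"
    using A B by (simp_all add: s_def)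
  then have "(1 - s) *\<^sub>R ((1 / A) *\<^sub>R v) + s *\<^sub>R ((1 / B) *\<^sub>R w) = (1 / (A + B)) *\<^sub>R (v + w)"
    by (simp add: scaleR_right_distrib)
  ultimately have "?K (v + w) / (A + B) \<le> 1"
    using kobayashi_metric_scaleR[OF D(1,3), of "1 / (A + B)" "v + w"] A B by simp
  then show "?K (v + w) \<le> ?K v + ?K w + e"
    using A B by (simp add: A_def B_def field_simps)
qed

text \<open>Inverts the parametrisation of the zero-free discs. The base point forces
  \<open>a = p\<close> and \<open>A = P\<close>, the distinguished coordinate determines \<sigma>,
  and the remaining tail equation is the formula for \<open>K\<^sup>2\<close>. The condition
  \<open>u \<le> p\<close> amounts to \<open>\<sigma> \<le> 1\<close>, with equality exactly when
  \<open>u = p\<close>; the unit factor \<open>u\<close> in the conclusion makes the distinguished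
  coordinate nonnegative.\<close>

lemma extremal_direction_below:
  fixes v :: "complex ^ 'n::finite"
  assumes m: "m \<ge> 1 / 2" and p: "0 < p" "p < 1" and tail: "tail_norm_sq k v > 0"
    and le: "m\<^sup>2 * (cmod (v $ k))\<^sup>2 \<le> p\<^sup>2 * tail_norm_sq k v"
    and strict: "m > 1 / 2 \<or> m\<^sup>2 * (cmod (v $ k))\<^sup>2 < p\<^sup>2 * tail_norm_sq k v"
    and P: "P = p powr (2 * m)"
    and K: "K = sqrt (m\<^sup>2 * P / p\<^sup>2 * (cmod (v $ k))\<^sup>2 / (1 - P)\<^sup>2 + tail_norm_sq k v / (1 - P))"
    and u: "cmod u = 1" "u * v $ k = of_real (cmod (v $ k))"
  shows "extremal_direction k m (axis k (of_real p)) ((u / of_real K) *s v)" "K > 0"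
proof -
  have P1: "0 < P" "P < 1" using p m by (auto simp: P powr_less_1)
  define T where "T = tail_norm_sq k v"
  define c where "c = cmod (v $ k)"
  have c: "c \<ge> 0" by (simp add: c_def)
  have T: "T > 0" using tail by (simp add: T_def)
  have m0: "m > 0" using m by simp
  have "m\<^sup>2 * P / p\<^sup>2 * c\<^sup>2 / (1 - P)\<^sup>2 + T / (1 - P) > 0"
    using P1 T by (intro add_nonneg_pos) auto
  then have K0: "K > 0" and K2: "K\<^sup>2 = m\<^sup>2 * P / p\<^sup>2 * c\<^sup>2 / (1 - P)\<^sup>2 + T / (1 - P)"
    unfolding K T_def c_def by auto
  then show "K > 0" by simp
  \<comment> \<open>Solves \<open>p * \<sigma> * (1 - P) / m = c / K\<close>, the requirement on the
    distinguished coordinate of the normalised direction.\<close>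
  define \<sigma> where "\<sigma> = m * c / (p * (1 - P) * K)"
  have \<sigma>0: "\<sigma> \<ge> 0" using m0 c p P1 K0 by (simp add: \<sigma>_def)
  have \<sigma>2: "\<sigma>\<^sup>2 * (p\<^sup>2 * (1 - P)\<^sup>2 * K\<^sup>2) = m\<^sup>2 * c\<^sup>2"
    using p P1 K0 by (simp add: \<sigma>_def power_divide power_mult_distrib)
  have K2': "p\<^sup>2 * (1 - P)\<^sup>2 * K\<^sup>2 = P * (m\<^sup>2 * c\<^sup>2) + (1 - P) * (p\<^sup>2 * T)"
  proof -
    have "x\<^sup>2 * y\<^sup>2 * (m\<^sup>2 * P / x\<^sup>2 * c\<^sup>2 / y\<^sup>2 + T / y) = P * (m\<^sup>2 * c\<^sup>2) + y * (x\<^sup>2 * T)"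
      if "x \<noteq> 0" "y \<noteq> 0" for x y :: real
      using that by (simp add: distrib_left power2_eq_square)
    from this[of p "1 - P"] show ?thesis unfolding K2 using p P1 by simp
  qed
  have Tsig: "T / K\<^sup>2 = (1 - P) * (1 - P * \<sigma>\<^sup>2)"
  proof -
    have pos: "p\<^sup>2 * (1 - P) * K\<^sup>2 > 0" using p P1 K0 by simp
    have "(1 - P) * (p\<^sup>2 * T) = p\<^sup>2 * (1 - P)\<^sup>2 * K\<^sup>2 - P * (\<sigma>\<^sup>2 * (p\<^sup>2 * (1 - P)\<^sup>2 * K\<^sup>2))"
      by (subst \<sigma>2) (simp add: K2')
    then have "(p\<^sup>2 * (1 - P) * K\<^sup>2) * (T / K\<^sup>2) = (p\<^sup>2 * (1 - P) * K\<^sup>2) * ((1 - P) * (1 - P * \<sigma>\<^sup>2))"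
      using K0 by (simp add: power2_eq_square algebra_simps)
    then show ?thesis using pos by (simp only: mult_cancel_left) auto
  qed
  have pos2: "p\<^sup>2 * (1 - P)\<^sup>2 * K\<^sup>2 > 0" using p P1 K0 by simp
  have vk: "((u / of_real K) *s v) $ k = of_real (p * \<sigma> * (1 - P) / m)"
  proof -
    have "p * \<sigma> * (1 - P) / m = c / K" using p P1 K0 m0 by (simp add: \<sigma>_def)
    moreover have "((u / of_real K) *s v) $ k = (u * v $ k) / of_real K" by simp
    ultimately show ?thesis unfolding u(2) c_def by simp
  qed
  have tl: "tail_norm_sq k ((u / of_real K) *s v) = (1 - P) * (1 - P * \<sigma>\<^sup>2)"
    unfolding tail_norm_sq_smult Tsig[symmetric] T_def using u(1) K0 by (simp add: norm_divide power_divide)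
  show "extremal_direction k m (axis k (of_real p)) ((u / of_real K) *s v)"
  proof (cases "\<sigma> < 1")
    case True
    show ?thesis by (rule extremal_direction_nonvanishing[OF m p \<sigma>0 True P vk tl])
  next
    case False
    have "\<sigma>\<^sup>2 * (p\<^sup>2 * (1 - P)\<^sup>2 * K\<^sup>2) \<le> 1 * (p\<^sup>2 * (1 - P)\<^sup>2 * K\<^sup>2)"
    proof -
      have "(1 - P) * (m\<^sup>2 * c\<^sup>2) \<le> (1 - P) * (p\<^sup>2 * T)"
        using le P1 by (intro mult_left_mono) (auto simp: T_def c_def)
      then show ?thesis unfolding \<sigma>2 unfolding K2' by (simp add: algebra_simps)
    qed
    then have "\<sigma>\<^sup>2 \<le> 1" using pos2 by (simp only: mult_le_cancel_right; auto)
    then have "\<sigma> = 1" using False \<sigma>0 by (simp add: power2_le_iff_abs_le abs_square_le_1)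
    have "\<not> m\<^sup>2 * c\<^sup>2 < p\<^sup>2 * T"
    proof
      assume "m\<^sup>2 * c\<^sup>2 < p\<^sup>2 * T"
      then have "(1 - P) * (m\<^sup>2 * c\<^sup>2) < (1 - P) * (p\<^sup>2 * T)"
        using P1 by simp
      moreover have "m\<^sup>2 * c\<^sup>2 = P * (m\<^sup>2 * c\<^sup>2) + (1 - P) * (p\<^sup>2 * T)"
        using \<sigma>2 K2' \<open>\<sigma> = 1\<close> by simp
      ultimately show False by (simp add: algebra_simps)
    qed
    then have "m > 1 / 2" using strict by (simp add: T_def c_def)
    then show ?thesis
    proof (rule extremal_direction_boundary_zero[OF _ p P])
      show "((u / of_real K) *s v) $ k = of_real (p * (1 - P) / m)"
        using vk \<open>\<sigma> = 1\<close> by simp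
      show "tail_norm_sq k ((u / of_real K) *s v) = (1 - P)\<^sup>2"
        using tl \<open>\<sigma> = 1\<close> by (simp add: power2_eq_square)
    qed
  qed
qed

section \<open>The equation for \<alpha> and the range \<open>u > p\<close>\<close>

lemma alpha_equation_iff:
  fixes \<alpha> m t P :: real
  assumes "\<alpha> > 0"
  shows "\<alpha> powr (2 * m) - t * \<alpha> powr (2 * m - 2) - (1 - t) * P = 0 \<longleftrightarrow>
    \<alpha> powr (2 * m) * (1 - t / \<alpha>\<^sup>2) = (1 - t) * P"
proof -
  have "\<alpha> powr (2 * m - 2) = \<alpha> powr (2 * m) / \<alpha>\<^sup>2"
    using assms by (simp add: powr_diff powr_numeral)
  then show ?thesis by (auto simp: algebra_simps)
qed

text \<open>The extremal disc will have \<alpha> as its parameter \<sigma> and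
  \<open>p / \<alpha>\<close> as its amplitude \<open>a\<close>; the two bounds are the conditions
  \<open>\<sigma> < 1\<close> and \<open>a \<le> 1\<close> on these parameters.\<close>

lemma alpha_bounds:
  fixes \<alpha> m p t :: real
  assumes m: "m > 0" and p: "0 < p" "p < 1" and t: "0 \<le> t" "t < 1" and \<alpha>: "\<alpha> > 0"
    and eq: "\<alpha> powr (2 * m) * (1 - t / \<alpha>\<^sup>2) = (1 - t) * p powr (2 * m)"
  shows "\<alpha> < 1" "p \<le> \<alpha>"
proof -
  show "\<alpha> < 1"
  proof (rule ccontr)
    assume "\<not> \<alpha> < 1"
    then have \<alpha>1: "\<alpha> \<ge> 1" by simp
    then have "t / \<alpha>\<^sup>2 \<le> t" using t by (simp add: divide_le_eq mult_left_le mult_le_cancel_left1)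
    moreover have "\<alpha> powr (2 * m) \<ge> 1" using \<alpha>1 m by (simp add: ge_one_powr_ge_zero)
    ultimately have "1 * (1 - t) \<le> \<alpha> powr (2 * m) * (1 - t / \<alpha>\<^sup>2)"
      using t by (intro mult_mono) auto
    also have "\<dots> < (1 - t) * 1"
      unfolding eq using t powr_less_1[of p "2 * m"] p m by (intro mult_strict_left_mono) auto
    finally show False by simp
  qed
  show "p \<le> \<alpha>"
  proof (rule ccontr)
    assume "\<not> p \<le> \<alpha>"
    then have lt: "\<alpha> < p" by simp
    have "\<alpha>\<^sup>2 \<le> 1" using \<alpha> \<open>\<alpha> < 1\<close> by (simp add: power_le_one)
    then have "t / \<alpha>\<^sup>2 \<ge> t" using t \<alpha> by (simp add: le_divide_eq mult_left_le)
    then have "\<alpha> powr (2 * m) * (1 - t / \<alpha>\<^sup>2) \<le> \<alpha> powr (2 * m) * (1 - t)"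
      by (intro mult_left_mono) auto
    also have "\<dots> < p powr (2 * m) * (1 - t)"
      using t powr_less_mono2[of "2 * m" \<alpha> p] \<alpha> lt m by (intro mult_strict_right_mono) auto
    finally show False using eq by simp
  qed
qed

text \<open>The factored left-hand side \<open>g\<close> need not be monotone on the whole
  half-line, but it increases strictly from any point where it is positive, being there a product of
  a strictly increasing and a nondecreasing positive factor. The right-hand side \<open>R\<close> is
  positive, so this suffices for uniqueness. Existence is the intermediate value theorem on the
  interval from \<open>p\<close> to 1.\<close>

lemma alpha_unique:
  fixes m p t :: real
  assumes m: "m > 0" and p: "0 < p" "p < 1" and t: "0 \<le> t" "t < 1"
  shows "\<exists>!\<alpha>. 0 < \<alpha> \<and> \<alpha> powr (2 * m) - t * \<alpha> powr (2 * m - 2) - (1 - t) * p powr (2 * m) = 0"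
proof -
  define g where "g \<alpha> = \<alpha> powr (2 * m) * (1 - t / \<alpha>\<^sup>2)" for \<alpha> :: real
  define R where "R = (1 - t) * p powr (2 * m)"
  have R: "R > 0" using t p by (simp add: R_def)
  have mono: "g \<alpha> < g \<beta>" if "0 < \<alpha>" "\<alpha> < \<beta>" "g \<alpha> > 0" for \<alpha> \<beta>
  proof -
    have pos: "1 - t / \<alpha>\<^sup>2 > 0" using that by (simp add: g_def zero_less_mult_iff)
    have "\<alpha>\<^sup>2 \<le> \<beta>\<^sup>2" using that by (intro power_mono) auto
    then have "t / \<beta>\<^sup>2 \<le> t / \<alpha>\<^sup>2" using that t by (intro divide_left_mono) auto
    then have "\<beta> powr (2 * m) * (1 - t / \<beta>\<^sup>2) \<ge> \<beta> powr (2 * m) * (1 - t / \<alpha>\<^sup>2)"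
      by (intro mult_left_mono) auto
    moreover have "\<alpha> powr (2 * m) * (1 - t / \<alpha>\<^sup>2) < \<beta> powr (2 * m) * (1 - t / \<alpha>\<^sup>2)"
      using that m pos powr_less_mono2[of "2 * m" \<alpha> \<beta>] by (intro mult_strict_right_mono) auto
    ultimately show ?thesis by (simp add: g_def)
  qed
  have "\<exists>\<alpha>\<ge>p. \<alpha> \<le> 1 \<and> g \<alpha> = R"
  proof (rule IVT')
    have "p\<^sup>2 \<le> 1" using p by (simp add: power_le_one)
    then have "t / p\<^sup>2 \<ge> t" using t p by (simp add: le_divide_eq mult_left_le)
    then have "p powr (2 * m) * (1 - t / p\<^sup>2) \<le> p powr (2 * m) * (1 - t)"
      by (intro mult_left_mono) auto
    then show "g p \<le> R" by (simp add: g_def R_def mult.commute)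
    show "R \<le> g 1" using t powr_less_1[of p "2 * m"] p m by (simp add: g_def R_def mult_left_le)
    show "continuous_on {p..1} g"
      unfolding g_def[abs_def] using p m by (intro continuous_intros continuous_on_powr') auto
  qed (use p in simp)
  then obtain \<alpha> where "p \<le> \<alpha>" "g \<alpha> = R" by blast
  then have \<alpha>: "\<alpha> > 0" "g \<alpha> = R" using p by auto
  have "\<beta> = \<alpha>" if "\<beta> > 0" "g \<beta> = R" for \<beta>
    using mono[of \<alpha> \<beta>] mono[of \<beta> \<alpha>] \<alpha> that R by (cases \<alpha> \<beta> rule: linorder_cases) auto
  then have "\<exists>!\<alpha>. 0 < \<alpha> \<and> g \<alpha> = R" using \<alpha> by blast
  then show ?thesis
    unfolding g_def R_def using alpha_equation_iff by (metis (no_types, lifting))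
qed

text \<open>Inverts the parametrisation of the discs with a Blaschke factor, with
  \<open>\<sigma> = \<alpha>\<close> and \<open>a = p / \<alpha>\<close>. The equation for \<alpha>
  and the relation defining \<open>t\<close> are the two conditions that remain on the
  parameters.\<close>

lemma extremal_direction_above:
  fixes v :: "complex ^ 'n::finite"
  assumes m: "m \<ge> 1 / 2" and p: "0 < p" "p < 1" and t: "0 \<le> t" "t < 1" and \<alpha>: "\<alpha> > 0"
    and eq: "\<alpha> powr (2 * m) * (1 - t / \<alpha>\<^sup>2) = (1 - t) * p powr (2 * m)"
    and vk: "v $ k \<noteq> 0"
    and tail: "tail_norm_sq k v * (p\<^sup>2 * (m * (1 - t) + t)\<^sup>2) = m\<^sup>2 * (cmod (v $ k))\<^sup>2 * t"
    and K: "K = m * \<alpha> * (1 - t) * cmod (v $ k) / (p * (1 - \<alpha>\<^sup>2) * (m * (1 - t) + t))"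
    and u: "cmod u = 1" "u * v $ k = of_real (cmod (v $ k))"
  shows "extremal_direction k m (axis k (of_real p)) ((u / of_real K) *s v)" "K > 0"
proof -
  have m0: "m > 0" using m by simp
  note ab = alpha_bounds[OF m0 p t \<alpha> eq]
  have \<alpha>2: "\<alpha>\<^sup>2 < 1" using ab \<alpha> by (simp add: power_less_one_iff)
  define c where "c = cmod (v $ k)"
  have c: "c > 0" using vk by (simp add: c_def)
  define N where "N = m * (1 - t) + t"
  have N: "N > 0" using m0 t by (simp add: N_def add_pos_nonneg)
  show K0: "K > 0" unfolding K using m0 \<alpha> t c p \<alpha>2 N by (simp add: c_def N_def)
  define a where "a = p / \<alpha>"
  have a: "0 \<le> a" "a \<le> 1" "a * \<alpha> = p" using p \<alpha> ab by (auto simp: a_def)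
  define A where "A = a powr (2 * m)"
  have A: "A = p powr (2 * m) / \<alpha> powr (2 * m)" using p \<alpha> by (simp add: A_def a_def powr_divide)
  have "\<alpha> powr (2 * m) > 0" using \<alpha> by simp
  then have "1 - t / \<alpha>\<^sup>2 = (1 - t) * A" using eq by (simp add: A field_simps)
  \<comment> \<open>The equation for \<alpha> after substitution of \<open>A\<close>; solved for
    \<open>t\<close> it reads
    \<open>t = \<alpha>\<^sup>2 * (1 - A) / (1 - A * \<alpha>\<^sup>2)\<close>.\<close>
  then have e0: "\<alpha>\<^sup>2 - t = (1 - t) * A * \<alpha>\<^sup>2" using \<alpha> by (simp add: field_simps)
  have e1: "t * (1 - A * \<alpha>\<^sup>2) = \<alpha>\<^sup>2 * (1 - A)" and e2: "(1 - t) * (1 - A * \<alpha>\<^sup>2) = 1 - \<alpha>\<^sup>2"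
    using e0 by (auto simp: algebra_simps)
  define B where "B = 1 - A * \<alpha>\<^sup>2"
  have KN: "K = m * \<alpha> * c / (p * B * N)"
  proof -
    have "K = m * \<alpha> * (1 - t) * c / (p * ((1 - t) * B) * N)"
      unfolding K N_def c_def B_def e2 by simp
    then show ?thesis using t by simp
  qed
  have B: "B > 0" using e2 t \<alpha>2 by (simp add: B_def) (smt (verit) zero_less_mult_pos)
  have cK: "c / K = p * B * N / (m * \<alpha>)"
    unfolding KN using c m0 \<alpha> p B N by (simp add: field_simps)
  have "p * B * N / (m * \<alpha>) = a * (1 - \<alpha>\<^sup>2 + \<alpha>\<^sup>2 * (1 - A) / m)"
  proof -
    have "B * N = m * (1 - \<alpha>\<^sup>2) + \<alpha>\<^sup>2 * (1 - A)"
      unfolding N_def e1[symmetric] e2[symmetric] B_def by (simp add: algebra_simps)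
    then have "p * B * N / (m * \<alpha>) = a * ((m * (1 - \<alpha>\<^sup>2) + \<alpha>\<^sup>2 * (1 - A)) / m)"
      using \<alpha> m0 by (simp add: a_def mult.assoc)
    then show ?thesis using m0 by (simp add: add_divide_distrib)
  qed
  then have vk': "((u / of_real K) *s v) $ k = of_real (a * (1 - \<alpha>\<^sup>2 + \<alpha>\<^sup>2 * (1 - A) / m))"
  proof -
    assume *: "p * B * N / (m * \<alpha>) = a * (1 - \<alpha>\<^sup>2 + \<alpha>\<^sup>2 * (1 - A) / m)"
    have "((u / of_real K) *s v) $ k = (u * v $ k) / of_real K" by simp
    also have "\<dots> = of_real (c / K)" unfolding u(2) c_def by simp
    finally show ?thesis unfolding cK * .
  qed
  have "tail_norm_sq k ((u / of_real K) *s v) = tail_norm_sq k v / K\<^sup>2"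
    unfolding tail_norm_sq_smult using u(1) K0 by (simp add: norm_divide power_divide)
  also have "\<dots> = (1 - A) * B"
  proof -
    have "tail_norm_sq k v = m\<^sup>2 * c\<^sup>2 * t / (p\<^sup>2 * N\<^sup>2)"
      using tail p N by (simp add: N_def c_def field_simps)
    moreover have "K\<^sup>2 = m\<^sup>2 * \<alpha>\<^sup>2 * c\<^sup>2 / (p\<^sup>2 * B\<^sup>2 * N\<^sup>2)"
      unfolding KN by (simp add: power_divide power_mult_distrib)
    moreover have "(M * C * t / (Q * X)) / (M * Y * C / (Q * Z * X)) = t * Z / Y"
      if "M \<noteq> 0" "C \<noteq> 0" "Q \<noteq> 0" "X \<noteq> 0" "Y \<noteq> 0" "Z \<noteq> 0" for M C Q X Y Z :: real
      using that by simp
    ultimately have "tail_norm_sq k v / K\<^sup>2 = t * B\<^sup>2 / \<alpha>\<^sup>2"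
      using m0 c p N B \<alpha> by simp
    also have "\<dots> = (t * B) * B / \<alpha>\<^sup>2" by (simp add: power2_eq_square)
    also have "\<dots> = (1 - A) * B"
      using e1 \<alpha> by (simp add: B_def)
    finally show ?thesis .
  qed
  finally have tl: "tail_norm_sq k ((u / of_real K) *s v) = (1 - A) * (1 - A * \<alpha>\<^sup>2)"
    by (simp add: B_def)
  from extremal_direction_vanishing[OF m a(1,2) less_imp_le[OF \<alpha>] ab(1) A_def vk' tl]
  show "extremal_direction k m (axis k (of_real p)) ((u / of_real K) *s v)"
    by (simp add: a(3))
qed

text \<open>The denominator of \<open>t\<close> is half the square of \<open>q = s + sqrt D\<close>,
  so \<open>t\<close> is the square of \<open>r = 2 * m * p / q\<close>. This \<open>r\<close>
  solves the quadratic equation \<open>s * r = p * (m * (1 - r\<^sup>2) + r\<^sup>2)\<close>, whose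
  square is the last claim; \<open>p < s\<close> gives \<open>r < 1\<close>.\<close>

lemma t_param_finite:
  assumes m: "m \<ge> 1 / 2" and p: "0 < p" and s: "p < s"
  shows "0 \<le> t_param m p (ereal s)" "t_param m p (ereal s) < 1"
    "s\<^sup>2 * t_param m p (ereal s) = p\<^sup>2 * (m * (1 - t_param m p (ereal s)) + t_param m p (ereal s))\<^sup>2"
proof -
  define t where "t = t_param m p (ereal s)"
  define D where "D = s\<^sup>2 + 4 * m * (m - 1) * p\<^sup>2"
  define q where "q = s + sqrt D"
  have "s\<^sup>2 > p\<^sup>2" using p s by (simp add: power_strict_mono)
  \<comment> \<open>For \<open>m < 1\<close> the second summand of \<open>D\<close> is negative; in
    this form the radicand is visibly positive.\<close>
  moreover have "D = ((2 * m - 1) * p)\<^sup>2 + (s\<^sup>2 - p\<^sup>2)"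
    by (simp add: D_def power2_eq_square algebra_simps)
  ultimately have D: "D > ((2 * m - 1) * p)\<^sup>2" by simp
  then have D0: "D > 0" by (smt (verit) zero_le_power2)
  have "sqrt D > (2 * m - 1) * p"
    using D m p by (intro real_less_rsqrt) auto
  then have q: "q > 2 * m * p" using s by (simp add: q_def algebra_simps)
  moreover have mp: "2 * m * p > 0" using m p by simp
  ultimately have q0: "q > 0" by simp
  define den where "den = s\<^sup>2 + 2 * m * (m - 1) * p\<^sup>2 + s * sqrt D"
  have "q\<^sup>2 = 2 * den"
    using D0 by (simp add: q_def power2_sum den_def) (simp add: D_def algebra_simps)
  moreover have "t = 2 * m\<^sup>2 * p\<^sup>2 / den"
    by (simp add: t_def t_param_def den_def D_def Let_def)
  ultimately have t: "t = 4 * m\<^sup>2 * p\<^sup>2 / q\<^sup>2" by simp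
  then have tr: "t = (2 * m * p / q)\<^sup>2" by (simp add: power_divide power_mult_distrib)
  have r: "0 \<le> 2 * m * p / q" "2 * m * p / q < 1" using mp q q0 by auto
  show "0 \<le> t_param m p (ereal s)" unfolding t_def[symmetric] tr by simp
  show "t_param m p (ereal s) < 1" unfolding t_def[symmetric] tr using r by (simp add: power_less_one_iff)
  have "(q - s)\<^sup>2 = D" using D0 by (simp add: q_def)
  then have qs: "2 * q * s = q\<^sup>2 - 4 * m * (m - 1) * p\<^sup>2" by (simp add: D_def power2_diff algebra_simps)
  have "s * (2 * m * p / q) = p * (m * (1 - t) + t)"
  proof -
    have "s * (2 * m * p / q) = m * p * (2 * q * s) / q\<^sup>2" using q0 by (simp add: power2_eq_square)
    also have "\<dots> = p * (m * (1 - t) + t)"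
      unfolding qs t using q0 by (simp add: field_simps power2_eq_square)
    finally show ?thesis .
  qed
  then have "(s * (2 * m * p / q))\<^sup>2 = (p * (m * (1 - t) + t))\<^sup>2" by simp
  then show "s\<^sup>2 * t_param m p (ereal s) = p\<^sup>2 * (m * (1 - t_param m p (ereal s)) + t_param m p (ereal s))\<^sup>2"
    unfolding t_def[symmetric] power_mult_distrib tr[symmetric] .
qed

lemma kobayashi_metric_below_strict:
  fixes v :: "complex ^ 'n::finite"
  assumes m: "m \<ge> 1 / 2" and p: "0 < p" "p < 1" and tail: "tail_norm_sq k v > 0"
    and le: "m\<^sup>2 * (cmod (v $ k))\<^sup>2 \<le> p\<^sup>2 * tail_norm_sq k v"
    and strict: "m > 1 / 2 \<or> m\<^sup>2 * (cmod (v $ k))\<^sup>2 < p\<^sup>2 * tail_norm_sq k v"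
    and P: "P = p powr (2 * m)"
  shows "kobayashi_metric (ellipsoid k m) (axis k (of_real p)) v =
    sqrt (m\<^sup>2 * P / p\<^sup>2 * (cmod (v $ k))\<^sup>2 / (1 - P)\<^sup>2 + tail_norm_sq k v / (1 - P))"
proof -
  obtain u where u: "cmod u = 1" "u * v $ k = of_real (cmod (v $ k))"
    using phase_exists by blast
  note ex = extremal_direction_below[OF m p tail le strict P refl u]
  show ?thesis
    using m p ex(2) u(1)
    by (intro kobayashi_metric_scaled_extremal[OF m _ ex(1)] axis_in_ellipsoid) (auto simp: norm_divide)
qed

text \<open>For \<open>m = 1 / 2\<close> and \<open>u = p\<close> the dual of the extremal disc is discontinuous at a boundary point; that
  case is reached by letting \<open>v $ k\<close> increase.\<close>

lemma kobayashi_metric_below: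
  fixes v :: "complex ^ 'n::finite"
  assumes m: "m \<ge> 1 / 2" and p: "0 < p" "p < 1" and tail: "tail_norm_sq k v > 0"
    and le: "m\<^sup>2 * (cmod (v $ k))\<^sup>2 \<le> p\<^sup>2 * tail_norm_sq k v"
    and P: "P = p powr (2 * m)"
  shows "kobayashi_metric (ellipsoid k m) (axis k (of_real p)) v =
    sqrt (m\<^sup>2 * P / p\<^sup>2 * (cmod (v $ k))\<^sup>2 / (1 - P)\<^sup>2 + tail_norm_sq k v / (1 - P))"
proof (cases "m\<^sup>2 * (cmod (v $ k))\<^sup>2 < p\<^sup>2 * tail_norm_sq k v")
  case True
  then show ?thesis using kobayashi_metric_below_strict[OF m p tail le _ P] by blast
next
  case False
  have m0: "m > 0" using m by simp
  let ?E = "ellipsoid k m" and ?z = "axis k (complex_of_real p)"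
  let ?K = "kobayashi_metric ?E ?z"
  have E: "open ?E" "convex ?E" "?z \<in> ?E"
    using m0 m p by (auto intro: open_ellipsoid convex_ellipsoid axis_in_ellipsoid)
  define c1 where "c1 = m\<^sup>2 * P / p\<^sup>2 * (cmod (v $ k))\<^sup>2 / (1 - P)\<^sup>2"
  define c2 where "c2 = tail_norm_sq k v / (1 - P)"
  define w where "w = axis k (v $ k)"
  define V where "V \<epsilon> = v + (- \<epsilon>) *\<^sub>R w" for \<epsilon> :: real
  define F where "F \<epsilon> = sqrt (c1 * (1 - \<epsilon>)\<^sup>2 + c2)" for \<epsilon> :: real
  have pos: "m\<^sup>2 * (cmod (v $ k))\<^sup>2 > 0"
  proof -
    have "p\<^sup>2 * tail_norm_sq k v > 0" using p tail by simp
    with False show ?thesis by linarith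
  qed
  have KV: "?K (V \<epsilon>) = F \<epsilon>" if \<epsilon>: "0 < \<epsilon>" "\<epsilon> < 1" for \<epsilon>
  proof -
    have Vk: "cmod (V \<epsilon> $ k) = (1 - \<epsilon>) * cmod (v $ k)"
    proof -
      have "V \<epsilon> $ k = of_real (1 - \<epsilon>) * v $ k"
        unfolding V_def w_def vector_add_component vector_scaleR_component
        by (simp add: axis_def scaleR_conv_of_real algebra_simps)
      then show ?thesis using \<epsilon> by (simp only: norm_mult norm_of_real; simp)
    qed
    have tl: "tail_norm_sq k (V \<epsilon>) = tail_norm_sq k v"
      unfolding tail_norm_sq_def by (intro sum.cong) (auto simp: V_def w_def axis_def)
    have "m\<^sup>2 * (cmod (V \<epsilon> $ k))\<^sup>2 = (1 - \<epsilon>)\<^sup>2 * (m\<^sup>2 * (cmod (v $ k))\<^sup>2)"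
      unfolding Vk by (simp add: power_mult_distrib)
    also have "\<dots> < 1 * (m\<^sup>2 * (cmod (v $ k))\<^sup>2)"
      using \<epsilon> pos by (intro mult_strict_right_mono) (auto simp: power_less_one_iff)
    finally have less: "m\<^sup>2 * (cmod (V \<epsilon> $ k))\<^sup>2 < p\<^sup>2 * tail_norm_sq k (V \<epsilon>)"
      unfolding tl using le by simp
    have "?K (V \<epsilon>) = sqrt (m\<^sup>2 * P / p\<^sup>2 * (cmod (V \<epsilon> $ k))\<^sup>2 / (1 - P)\<^sup>2 + tail_norm_sq k (V \<epsilon>) / (1 - P))"
      using less tail by (intro kobayashi_metric_below_strict[OF m p _ _ _ P]) (auto simp: tl)
    then show ?thesis
      unfolding F_def c1_def c2_def Vk tl by (simp add: power_mult_distrib mult_ac)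
  qed
  \<comment> \<open>Subadditivity in both directions bounds the change of the metric by
    \<open>\<epsilon> * ?K w\<close>, so the limit needs no prior continuity in the
    direction.\<close>
  have "norm (?K v - F \<epsilon>) \<le> \<epsilon> * ?K w" if \<epsilon>: "0 < \<epsilon>" "\<epsilon> < 1" for \<epsilon>
  proof -
    have Kw: "?K (\<epsilon> *\<^sub>R w) = \<epsilon> * ?K w" "?K ((- \<epsilon>) *\<^sub>R w) = \<epsilon> * ?K w"
      using kobayashi_metric_smult[OF E(1,3), of "of_real \<epsilon>" w]
        kobayashi_metric_smult[OF E(1,3), of "of_real (- \<epsilon>)" w] \<epsilon>
      unfolding scaleR_eq_smult by simp_all
    have "?K (V \<epsilon>) \<le> ?K v + \<epsilon> * ?K w"
      unfolding V_def Kw(2)[symmetric] by (rule kobayashi_metric_subadditive[OF E])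
    moreover have "v = V \<epsilon> + \<epsilon> *\<^sub>R w" by (simp add: V_def)
    then have "?K v \<le> ?K (V \<epsilon>) + \<epsilon> * ?K w"
      using kobayashi_metric_subadditive[OF E, of "V \<epsilon>" "\<epsilon> *\<^sub>R w"] Kw(1) by simp
    ultimately show ?thesis unfolding KV[OF \<epsilon>] by (simp add: abs_le_iff)
  qed
  then have "eventually (\<lambda>\<epsilon>. norm (?K v - F \<epsilon>) \<le> \<epsilon> * ?K w) (at_right 0)"
    unfolding eventually_at_right_field by (intro exI[of _ 1]) auto
  moreover have "((\<lambda>\<epsilon>. \<epsilon> * ?K w) \<longlongrightarrow> 0) (at_right 0)"
    by (auto intro!: tendsto_eq_intros)
  ultimately have "((\<lambda>\<epsilon>. ?K v - F \<epsilon>) \<longlongrightarrow> 0) (at_right 0)"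
    by (rule Lim_null_comparison)
  moreover have "((\<lambda>\<epsilon>. ?K v - F \<epsilon>) \<longlongrightarrow> ?K v - sqrt (c1 * (1 - 0)\<^sup>2 + c2)) (at_right 0)"
    unfolding F_def by (intro tendsto_intros)
  ultimately have "?K v - sqrt (c1 * (1 - 0)\<^sup>2 + c2) = 0"
    by (intro tendsto_unique[OF trivial_limit_at_right_real])
  then show ?thesis by (simp add: c1_def c2_def)
qed

section \<open>From the parameters \<open>u\<close> and \<open>t\<close> to conditions on the
  vector\<close>

lemma tail_norm_sq_eq_0_imp:
  fixes v :: "complex ^ 'n::finite"
  assumes "tail_norm_sq k v = 0" "v \<noteq> 0"
  shows "v $ k \<noteq> 0"
proof
  assume vk: "v $ k = 0"
  have "\<forall>j\<in>UNIV - {k}. (cmod (v $ j))\<^sup>2 = 0"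
    using assms(1) unfolding tail_norm_sq_def by (subst (asm) sum_nonneg_eq_0_iff) auto
  then have "v $ j = 0" for j using vk by (cases "j = k") auto
  then show False using assms(2) by (simp add: vec_eq_iff)
qed

text \<open>The relation between \<open>t\<close> and the tail is cleared of denominators so that it
  also covers \<open>u = \<infinity>\<close>, where the tail and \<open>t\<close> both
  vanish.\<close>

lemma u_param_greater:
  fixes v :: "complex ^ 'n::finite"
  assumes m: "m \<ge> 1 / 2" and p: "0 < p" and v: "v \<noteq> 0" and u: "u_param k m v > ereal p"
  defines "t \<equiv> t_param m p (u_param k m v)"
  shows "0 \<le> t" "t < 1" "v $ k \<noteq> 0"
    "tail_norm_sq k v * (p\<^sup>2 * (m * (1 - t) + t)\<^sup>2) = m\<^sup>2 * (cmod (v $ k))\<^sup>2 * t"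
proof -
  have "0 \<le> t \<and> t < 1 \<and> v $ k \<noteq> 0 \<and>
      tail_norm_sq k v * (p\<^sup>2 * (m * (1 - t) + t)\<^sup>2) = m\<^sup>2 * (cmod (v $ k))\<^sup>2 * t"
  proof (cases "tail_norm_sq k v = 0")
    case True
    then have "t = 0" by (simp add: t_def t_param_def u_param_def)
    then show ?thesis using True tail_norm_sq_eq_0_imp[OF True v] by simp
  next
    case False
    define s where "s = sqrt (m\<^sup>2 * (cmod (v $ k))\<^sup>2 / tail_norm_sq k v)"
    have us: "u_param k m v = ereal s" using False by (simp add: u_param_def s_def)
    have ps: "p < s" using u unfolding us by simp
    have t: "t = t_param m p (ereal s)" by (simp add: t_def us)
    note tp = t_param_finite[OF m p ps, folded t]
    have "v $ k \<noteq> 0" using ps p by (auto simp: s_def)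
    moreover have "s\<^sup>2 = m\<^sup>2 * (cmod (v $ k))\<^sup>2 / tail_norm_sq k v"
      unfolding s_def using tail_norm_sq_nonneg[of k v] by (simp add: zero_le_divide_iff)
    then have "tail_norm_sq k v * s\<^sup>2 = m\<^sup>2 * (cmod (v $ k))\<^sup>2" using False by simp
    then have "tail_norm_sq k v * (s\<^sup>2 * t) = m\<^sup>2 * (cmod (v $ k))\<^sup>2 * t" by simp
    ultimately show ?thesis using tp by simp
  qed
  then show "0 \<le> t" "t < 1" "v $ k \<noteq> 0"
    "tail_norm_sq k v * (p\<^sup>2 * (m * (1 - t) + t)\<^sup>2) = m\<^sup>2 * (cmod (v $ k))\<^sup>2 * t" by auto
qed

lemma u_param_leD:
  fixes v :: "complex ^ 'n::finite"
  assumes "u_param k m v \<le> ereal p" "0 < p"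
  shows "tail_norm_sq k v > 0" "m\<^sup>2 * (cmod (v $ k))\<^sup>2 \<le> p\<^sup>2 * tail_norm_sq k v"
proof -
  have "tail_norm_sq k v \<noteq> 0" using assms by (auto simp: u_param_def)
  then show T: "tail_norm_sq k v > 0" using tail_norm_sq_nonneg[of k v] by simp
  have "sqrt (m\<^sup>2 * (cmod (v $ k))\<^sup>2 / tail_norm_sq k v) \<le> p"
    using assms T by (simp add: u_param_def)
  then have "m\<^sup>2 * (cmod (v $ k))\<^sup>2 / tail_norm_sq k v \<le> p\<^sup>2" by (rule sqrt_le_D)
  then show "m\<^sup>2 * (cmod (v $ k))\<^sup>2 \<le> p\<^sup>2 * tail_norm_sq k v" using T by (simp add: divide_le_eq)
qed

lemma kobayashi_metric_above:
  fixes v :: "complex ^ 'n::finite"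
  assumes m: "m \<ge> 1 / 2" and p: "0 < p" "p < 1" and t: "0 \<le> t" "t < 1" and \<alpha>: "\<alpha> > 0"
    and eq: "\<alpha> powr (2 * m) - t * \<alpha> powr (2 * m - 2) - (1 - t) * p powr (2 * m) = 0"
    and vk: "v $ k \<noteq> 0"
    and tail: "tail_norm_sq k v * (p\<^sup>2 * (m * (1 - t) + t)\<^sup>2) = m\<^sup>2 * (cmod (v $ k))\<^sup>2 * t"
  shows "kobayashi_metric (ellipsoid k m) (axis k (of_real p)) v =
    m * \<alpha> * (1 - t) * cmod (v $ k) / (p * (1 - \<alpha>\<^sup>2) * (m * (1 - t) + t))"
proof -
  obtain u where u: "cmod u = 1" "u * v $ k = of_real (cmod (v $ k))"
    using phase_exists by blast
  define K where "K = m * \<alpha> * (1 - t) * cmod (v $ k) / (p * (1 - \<alpha>\<^sup>2) * (m * (1 - t) + t))"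
  note ex = extremal_direction_above[OF m p t \<alpha> eq[unfolded alpha_equation_iff[OF \<alpha>]] vk tail K_def u]
  show ?thesis
    unfolding K_def[symmetric] using m p ex(2) u(1)
    by (intro kobayashi_metric_scaled_extremal[OF m _ ex(1)] axis_in_ellipsoid) (auto simp: norm_divide)
qed

text \<open>With \<open>\<sigma> = 0\<close> the explicit discs are linear. The scale
  \<open>x\<close> that brings \<open>x *\<^sub>R v\<close> to the boundary comes from the
  intermediate value theorem, since \<open>g x\<close> is the defining function along this
  ray.\<close>

lemma extremal_direction_origin:
  fixes v :: "complex ^ 'n::finite"
  assumes m: "m \<ge> 1 / 2" and v: "v \<noteq> 0"
  shows "\<exists>c. c \<noteq> 0 \<and> extremal_direction k m (axis k 0) (c *s v)"
proof -
  obtain u where u: "cmod u = 1" "u * v $ k = of_real (cmod (v $ k))"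
    using phase_exists by blast
  define c where "c = cmod (v $ k)"
  define T where "T = tail_norm_sq k v"
  define g where "g x = (x * c) powr (2 * m) + x\<^sup>2 * T" for x :: real
  have T: "T \<ge> 0" by (simp add: T_def tail_norm_sq_nonneg)
  have c0: "c \<ge> 0" by (simp add: c_def)
  have "\<exists>L\<ge>0. g L \<ge> 1"
  proof (cases "T = 0")
    case True
    then have "c > 0" using tail_norm_sq_eq_0_imp[OF _ v, of k] by (simp add: T_def c_def)
    then show ?thesis by (intro exI[of _ "1 / c"]) (simp add: g_def True)
  next
    case False
    then have "T > 0" using T by simp
    then show ?thesis by (intro exI[of _ "1 / sqrt T"]) (simp add: g_def power_divide)
  qed
  then obtain L where L: "L \<ge> 0" "g L \<ge> 1" by blast
  have "\<exists>x\<ge>0. x \<le> L \<and> g x = 1"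
  proof (rule IVT')
    show "g 0 \<le> 1" by (simp add: g_def)
    show "continuous_on {0..L} g"
      unfolding g_def[abs_def] using m c0 by (intro continuous_intros continuous_on_powr') auto
  qed (use L in auto)
  then obtain x where x: "x \<ge> 0" "g x = 1" by blast
  have x0: "x > 0" using x by (cases "x = 0") (auto simp: g_def)
  define a where "a = x * c"
  define A where "A = a powr (2 * m)"
  have a0: "a \<ge> 0" using x c0 by (simp add: a_def)
  have AT: "A + x\<^sup>2 * T = 1" using x(2) by (simp add: g_def A_def a_def)
  have a1: "a \<le> 1"
  proof (rule ccontr)
    assume "\<not> a \<le> 1"
    then have "1 powr (2 * m) < a powr (2 * m)" using m by (intro powr_less_mono2) auto
    moreover have "x\<^sup>2 * T \<ge> 0" using T by simp
    ultimately show False using AT by (simp add: A_def)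
  qed
  have "extremal_direction k m (axis k (of_real (a * 0))) ((of_real x * u) *s v)"
  proof (rule extremal_direction_vanishing[OF m a0 a1 _ _ A_def])
    have "((of_real x * u) *s v) $ k = of_real x * (u * v $ k)" by simp
    also have "\<dots> = of_real a" unfolding u(2) by (simp add: a_def c_def)
    finally show "((of_real x * u) *s v) $ k = of_real (a * (1 - 0\<^sup>2 + 0\<^sup>2 * (1 - A) / m))" by simp
    show "tail_norm_sq k ((of_real x * u) *s v) = (1 - A) * (1 - A * 0\<^sup>2)"
      unfolding tail_norm_sq_smult using u(1) AT by (simp add: norm_mult T_def)
  qed auto
  then have "extremal_direction k m (axis k 0) ((of_real x * u) *s v)" by simp
  moreover have "of_real x * u \<noteq> 0" using x0 u(1) by auto
  ultimately show ?thesis by blast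
qed

lemma extremal_direction_exists:
  fixes v :: "complex ^ 'n::finite"
  assumes m: "m > 1 / 2" and p: "0 \<le> p" "p < 1" and v: "v \<noteq> 0"
  shows "\<exists>c. c \<noteq> 0 \<and> extremal_direction k m (axis k (of_real p)) (c *s v)"
proof (cases "p = 0")
  case True
  then show ?thesis using extremal_direction_origin[OF _ v, of m k] m by simp
next
  case False
  then have p: "0 < p" "p < 1" using p by auto
  have m': "m \<ge> 1 / 2" using m by simp
  obtain u where u: "cmod u = 1" "u * v $ k = of_real (cmod (v $ k))"
    using phase_exists by blast
  show ?thesis
  proof (cases "u_param k m v \<le> ereal p")
    case True
    obtain K where "extremal_direction k m (axis k (of_real p)) ((u / of_real K) *s v)" "K > 0"
      using extremal_direction_below[OF m' p u_param_leD[OF True p(1)] disjI1[OF m] refl refl u] by blast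
    then show ?thesis using u(1) by (intro exI[of _ "u / of_real K"]) auto
  next
    case False
    then have gt: "u_param k m v > ereal p" by simp
    note t = u_param_greater[OF m' p(1) v gt]
    obtain \<alpha> where \<alpha>: "\<alpha> > 0" "\<alpha> powr (2 * m) - t_param m p (u_param k m v) * \<alpha> powr (2 * m - 2) -
        (1 - t_param m p (u_param k m v)) * p powr (2 * m) = 0"
      using alpha_unique[OF _ p t(1,2), of m] m by auto
    obtain K where "extremal_direction k m (axis k (of_real p)) ((u / of_real K) *s v)" "K > 0"
      using extremal_direction_above[OF m' p t(1,2) \<alpha>(1) \<alpha>(2)[unfolded alpha_equation_iff[OF \<alpha>(1)]]
        t(3,4) refl u] by blast
    then show ?thesis using u(1) by (intro exI[of _ "u / of_real K"]) auto
  qed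
qed

lemma kobayashi_metric_formula:
  fixes m p :: real and k :: "'n::finite" and v :: "complex ^ 'n"
  assumes m: "m \<ge> 1 / 2" and p: "0 < p" "p < 1" and v: "v \<noteq> 0"
  defines "u \<equiv> u_param k m v"
  defines "t \<equiv> t_param m p u"
  defines "is_sol \<equiv> (\<lambda>\<alpha>::real. 0 < \<alpha> \<and>
             \<alpha> powr (2 * m) - t * \<alpha> powr (2 * m - 2) - (1 - t) * p powr (2 * m) = 0)"
  shows "u \<le> ereal p \<Longrightarrow> kobayashi_metric (ellipsoid k m) (axis k (complex_of_real p)) v =
      sqrt (m\<^sup>2 * p powr (2 * m - 2) * (cmod (v $ k))\<^sup>2 / (1 - p powr (2 * m))\<^sup>2
        + (\<Sum>j \<in> UNIV - {k}. (cmod (v $ j))\<^sup>2 / (1 - p powr (2 * m))))"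
    and "u > ereal p \<Longrightarrow> \<exists>!\<alpha>. is_sol \<alpha>"
    and "u > ereal p \<Longrightarrow> is_sol \<alpha> \<Longrightarrow> kobayashi_metric (ellipsoid k m) (axis k (complex_of_real p)) v =
      m * \<alpha> * (1 - t) * cmod (v $ k) / (p * (1 - \<alpha>\<^sup>2) * (m * (1 - t) + t))"
proof -
  assume le: "u \<le> ereal p"
  have "p powr (2 * m - 2) = p powr (2 * m) / p\<^sup>2"
    using p by (simp add: powr_diff powr_numeral)
  then show "kobayashi_metric (ellipsoid k m) (axis k (complex_of_real p)) v =
      sqrt (m\<^sup>2 * p powr (2 * m - 2) * (cmod (v $ k))\<^sup>2 / (1 - p powr (2 * m))\<^sup>2
        + (\<Sum>j \<in> UNIV - {k}. (cmod (v $ j))\<^sup>2 / (1 - p powr (2 * m))))"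
    using kobayashi_metric_below[OF m p u_param_leD[OF le[unfolded u_def] p(1)] refl]
    by (simp add: tail_norm_sq_def sum_divide_distrib)
next
  assume "u > ereal p"
  then have gt: "u_param k m v > ereal p" by (simp add: u_def)
  note t = u_param_greater[OF m p(1) v gt, folded u_def, folded t_def]
  show "\<exists>!\<alpha>. is_sol \<alpha>"
    unfolding is_sol_def using alpha_unique[OF _ p t(1,2), of m] m by simp
next
  assume "u > ereal p" and sol: "is_sol \<alpha>"
  then have gt: "u_param k m v > ereal p" by (simp add: u_def)
  note t = u_param_greater[OF m p(1) v gt, folded u_def, folded t_def]
  show "kobayashi_metric (ellipsoid k m) (axis k (complex_of_real p)) v =
      m * \<alpha> * (1 - t) * cmod (v $ k) / (p * (1 - \<alpha>\<^sup>2) * (m * (1 - t) + t))"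
    using sol unfolding is_sol_def by (intro kobayashi_metric_above[OF m p t(1,2) _ _ t(3,4)]) auto
qed

subsection \<open>Automorphisms of the ellipsoid\<close>

text \<open>Formulated by composition with discs: \<open>\<Phi>' z v\<close> plays the part of the
  complex derivative of \<Phi> at \<open>z\<close> in direction \<open>v\<close>, and only its
  effect on one-variable derivatives is recorded.\<close>

definition kobayashi_morphism ::
    "(complex ^ 'n) set \<Rightarrow> (complex ^ 'n \<Rightarrow> complex ^ 'n) \<Rightarrow> (complex ^ 'n \<Rightarrow> complex ^ 'n \<Rightarrow> complex ^ 'n) \<Rightarrow> bool"
  where "kobayashi_morphism D \<Phi> \<Phi>' \<longleftrightarrow> (\<forall>z v g r. 0 < r \<longrightarrow> kobayashi_disc D z v g r \<longrightarrow>
    kobayashi_disc D (\<Phi> z) (\<Phi>' z v) (\<lambda>\<zeta>. \<Phi> (g \<zeta>)) r)"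

lemma kobayashi_morphism_in:
  assumes "kobayashi_morphism D \<Phi> \<Phi>'" "z \<in> D"
  shows "\<Phi> z \<in> D"
proof -
  have "kobayashi_disc D z 0 (\<lambda>_. z) 1" using assms(2) by (intro kobayashi_discI) auto
  then have "kobayashi_disc D (\<Phi> z) (\<Phi>' z 0) (\<lambda>_. \<Phi> z) 1"
    using assms(1) by (auto simp: kobayashi_morphism_def)
  then have "(\<lambda>_. \<Phi> z) ` ball (0::complex) 1 \<subseteq> D" by (simp add: kobayashi_disc_def)
  moreover have "\<Phi> z \<in> (\<lambda>_. \<Phi> z) ` ball (0::complex) 1" by (rule image_eqI[of _ _ 0]) auto
  ultimately show ?thesis by blast
qed

lemma kobayashi_morphism_le:
  fixes z v :: "complex ^ 'n::finite"
  assumes "open D" "kobayashi_morphism D \<Phi> \<Phi>'" "z \<in> D"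
  shows "kobayashi_metric D (\<Phi> z) (\<Phi>' z v) \<le> kobayashi_metric D z v"
proof (rule kobayashi_metric_greatest[OF assms(1,3)])
  fix f r assume "kobayashi_disc D z v f r" "r > 0"
  then have "kobayashi_disc D (\<Phi> z) (\<Phi>' z v) (\<lambda>\<zeta>. \<Phi> (f \<zeta>)) r"
    using assms(2) by (auto simp: kobayashi_morphism_def)
  then show "kobayashi_metric D (\<Phi> z) (\<Phi>' z v) \<le> 1 / r"
    using \<open>r > 0\<close> by (rule kobayashi_metric_le)
qed

text \<open>The chain rule read off one disc: pushed forward by \<Phi> and \<Psi> it agrees with
  itself, and its derivative at 0 is unique.\<close>

lemma kobayashi_morphism_inverse_deriv:
  fixes z v :: "complex ^ 'n::finite"
  assumes D: "open D" "z \<in> D" and \<Phi>: "kobayashi_morphism D \<Phi> \<Phi>'" and \<Psi>: "kobayashi_morphism D \<Psi> \<Psi>'"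
    and inv: "\<And>z. z \<in> D \<Longrightarrow> \<Psi> (\<Phi> z) = z"
  shows "\<Psi>' (\<Phi> z) (\<Phi>' z v) = v"
proof -
  obtain r g where r: "r > 0" and g: "kobayashi_disc D z v g r"
    using kobayashi_disc_exists[OF D] by blast
  have "kobayashi_disc D (\<Phi> z) (\<Phi>' z v) (\<lambda>\<zeta>. \<Phi> (g \<zeta>)) r"
    using \<Phi> r g by (auto simp: kobayashi_morphism_def)
  then have h: "kobayashi_disc D (\<Psi> (\<Phi> z)) (\<Psi>' (\<Phi> z) (\<Phi>' z v)) (\<lambda>\<zeta>. \<Psi> (\<Phi> (g \<zeta>))) r"
    using \<Psi> r unfolding kobayashi_morphism_def by blast
  show ?thesis
    unfolding vec_eq_iff
  proof
    fix i
    have "((\<lambda>\<zeta>. g \<zeta> $ i) has_field_derivative \<Psi>' (\<Phi> z) (\<Phi>' z v) $ i) (at 0)"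
    proof (rule has_field_derivative_transform_within_open[OF kobayashi_disc_DERIV[OF h r] open_ball])
      show "0 \<in> ball 0 r" using r by simp
      fix \<zeta> :: complex assume "\<zeta> \<in> ball 0 r"
      then have "g \<zeta> \<in> D" using g by (auto simp: kobayashi_disc_def)
      then show "\<Psi> (\<Phi> (g \<zeta>)) $ i = g \<zeta> $ i" by (simp add: inv)
    qed
    with kobayashi_disc_DERIV[OF g r] show "\<Psi>' (\<Phi> z) (\<Phi>' z v) $ i = v $ i"
      by (intro DERIV_unique)
  qed
qed

lemma kobayashi_metric_invariant:
  fixes z v :: "complex ^ 'n::finite"
  assumes D: "open D" "z \<in> D" and \<Phi>: "kobayashi_morphism D \<Phi> \<Phi>'" and \<Psi>: "kobayashi_morphism D \<Psi> \<Psi>'"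
    and inv: "\<And>z. z \<in> D \<Longrightarrow> \<Psi> (\<Phi> z) = z"
  shows "kobayashi_metric D (\<Phi> z) (\<Phi>' z v) = kobayashi_metric D z v"
proof (rule antisym)
  show "kobayashi_metric D (\<Phi> z) (\<Phi>' z v) \<le> kobayashi_metric D z v"
    by (rule kobayashi_morphism_le[OF D(1) \<Phi> D(2)])
  show "kobayashi_metric D z v \<le> kobayashi_metric D (\<Phi> z) (\<Phi>' z v)"
    using kobayashi_morphism_le[OF D(1) \<Psi> kobayashi_morphism_in[OF \<Phi> D(2)], of "\<Phi>' z v"]
    by (simp add: inv[OF D(2)] kobayashi_morphism_inverse_deriv[OF D \<Phi> \<Psi> inv])
qed

text \<open>Positivity is carried along with differentiability because the continuity of the
  derivative will rest on both, and automorphisms transport both.\<close>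

definition regular_point :: "(complex ^ 'n::finite) set \<Rightarrow> complex ^ 'n \<Rightarrow> bool"
  where "regular_point D z \<longleftrightarrow> (\<forall>v. v \<noteq> 0 \<longrightarrow> kobayashi_metric D z v > 0 \<and>
    (\<lambda>x. kobayashi_metric D (fst x) (snd x)) differentiable (at (z, v)))"

lemma differentiable_vecI:
  fixes f :: "'a::real_normed_vector \<Rightarrow> complex ^ 'n::finite"
  assumes "\<And>i. (\<lambda>x. f x $ i) differentiable (at x)"
  shows "f differentiable (at x)"
proof -
  have ax: "bounded_linear (\<lambda>y. axis i y :: complex ^ 'n)" for i
    unfolding linear_conv_bounded_linear[symmetric]
    by (rule linearI) (auto simp: axis_def vec_eq_iff)
  have "(\<lambda>x. \<Sum>i\<in>UNIV. axis i (f x $ i) :: complex ^ 'n) differentiable (at x)"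
    using assms bounded_linear_imp_differentiable[OF ax]
    by (intro differentiable_sum) (auto intro: differentiable_compose[where f = "axis _"])
  moreover have "(\<Sum>i\<in>UNIV. axis i (f x $ i)) = f x" for x
    by (simp add: vec_eq_iff axis_def if_distrib cong: if_cong)
  ultimately show ?thesis by simp
qed

text \<open>Near \<open>(z, v)\<close> the metric equals itself composed with
  \<open>(\<Phi>, \<Phi>')\<close>, so the chain rule applies. The image of a nonzero direction is
  nonzero because \<open>\<Psi>'\<close> recovers it.\<close>

lemma regular_point_pullback:
  fixes z :: "complex ^ 'n::finite" and \<Phi> :: "complex ^ 'n \<Rightarrow> complex ^ 'n"
    and \<Phi>' :: "complex ^ 'n \<Rightarrow> complex ^ 'n \<Rightarrow> complex ^ 'n"
  assumes D: "open D" "z \<in> D" and \<Phi>: "kobayashi_morphism D \<Phi> \<Phi>'" and \<Psi>: "kobayashi_morphism D \<Psi> \<Psi>'"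
    and inv: "\<And>z. z \<in> D \<Longrightarrow> \<Psi> (\<Phi> z) = z" and \<Psi>0: "\<And>w. \<Psi>' w 0 = 0"
    and diff: "\<And>(v :: complex ^ 'n) i. (\<lambda>x. \<Phi> (fst x) $ i) differentiable (at (z, v))"
      "\<And>v i. (\<lambda>x. \<Phi>' (fst x) (snd x) $ i) differentiable (at (z, v))"
    and reg: "regular_point D (\<Phi> z)"
  shows "regular_point D z"
  unfolding regular_point_def
proof (intro allI impI conjI)
  fix v :: "complex ^ 'n" assume v: "v \<noteq> 0"
  have \<Phi>v: "\<Phi>' z v \<noteq> 0"
    using kobayashi_morphism_inverse_deriv[OF D \<Phi> \<Psi> inv, of v] v \<Psi>0 by metis
  then show "kobayashi_metric D z v > 0"
    using reg kobayashi_metric_invariant[OF D \<Phi> \<Psi> inv, of v] by (auto simp: regular_point_def)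
  define \<Theta> where "\<Theta> x = (\<Phi> (fst x), \<Phi>' (fst x) (snd x))" for x
  have "(\<lambda>x. \<Phi> (fst x)) differentiable (at (z, v))"
    by (rule differentiable_vecI) (rule diff(1))
  then obtain d1 where d1: "((\<lambda>x. \<Phi> (fst x)) has_derivative d1) (at (z, v))"
    by (auto simp: differentiable_def)
  have "(\<lambda>x. \<Phi>' (fst x) (snd x)) differentiable (at (z, v))"
    by (rule differentiable_vecI) (rule diff(2))
  then obtain d2 where d2: "((\<lambda>x. \<Phi>' (fst x) (snd x)) has_derivative d2) (at (z, v))"
    by (auto simp: differentiable_def)
  have \<Theta>: "(\<Theta> has_derivative (\<lambda>h. (d1 h, d2 h))) (at (z, v))"
    unfolding \<Theta>_def[abs_def] by (rule has_derivative_Pair[OF d1 d2])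
  obtain K' where "((\<lambda>x. kobayashi_metric D (fst x) (snd x)) has_derivative K') (at (\<Theta> (z, v)))"
    using reg \<Phi>v unfolding regular_point_def differentiable_def by (auto simp: \<Theta>_def)
  from has_derivative_compose[OF \<Theta> this]
  have "((\<lambda>x. kobayashi_metric D (fst (\<Theta> x)) (snd (\<Theta> x))) has_derivative (\<lambda>h. K' (d1 h, d2 h))) (at (z, v))" .
  then have "((\<lambda>x. kobayashi_metric D (fst x) (snd x)) has_derivative (\<lambda>h. K' (d1 h, d2 h))) (at (z, v))"
  proof (rule has_derivative_transform_within_open)
    show "open (D \<times> UNIV)" using D by (intro open_Times) auto
    show "(z, v) \<in> D \<times> UNIV" using D by simp
    fix x :: "(complex ^ 'n) \<times> (complex ^ 'n)" assume "x \<in> D \<times> UNIV"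
    then have "fst x \<in> D" by auto
    then show "kobayashi_metric D (fst (\<Theta> x)) (snd (\<Theta> x)) = kobayashi_metric D (fst x) (snd x)"
      unfolding \<Theta>_def using kobayashi_metric_invariant[OF D(1) _ \<Phi> \<Psi> inv] by simp
  qed
  then show "(\<lambda>x. kobayashi_metric D (fst x) (snd x)) differentiable (at (z, v))"
    unfolding differentiable_def by blast
qed

section \<open>Rotations of the distinguished coordinate\<close>

definition rotation :: "'n \<Rightarrow> complex \<Rightarrow> complex ^ 'n \<Rightarrow> complex ^ 'n"
  where "rotation k u z = (\<chi> i. if i = k then u * z $ i else z $ i)"

lemma tail_norm_sq_rotation: "tail_norm_sq k (rotation k u z) = tail_norm_sq k z"
  unfolding tail_norm_sq_def by (intro sum.cong) (auto simp: rotation_def)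

lemma rotation_in_ellipsoid:
  "cmod u = 1 \<Longrightarrow> z \<in> ellipsoid k m \<Longrightarrow> rotation k u z \<in> ellipsoid k m"
  by (simp add: ellipsoid_def tail_norm_sq_rotation) (simp add: rotation_def norm_mult)

lemma kobayashi_morphism_rotation:
  assumes "cmod u = 1"
  shows "kobayashi_morphism (ellipsoid k m) (rotation k u) (\<lambda>_. rotation k u)"
  unfolding kobayashi_morphism_def
proof (intro allI impI)
  fix z v :: "complex ^ 'a" and g r
  assume r: "0 < r" and g: "kobayashi_disc (ellipsoid k m) z v g r"
  have hol: "(\<lambda>\<zeta>. g \<zeta> $ i) holomorphic_on ball 0 r" for i
    using g by (simp add: kobayashi_disc_def holomorphic_map_on_def)
  show "kobayashi_disc (ellipsoid k m) (rotation k u z) (rotation k u v) (\<lambda>\<zeta>. rotation k u (g \<zeta>)) r"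
  proof (rule kobayashi_discI)
    fix i
    show "(\<lambda>\<zeta>. rotation k u (g \<zeta>) $ i) holomorphic_on ball 0 r"
      using hol by (cases "i = k") (auto simp: rotation_def intro!: holomorphic_intros)
    show "((\<lambda>\<zeta>. rotation k u (g \<zeta>) $ i) has_field_derivative rotation k u v $ i) (at 0)"
      using kobayashi_disc_DERIV[OF g r] by (cases "i = k") (auto simp: rotation_def intro!: DERIV_cmult)
  next
    fix \<zeta> :: complex assume "cmod \<zeta> < r"
    then have "g \<zeta> \<in> ellipsoid k m" using g by (auto simp: kobayashi_disc_def)
    then show "rotation k u (g \<zeta>) \<in> ellipsoid k m" by (rule rotation_in_ellipsoid[OF assms])
  qed (use g in \<open>simp add: kobayashi_disc_def\<close>)
qed

lemma differentiable_fst_nth [simp]: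
  "(\<lambda>x. fst x $ i) differentiable (at (x :: (complex ^ 'n::finite) \<times> 'b::real_normed_vector))"
  by (intro bounded_linear_imp_differentiable bounded_linear_compose[OF bounded_linear_vec_nth bounded_linear_fst])

lemma differentiable_snd_nth [simp]:
  "(\<lambda>x. snd x $ i) differentiable (at (x :: 'b::real_normed_vector \<times> (complex ^ 'n::finite)))"
  by (intro bounded_linear_imp_differentiable bounded_linear_compose[OF bounded_linear_vec_nth bounded_linear_snd])

lemma regular_point_rotation:
  fixes z :: "complex ^ 'n::finite"
  assumes m: "m > 0" and z: "z \<in> ellipsoid k m" and u: "cmod u = 1"
    and reg: "regular_point (ellipsoid k m) (rotation k u z)"
  shows "regular_point (ellipsoid k m) z"
proof (rule regular_point_pullback[OF open_ellipsoid[OF m] z kobayashi_morphism_rotation[OF u]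
      kobayashi_morphism_rotation[of "cnj u"] _ _ _ _ reg])
  show "cmod (cnj u) = 1" using u by simp
  show "rotation k (cnj u) (rotation k u z) = z" for z
    using cnj_mult_self_unit[OF u] by (simp add: vec_eq_iff rotation_def mult.assoc[symmetric])
  show "rotation k (cnj u) 0 = 0" by (simp add: vec_eq_iff rotation_def)
  show "(\<lambda>x. rotation k u (fst x) $ i) differentiable (at (z, v))" for v :: "complex ^ 'n" and i
    by (cases "i = k") (auto simp: rotation_def intro!: differentiable_mult)
  show "(\<lambda>x. rotation k u (snd x) $ i) differentiable (at (z, v))" for v :: "complex ^ 'n" and i
    by (cases "i = k") (auto simp: rotation_def intro!: differentiable_mult)
qed

lemma regular_point_axis:
  fixes k :: "'n::finite"
  assumes m: "m > 1 / 2" and p: "0 \<le> p" "p < 1"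
  shows "regular_point (ellipsoid k m) (axis k (of_real p))"
  unfolding regular_point_def
proof (intro allI impI)
  let ?E = "ellipsoid k m" and ?z = "axis k (complex_of_real p)"
  let ?K = "\<lambda>x. kobayashi_metric ?E (fst x) (snd x)"
  have m': "m \<ge> 1 / 2" "m > 0" using m by auto
  have E: "open ?E" "?z \<in> ?E" using m' p by (auto intro: open_ellipsoid axis_in_ellipsoid)
  fix v :: "complex ^ 'n" assume "v \<noteq> 0"
  then obtain c where c: "c \<noteq> 0" "extremal_direction k m ?z (c *s v)"
    using extremal_direction_exists[OF m p] by blast
  have "cmod c * kobayashi_metric ?E ?z v = 1"
    using extremal_direction_eq_1[OF m'(1) c(2) E(2)] kobayashi_metric_smult[OF E, of c v] by simp
  then have pos: "kobayashi_metric ?E ?z v > 0"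
    by (metis norm_ge_zero not_less zero_less_one mult_nonneg_nonpos)
  define K where "K = ?K"
  obtain K' where K': "(K has_derivative K') (at (?z, c *s v))"
    using extremal_direction_differentiable[OF m c(2) E(2)] unfolding differentiable_def K_def by blast
  have "bounded_linear (\<lambda>x. (fst x, c *s snd x) :: (complex ^ 'n) \<times> (complex ^ 'n))"
    unfolding linear_conv_bounded_linear[symmetric]
    by (rule linearI) (auto simp: vec_eq_iff algebra_simps)
  then have "((\<lambda>x. (fst x, c *s snd x) :: (complex ^ 'n) \<times> (complex ^ 'n)) has_derivative
      (\<lambda>x. (fst x, c *s snd x))) (at (?z, v))"
    by (rule bounded_linear_imp_has_derivative)
  from has_derivative_compose[OF this, of K K'] K'
  have "((\<lambda>x. K (fst x, c *s snd x)) has_derivative (\<lambda>x. K' (fst x, c *s snd x))) (at (?z, v))"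
    by simp
  from has_derivative_mult_right[OF this, of "1 / cmod c"]
  have "(K has_derivative (\<lambda>x. 1 / cmod c * K' (fst x, c *s snd x))) (at (?z, v))"
  proof (rule has_derivative_transform_within_open)
    show "open (?E \<times> (UNIV :: (complex ^ 'n) set))" using E by (intro open_Times) auto
    show "(?z, v) \<in> ?E \<times> UNIV" using E by simp
    fix x :: "(complex ^ 'n) \<times> (complex ^ 'n)" assume "x \<in> ?E \<times> UNIV"
    then have "fst x \<in> ?E" by auto
    then show "1 / cmod c * K (fst x, c *s snd x) = K x"
      using kobayashi_metric_smult[OF E(1), of "fst x" c "snd x"] c(1) by (simp add: K_def)
  qed
  with pos show "kobayashi_metric ?E ?z v > 0 \<and> ?K differentiable (at (?z, v))"
    unfolding differentiable_def K_def by blast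
qed

section \<open>Moebius automorphisms acting on the tail coordinates\<close>

definition root_factor :: "real \<Rightarrow> complex \<Rightarrow> complex \<Rightarrow> complex"
  where "root_factor m c w = exp ((of_real (ln (1 - (cmod c)\<^sup>2) / 2) - Ln (1 - cnj c * w)) / of_real m)"

text \<open>On the tail coordinates this is the automorphism of the unit ball that sends the point
  with \<open>j\<close>-th entry \<open>c\<close> and other entries 0 to the origin. The
  distinguished coordinate receives the weight that makes the ellipsoid invariant.\<close>

definition moebius :: "'n \<Rightarrow> real \<Rightarrow> 'n \<Rightarrow> complex \<Rightarrow> complex ^ 'n \<Rightarrow> complex ^ 'n"
  where "moebius k m j c z = (\<chi> i.
    if i = j then (z $ j - c) / (1 - cnj c * z $ j)
    else if i = k then z $ k * root_factor m c (z $ j)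
    else of_real (sqrt (1 - (cmod c)\<^sup>2)) * z $ i / (1 - cnj c * z $ j))"

definition moebius_deriv ::
    "'n \<Rightarrow> real \<Rightarrow> 'n \<Rightarrow> complex \<Rightarrow> complex ^ 'n \<Rightarrow> complex ^ 'n \<Rightarrow> complex ^ 'n"
  where "moebius_deriv k m j c z v = (\<chi> i.
    if i = j then of_real (1 - (cmod c)\<^sup>2) * v $ j / (1 - cnj c * z $ j)\<^sup>2
    else if i = k then root_factor m c (z $ j) *
      (v $ k + z $ k * (cnj c * v $ j) / (of_real m * (1 - cnj c * z $ j)))
    else of_real (sqrt (1 - (cmod c)\<^sup>2)) *
      (v $ i / (1 - cnj c * z $ j) + z $ i * (cnj c * v $ j) / (1 - cnj c * z $ j)\<^sup>2))"

lemma moebius_denominator: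
  assumes "cmod c < 1" "cmod w < 1"
  shows "Re (1 - cnj c * w) > 0" "1 - cnj c * w \<noteq> 0" "1 - cnj c * w \<notin> \<real>\<^sub>\<le>\<^sub>0"
proof -
  have "cmod (cnj c * w) < 1"
    using mult_strict_mono'[of "cmod c" 1 "cmod w" 1] assms by (simp add: norm_mult)
  then show "Re (1 - cnj c * w) > 0"
    using complex_Re_le_cmod[of "cnj c * w"] by (simp only: minus_complex.sel one_complex.sel)
  then show "1 - cnj c * w \<noteq> 0" "1 - cnj c * w \<notin> \<real>\<^sub>\<le>\<^sub>0"
    by (auto simp only: complex_nonpos_Reals_iff zero_complex.sel)
qed

lemma cmod_sq_less_1: "cmod c < 1 \<Longrightarrow> (cmod c)\<^sup>2 < 1"
  by (simp add: power_less_one_iff)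

lemma cmod_tail_less_1:
  fixes z :: "complex ^ 'n::finite"
  assumes m: "m > 0" and z: "z \<in> ellipsoid k m" and j: "j \<noteq> k"
  shows "cmod (z $ j) < 1"
proof -
  have "(cmod (z $ j))\<^sup>2 \<le> tail_norm_sq k z"
    unfolding tail_norm_sq_def using j by (intro member_le_sum) auto
  also have "\<dots> < 1"
  proof -
    have "cmod (z $ k) powr (2 * m) + tail_norm_sq k z < 1" using z by (simp add: ellipsoid_def)
    moreover have "0 \<le> cmod (z $ k) powr (2 * m)" by simp
    ultimately show ?thesis by linarith
  qed
  finally have "(cmod (z $ j))\<^sup>2 < 1\<^sup>2" by simp
  then show ?thesis by (rule power_less_imp_less_base) simp
qed

text \<open>The value is the factor by which the squared moduli of the tail coordinates other than
  \<open>j\<close> are scaled; matching it is the purpose of the \<open>m\<close>-th root.\<close>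

lemma cmod_root_factor:
  assumes "m \<noteq> 0" "cmod c < 1" "cmod w < 1"
  shows "cmod (root_factor m c w) powr (2 * m) = (1 - (cmod c)\<^sup>2) / (cmod (1 - cnj c * w))\<^sup>2"
proof -
  define d where "d = 1 - cnj c * w"
  define s where "s = 1 - (cmod c)\<^sup>2"
  have d: "d \<noteq> 0" unfolding d_def by (rule moebius_denominator(2)[OF assms(2,3)])
  have s: "s > 0" using cmod_sq_less_1[OF assms(2)] by (simp add: s_def)
  have "cmod (root_factor m c w) powr (2 * m) = exp (ln s - 2 * ln (cmod d))"
    using assms(1) d unfolding root_factor_def d_def[symmetric] s_def[symmetric]
    by (simp add: powr_def Re_divide_of_real field_simps)
  also have "\<dots> = s / (cmod d)\<^sup>2" using s d by (simp add: exp_diff exp_double)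
  finally show ?thesis by (simp add: d_def s_def)
qed

lemma moebius_identity:
  "(cmod (1 - cnj c * w))\<^sup>2 - (cmod (w - c))\<^sup>2 = (1 - (cmod c)\<^sup>2) * (1 - (cmod w)\<^sup>2)"
  unfolding cmod_power2 by (simp add: power2_eq_square algebra_simps)

text \<open>By the identity for one-variable Moebius maps, \<open>1 - (cmod (z $ j))\<^sup>2\<close>
  is multiplied by the same factor as the terms of all other coordinates, so the whole difference
  from 1 scales by it.\<close>

lemma defining_fun_moebius:
  fixes z :: "complex ^ 'n::finite"
  assumes m: "m > 0" and c: "cmod c < 1" and j: "j \<noteq> k" and zj: "cmod (z $ j) < 1"
  shows "1 - defining_fun k m (moebius k m j c z) =
    (1 - (cmod c)\<^sup>2) / (cmod (1 - cnj c * z $ j))\<^sup>2 * (1 - defining_fun k m z)"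
proof -
  define d where "d = 1 - cnj c * z $ j"
  define s where "s = 1 - (cmod c)\<^sup>2"
  define R where "R = (\<Sum>i\<in>UNIV - {k} - {j}. (cmod (z $ i))\<^sup>2)"
  have d: "d \<noteq> 0" unfolding d_def by (rule moebius_denominator(2)[OF c zj])
  have s: "s > 0" using cmod_sq_less_1[OF c] by (simp add: s_def)
  have tz: "tail_norm_sq k z = (cmod (z $ j))\<^sup>2 + R"
    unfolding tail_norm_sq_def R_def using j by (subst sum.remove[of _ j]) auto
  have "tail_norm_sq k (moebius k m j c z) = (cmod (moebius k m j c z $ j))\<^sup>2 +
      (\<Sum>i\<in>UNIV - {k} - {j}. (cmod (moebius k m j c z $ i))\<^sup>2)"
    unfolding tail_norm_sq_def using j by (subst sum.remove[of _ j]) auto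
  also have "(\<Sum>i\<in>UNIV - {k} - {j}. (cmod (moebius k m j c z $ i))\<^sup>2) =
      (\<Sum>i\<in>UNIV - {k} - {j}. s / (cmod d)\<^sup>2 * (cmod (z $ i))\<^sup>2)"
    using s by (intro sum.cong)
      (auto simp: moebius_def s_def[symmetric] d_def[symmetric] norm_mult norm_divide power_divide power_mult_distrib)
  also have "\<dots> = s / (cmod d)\<^sup>2 * R" by (simp add: R_def sum_distrib_left)
  also have "(cmod (moebius k m j c z $ j))\<^sup>2 = (cmod (z $ j - c))\<^sup>2 / (cmod d)\<^sup>2"
    by (simp add: moebius_def d_def norm_divide power_divide)
  finally have tM: "tail_norm_sq k (moebius k m j c z) = (cmod (z $ j - c))\<^sup>2 / (cmod d)\<^sup>2 + s / (cmod d)\<^sup>2 * R" .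
  have kM: "cmod (moebius k m j c z $ k) powr (2 * m) = s / (cmod d)\<^sup>2 * cmod (z $ k) powr (2 * m)"
    using cmod_root_factor[OF _ c zj, of m] m j
    by (auto simp: moebius_def norm_mult powr_mult s_def d_def)
  have "(cmod (z $ j - c))\<^sup>2 = (cmod d)\<^sup>2 - s * (1 - (cmod (z $ j))\<^sup>2)"
    using moebius_identity[of c "z $ j"] by (simp add: d_def s_def)
  then have "1 - defining_fun k m (moebius k m j c z) = s / (cmod d)\<^sup>2 * (1 - defining_fun k m z)"
    unfolding defining_fun_def tM kM tz using d by (simp add: field_simps)
  then show ?thesis by (simp add: s_def d_def)
qed

lemma moebius_in_ellipsoid:
  fixes z :: "complex ^ 'n::finite"
  assumes m: "m > 0" and c: "cmod c < 1" and j: "j \<noteq> k" and z: "z \<in> ellipsoid k m"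
  shows "moebius k m j c z \<in> ellipsoid k m"
proof -
  have zj: "cmod (z $ j) < 1" by (rule cmod_tail_less_1[OF m z j])
  have "(1 - (cmod c)\<^sup>2) / (cmod (1 - cnj c * z $ j))\<^sup>2 * (1 - defining_fun k m z) > 0"
    using cmod_sq_less_1[OF c] moebius_denominator(2)[OF c zj] z by (simp add: in_ellipsoid_iff)
  then show ?thesis using defining_fun_moebius[OF m c j zj] by (simp add: in_ellipsoid_iff)
qed

lemma moebius_inverse:
  fixes z :: "complex ^ 'n::finite"
  assumes m: "m > 0" and c: "cmod c < 1" and j: "j \<noteq> k" and z: "z \<in> ellipsoid k m"
  shows "moebius k m j (- c) (moebius k m j c z) = z"
proof -
  have zj: "cmod (z $ j) < 1" by (rule cmod_tail_less_1[OF m z j])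
  define d where "d = 1 - cnj c * z $ j"
  define s where "s = 1 - (cmod c)\<^sup>2"
  have d: "d \<noteq> 0" "d \<notin> \<real>\<^sub>\<le>\<^sub>0" unfolding d_def by (rule moebius_denominator[OF c zj])+
  have s: "s > 0" using cmod_sq_less_1[OF c] by (simp add: s_def)
  have cc: "cnj c * c = of_real (1 - s)"
    unfolding s_def using complex_norm_square[of c] by (simp add: mult.commute)
  define w where "w = (z $ j - c) / d"
  \<comment> \<open>The denominator of the second map is the inverse of that of the first, up to
    \<open>s\<close>; the cancellation in every coordinate follows from this.\<close>
  have wd: "1 + cnj c * w = of_real s / d"
  proof -
    have "w * d = z $ j - c" using d by (simp add: w_def)
    moreover have "(1 + cnj c * w) * d = d + cnj c * (w * d)" by (simp add: distrib_right mult.assoc)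
    ultimately have "(1 + cnj c * w) * d = d + cnj c * (z $ j - c)" by simp
    also have "\<dots> = 1 - cnj c * c" by (simp add: d_def algebra_simps)
    also have "\<dots> = of_real s" unfolding cc by simp
    finally show ?thesis using d by (simp add: field_simps)
  qed
  have Mj: "moebius k m j c z $ j = w" by (simp add: moebius_def w_def d_def)
  show ?thesis
    unfolding vec_eq_iff
  proof
    fix i
    consider "i = j" | "i = k" "i \<noteq> j" | "i \<noteq> j" "i \<noteq> k" by blast
    then show "moebius k m j (- c) (moebius k m j c z) $ i = z $ i"
    proof cases
      case 1
      have "(w + c) / (1 + cnj c * w) = z $ j"
      proof -
        have "(w + c) * d = z $ j * of_real s"
        proof -
          have "(w + c) * d = z $ j - c + c * d" using d by (simp add: w_def distrib_right)
          also have "\<dots> = z $ j - (cnj c * c) * z $ j" by (simp add: d_def algebra_simps)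
          finally show ?thesis unfolding cc by (simp add: algebra_simps)
        qed
        then show ?thesis unfolding wd using d s by (simp add: field_simps)
      qed
      then show ?thesis unfolding moebius_def[of k m j "- c"] using 1 Mj by simp
    next
      case 2
      \<comment> \<open>There is no correction by a multiple of \<open>2 * pi * \<i>\<close>, as
        \<open>s\<close> is a positive real and \<open>d\<close> avoids the branch cut. Hence the
        two root factors are inverse to each other on the nose.\<close>
      have "Ln (of_real s / d) = of_real (ln s) - Ln d"
      proof -
        have "Ln (of_real s / d) = Ln (of_real s * inverse d)" by (simp add: divide_inverse)
        also have "\<dots> = of_real (ln s) + Ln (inverse d)"
          by (subst Ln_times_of_real) (use s d in \<open>auto simp: Ln_of_real\<close>)
        also have "Ln (inverse d) = - Ln d" using d(2) by (rule Ln_inverse)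
        finally show ?thesis by simp
      qed
      then have "root_factor m c (z $ j) * root_factor m (- c) w = 1"
        unfolding root_factor_def using m
        by (simp add: wd d_def[symmetric] s_def[symmetric] exp_add[symmetric] add_divide_distrib[symmetric])
      then show ?thesis
        unfolding moebius_def[of k m j "- c"] using 2 Mj
        by (simp add: moebius_def mult.assoc)
    next
      case 3
      have "of_real (sqrt s) * (of_real (sqrt s) * z $ i / d) / (of_real s / d) = z $ i"
        using s d by (simp add: of_real_mult[symmetric] mult.assoc[symmetric] del: of_real_mult)
      then show ?thesis
        unfolding moebius_def[of k m j "- c"] using 3 Mj
        by (simp add: moebius_def wd s_def[symmetric] d_def[symmetric])
    qed
  qed
qed

lemma DERIV_root_factor:
  assumes "m \<noteq> 0" "cmod c < 1" "cmod w < 1"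
  shows "(root_factor m c has_field_derivative
    root_factor m c w * (cnj c / (of_real m * (1 - cnj c * w)))) (at w)"
  unfolding root_factor_def[abs_def] using moebius_denominator[OF assms(2,3)] assms(1)
  by (auto intro!: derivative_eq_intros simp: field_simps)

lemma quotient_rule_split:
  fixes a b D e :: complex
  assumes "D \<noteq> 0"
  shows "(a * D - b * - e) / (D * D) = a / D + b * e / D\<^sup>2"
  using assms by (simp add: field_simps power2_eq_square)

lemma kobayashi_morphism_moebius:
  fixes k :: "'n::finite"
  assumes m: "m > 0" and c: "cmod c < 1" and j: "j \<noteq> k"
  shows "kobayashi_morphism (ellipsoid k m) (moebius k m j c) (moebius_deriv k m j c)"
  unfolding kobayashi_morphism_def
proof (intro allI impI)
  fix z v :: "complex ^ 'n" and g r
  assume r: "0 < r" and g: "kobayashi_disc (ellipsoid k m) z v g r"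
  have hol: "(\<lambda>\<zeta>. g \<zeta> $ i) holomorphic_on ball 0 r" for i
    using g by (simp add: kobayashi_disc_def holomorphic_map_on_def)
  have gE: "g \<zeta> \<in> ellipsoid k m" if "cmod \<zeta> < r" for \<zeta>
    using g that by (auto simp: kobayashi_disc_def)
  have g0: "g 0 = z" using g by (simp add: kobayashi_disc_def)
  have gj: "cmod (g \<zeta> $ j) < 1" if "cmod \<zeta> < r" for \<zeta>
    by (rule cmod_tail_less_1[OF m gE[OF that] j])
  note den = moebius_denominator[OF c gj]
  have d0: "1 - cnj c * z $ j \<noteq> 0" using den(2)[of 0] r g0 by simp
  have s: "1 - cnj c * c = of_real (1 - (cmod c)\<^sup>2)"
    using complex_norm_square[of c] by (simp add: mult.commute)
  show "kobayashi_disc (ellipsoid k m) (moebius k m j c z) (moebius_deriv k m j c z v)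
      (\<lambda>\<zeta>. moebius k m j c (g \<zeta>)) r"
  proof (rule kobayashi_discI)
    fix i
    have g': "((\<lambda>\<zeta>. g \<zeta> $ i) has_field_derivative v $ i) (at 0)" for i
      by (rule kobayashi_disc_DERIV[OF g r])
    have dd: "((\<lambda>\<zeta>. 1 - cnj c * g \<zeta> $ j) has_field_derivative - (cnj c * v $ j)) (at 0)"
      using DERIV_diff[OF DERIV_const DERIV_cmult[OF g']] by simp
    have rf_hol: "(\<lambda>\<zeta>. root_factor m c (g \<zeta> $ j)) holomorphic_on ball 0 r"
      unfolding root_factor_def[abs_def] using m den by (intro holomorphic_intros hol) auto
    have "cmod (g 0 $ j) < 1" using gj[of 0] r by simp
    from DERIV_chain2[OF DERIV_root_factor[OF _ c this] g'] m
    have rf: "((\<lambda>\<zeta>. root_factor m c (g \<zeta> $ j)) has_field_derivative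
        root_factor m c (z $ j) * (cnj c / (of_real m * (1 - cnj c * z $ j))) * v $ j) (at 0)"
      by (simp add: g0)
    consider "i = j" | "i = k" "i \<noteq> j" | "i \<noteq> j" "i \<noteq> k" by blast
    then have "(\<lambda>\<zeta>. moebius k m j c (g \<zeta>) $ i) holomorphic_on ball 0 r \<and>
        ((\<lambda>\<zeta>. moebius k m j c (g \<zeta>) $ i) has_field_derivative moebius_deriv k m j c z v $ i) (at 0)"
    proof cases
      case 1
      have "((\<lambda>\<zeta>. (g \<zeta> $ j - c) / (1 - cnj c * g \<zeta> $ j)) has_field_derivative
          (v $ j * (1 - cnj c * g 0 $ j) - (g 0 $ j - c) * - (cnj c * v $ j)) /
          ((1 - cnj c * g 0 $ j) * (1 - cnj c * g 0 $ j))) (at 0)"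
        using DERIV_divide[OF DERIV_diff[OF g' DERIV_const] dd] d0 g0 by simp
      moreover have "v $ j * (1 - cnj c * z $ j) - (z $ j - c) * - (cnj c * v $ j) =
          of_real (1 - (cmod c)\<^sup>2) * v $ j"
      proof -
        have alg: "V * (1 - C * Z) - (Z - c) * - (C * V) = (1 - C * c) * V" for V C Z :: complex
          by (simp add: algebra_simps)
        show ?thesis unfolding alg s ..
      qed
      ultimately have "((\<lambda>\<zeta>. (g \<zeta> $ j - c) / (1 - cnj c * g \<zeta> $ j)) has_field_derivative
          of_real (1 - (cmod c)\<^sup>2) * v $ j / (1 - cnj c * z $ j)\<^sup>2) (at 0)"
        by (simp only: g0 power2_eq_square[of "1 - cnj c * z $ j"])
      moreover have "(\<lambda>\<zeta>. (g \<zeta> $ j - c) / (1 - cnj c * g \<zeta> $ j)) holomorphic_on ball 0 r"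
        using den by (intro holomorphic_intros hol) auto
      ultimately show ?thesis
        using 1 by (simp add: moebius_def moebius_deriv_def)
    next
      case 2
      have "(\<lambda>\<zeta>. g \<zeta> $ k * root_factor m c (g \<zeta> $ j)) holomorphic_on ball 0 r"
        by (intro holomorphic_intros hol rf_hol)
      moreover have "((\<lambda>\<zeta>. g \<zeta> $ k * root_factor m c (g \<zeta> $ j)) has_field_derivative
          root_factor m c (z $ j) * (v $ k + z $ k * (cnj c * v $ j) / (of_real m * (1 - cnj c * z $ j)))) (at 0)"
      proof -
        have alg: "v $ k * R + R * (C / (M * D)) * V * Z = R * (v $ k + Z * (C * V) / (M * D))"
          for R C M D V Z :: complex by (simp add: algebra_simps)
        from DERIV_mult[OF g'[of k] rf] show ?thesis unfolding g0 alg .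
      qed
      ultimately show ?thesis using 2 by (simp add: moebius_def moebius_deriv_def)
    next
      case 3
      have "((\<lambda>\<zeta>. of_real (sqrt (1 - (cmod c)\<^sup>2)) * (g \<zeta> $ i / (1 - cnj c * g \<zeta> $ j))) has_field_derivative
          of_real (sqrt (1 - (cmod c)\<^sup>2)) *
          ((v $ i * (1 - cnj c * g 0 $ j) - g 0 $ i * - (cnj c * v $ j)) /
          ((1 - cnj c * g 0 $ j) * (1 - cnj c * g 0 $ j)))) (at 0)"
        by (rule DERIV_cmult[OF DERIV_divide[OF g' dd]]) (use d0 g0 in simp)
      moreover have "(v $ i * (1 - cnj c * z $ j) - z $ i * - (cnj c * v $ j)) /
          ((1 - cnj c * z $ j) * (1 - cnj c * z $ j)) =
          v $ i / (1 - cnj c * z $ j) + z $ i * (cnj c * v $ j) / (1 - cnj c * z $ j)\<^sup>2"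
        by (rule quotient_rule_split[OF d0])
      moreover have "(\<lambda>\<zeta>. of_real (sqrt (1 - (cmod c)\<^sup>2)) * (g \<zeta> $ i / (1 - cnj c * g \<zeta> $ j))) holomorphic_on ball 0 r"
        using den by (intro holomorphic_intros hol) auto
      ultimately have "((\<lambda>\<zeta>. of_real (sqrt (1 - (cmod c)\<^sup>2)) * (g \<zeta> $ i / (1 - cnj c * g \<zeta> $ j))) has_field_derivative
          of_real (sqrt (1 - (cmod c)\<^sup>2)) *
          (v $ i / (1 - cnj c * z $ j) + z $ i * (cnj c * v $ j) / (1 - cnj c * z $ j)\<^sup>2)) (at 0)
          \<and> (\<lambda>\<zeta>. of_real (sqrt (1 - (cmod c)\<^sup>2)) * (g \<zeta> $ i / (1 - cnj c * g \<zeta> $ j))) holomorphic_on ball 0 r"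
        by (simp only: g0 simp_thms)
      then show ?thesis
        using 3 by (simp add: moebius_def moebius_deriv_def)
    qed
    then show "(\<lambda>\<zeta>. moebius k m j c (g \<zeta>) $ i) holomorphic_on ball 0 r"
      "((\<lambda>\<zeta>. moebius k m j c (g \<zeta>) $ i) has_field_derivative moebius_deriv k m j c z v $ i) (at 0)"
      by auto
  qed (use moebius_in_ellipsoid[OF m c j] gE g0 in auto)
qed

lemma differentiable_field_compose:
  fixes f :: "complex \<Rightarrow> complex"
  assumes "f field_differentiable (at (g x))" "g differentiable (at x)"
  shows "(\<lambda>x. f (g x)) differentiable (at x)"
  using differentiable_compose[OF field_differentiable_imp_differentiable[OF assms(1)] assms(2)] .

lemma regular_point_moebius:
  fixes z :: "complex ^ 'n::finite"
  assumes m: "m > 0" and z: "z \<in> ellipsoid k m" and c: "cmod c < 1" and j: "j \<noteq> k"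
    and reg: "regular_point (ellipsoid k m) (moebius k m j c z)"
  shows "regular_point (ellipsoid k m) z"
proof (rule regular_point_pullback[OF open_ellipsoid[OF m] z kobayashi_morphism_moebius[OF m c j]
      kobayashi_morphism_moebius[OF m _ j, of "- c"] _ _ _ _ reg])
  show "cmod (- c) < 1" using c by simp
  show "moebius k m j (- c) (moebius k m j c z) = z" if "z \<in> ellipsoid k m" for z
    by (rule moebius_inverse[OF m c j that])
  show "moebius_deriv k m j (- c) w 0 = 0" for w by (simp add: vec_eq_iff moebius_deriv_def)
  fix v :: "complex ^ 'n" and i
  have zj: "cmod (z $ j) < 1" by (rule cmod_tail_less_1[OF m z j])
  have d0: "1 - cnj c * z $ j \<noteq> 0" by (rule moebius_denominator(2)[OF c zj])
  have rf: "(\<lambda>x. root_factor m c (fst x $ j)) differentiable (at (z, v))"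
  proof (rule differentiable_field_compose[where f = "root_factor m c" and g = "\<lambda>x. fst x $ j"])
    show "root_factor m c field_differentiable at (fst (z, v) $ j)"
      using DERIV_root_factor[OF _ c zj, of m] m by (auto simp: field_differentiable_def)
  qed simp
  show "(\<lambda>x. moebius k m j c (fst x) $ i) differentiable (at (z, v))"
    using d0 rf by (cases "i = j"; cases "i = k") (simp_all add: moebius_def)
  show "(\<lambda>x. moebius_deriv k m j c (fst x) (snd x) $ i) differentiable (at (z, v))"
    using d0 rf m by (cases "i = j"; cases "i = k") (simp_all add: moebius_deriv_def)
qed

text \<open>The Moebius map with \<open>c = z $ j\<close> kills the \<open>j\<close>-th coordinate
  and keeps vanishing tail coordinates zero, so the number of nonzero tail coordinates drops. Once
  none is left, a rotation leads to the nonnegative axis. The origin can occur there, which is why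
  the points treated on the axis include \<open>p = 0\<close>.\<close>

lemma regular_point_ellipsoid:
  fixes z :: "complex ^ 'n::finite"
  assumes m: "m > 1 / 2" and z: "z \<in> ellipsoid k m"
  shows "regular_point (ellipsoid k m) z"
  using z
proof (induction "card {j. j \<noteq> k \<and> z $ j \<noteq> 0}" arbitrary: z rule: less_induct)
  case less
  have m0: "m > 0" using m by simp
  show ?case
  proof (cases "\<exists>j. j \<noteq> k \<and> z $ j \<noteq> 0")
    case True
    then obtain j where j: "j \<noteq> k" "z $ j \<noteq> 0" by blast
    have c: "cmod (z $ j) < 1" by (rule cmod_tail_less_1[OF m0 less.prems j(1)])
    let ?w = "moebius k m j (z $ j) z"
    have "{i. i \<noteq> k \<and> ?w $ i \<noteq> 0} \<subset> {i. i \<noteq> k \<and> z $ i \<noteq> 0}"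
      using j by (auto simp: moebius_def)
    then have "card {i. i \<noteq> k \<and> ?w $ i \<noteq> 0} < card {i. i \<noteq> k \<and> z $ i \<noteq> 0}"
      by (intro psubset_card_mono) auto
    from less.hyps[OF this moebius_in_ellipsoid[OF m0 c j(1) less.prems]]
    show ?thesis by (rule regular_point_moebius[OF m0 less.prems c j(1)])
  next
    case False
    obtain u where u: "cmod u = 1" "u * z $ k = of_real (cmod (z $ k))"
      using phase_exists by blast
    have "rotation k u z = axis k (of_real (cmod (z $ k)))"
      using False u(2) by (auto simp: vec_eq_iff rotation_def axis_def)
    moreover have "cmod (z $ k) < 1"
    proof (rule ccontr)
      assume "\<not> cmod (z $ k) < 1"
      then have "cmod (z $ k) powr (2 * m) \<ge> 1" using m0 by (simp add: ge_one_powr_ge_zero)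
      then show False using less.prems tail_norm_sq_nonneg[of k z] by (simp add: ellipsoid_def)
    qed
    ultimately have "regular_point (ellipsoid k m) (rotation k u z)"
      using regular_point_axis[OF m, of "cmod (z $ k)" k] by simp
    then show ?thesis by (rule regular_point_rotation[OF m0 less.prems u(1)])
  qed
qed

lemma C1_smooth_on_kobayashi_metric_ellipsoid:
  fixes k :: "'n::finite"
  assumes m: "m > 1 / 2"
  shows "C1_smooth_on (ellipsoid k m \<times> (UNIV - {0})) (\<lambda>(z, v). kobayashi_metric (ellipsoid k m) z v)"
proof -
  let ?E = "ellipsoid k m"
  define K where "K = (\<lambda>x. kobayashi_metric ?E (fst x) (snd x))"
  have m': "m \<ge> 1 / 2" "m > 0" using m by auto
  have E: "open ?E" "convex ?E" using m' by (auto intro: open_ellipsoid convex_ellipsoid)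
  have "\<exists>L. (K has_derivative blinfun_apply L) (at x)" if x: "x \<in> ?E \<times> (UNIV - {0})" for x
  proof -
    have "K differentiable (at (fst x, snd x))"
      using regular_point_ellipsoid[OF m, of "fst x" k] x unfolding regular_point_def K_def by auto
    then obtain L where L: "(K has_derivative L) (at x)" unfolding differentiable_def by auto
    then have "bounded_linear L" by (rule has_derivative_bounded_linear)
    then have "blinfun_apply (Blinfun L) = L" by (rule bounded_linear_Blinfun_apply)
    then show ?thesis using L by metis
  qed
  then obtain K' where K': "\<And>x. x \<in> ?E \<times> (UNIV - {0}) \<Longrightarrow> (K has_derivative blinfun_apply (K' x)) (at x)"
    by metis
  have "continuous_on (?E \<times> (UNIV - {0})) K'"
  proof (rule quasiconvex_homogeneous_continuous_derivative[OF E(1) K'])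
    show "K (z, c *\<^sub>R v) = c * K (z, v)" if "z \<in> ?E" "c > 0" for z v c
      using kobayashi_metric_scaleR[OF E(1) that(1)] that(2) by (simp add: K_def)
    show "K (z, v) > 0" if "z \<in> ?E" "v \<noteq> 0" for z v
      using regular_point_ellipsoid[OF m that(1)] that(2) by (simp add: K_def regular_point_def)
    show "K ((1 - s) *\<^sub>R x + s *\<^sub>R y) \<le> c"
      if "fst x \<in> ?E" "fst y \<in> ?E" "K x < c" "K y < c" "0 \<le> s" "s \<le> 1" for x y c s
      using kobayashi_metric_quasiconvex[OF E that(1,2,5,6)] that(3,4) by (simp add: K_def)
  qed
  with K' have "C1_smooth_on (?E \<times> (UNIV - {0})) K"
    unfolding C1_smooth_on_def by blast
  then show ?thesis by (simp add: K_def case_prod_unfold)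
qed

theorem theorem1p6:
  fixes m :: real and k :: "'n::finite"
  assumes "m \<ge> 1 / 2"
  shows "(\<forall>(p::real) (v :: complex ^ 'n). 0 < p \<and> p < 1 \<and> v \<noteq> 0 \<longrightarrow>
      (let u = u_param k m v;
           t = t_param m p u;
           K = kobayashi_metric (ellipsoid k m) (axis k (complex_of_real p)) v;
           is_sol = (\<lambda>\<alpha>::real. 0 < \<alpha> \<and>
             \<alpha> powr (2 * m) - t * \<alpha> powr (2 * m - 2) - (1 - t) * p powr (2 * m) = 0)
       in (u \<le> ereal p \<longrightarrow>
             K = sqrt (m\<^sup>2 * p powr (2 * m - 2) * (cmod (v $ k))\<^sup>2 / (1 - p powr (2 * m))\<^sup>2
                       + (\<Sum>j \<in> UNIV - {k}. (cmod (v $ j))\<^sup>2 / (1 - p powr (2 * m))))) \<and>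
          (u > ereal p \<longrightarrow>
             (\<exists>!\<alpha>. is_sol \<alpha>) \<and>
             (\<forall>\<alpha>. is_sol \<alpha> \<longrightarrow>
               K = m * \<alpha> * (1 - t) * cmod (v $ k) /
                   (p * (1 - \<alpha>\<^sup>2) * (m * (1 - t) + t))))))
    \<and> (m > 1 / 2 \<longrightarrow>
        C1_smooth_on (ellipsoid k m \<times> (UNIV - {0}))
          (\<lambda>(z, v). kobayashi_metric (ellipsoid k m) z v))"
proof (unfold Let_def, intro conjI allI impI; (elim conjE)?)
  fix p :: real and v :: "complex ^ 'n"
  assume "0 < p" "p < 1" "v \<noteq> 0"
  note formula = kobayashi_metric_formula[OF assms this]
  {
    assume "u_param k m v \<le> ereal p"
    then show "kobayashi_metric (ellipsoid k m) (axis k (complex_of_real p)) v =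
        sqrt (m\<^sup>2 * p powr (2 * m - 2) * (cmod (v $ k))\<^sup>2 / (1 - p powr (2 * m))\<^sup>2
          + (\<Sum>j \<in> UNIV - {k}. (cmod (v $ j))\<^sup>2 / (1 - p powr (2 * m))))"
      by (rule formula(1))
  next
    assume "u_param k m v > ereal p"
    then show "\<exists>!\<alpha>. 0 < \<alpha> \<and> \<alpha> powr (2 * m) - t_param m p (u_param k m v) * \<alpha> powr (2 * m - 2) -
        (1 - t_param m p (u_param k m v)) * p powr (2 * m) = 0"
      by (rule formula(2))
  next
    fix \<alpha>
    assume "u_param k m v > ereal p" "0 < \<alpha>" "\<alpha> powr (2 * m) -
        t_param m p (u_param k m v) * \<alpha> powr (2 * m - 2) -
        (1 - t_param m p (u_param k m v)) * p powr (2 * m) = 0"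
    then show "kobayashi_metric (ellipsoid k m) (axis k (complex_of_real p)) v =
        m * \<alpha> * (1 - t_param m p (u_param k m v)) * cmod (v $ k) /
        (p * (1 - \<alpha>\<^sup>2) * (m * (1 - t_param m p (u_param k m v)) + t_param m p (u_param k m v)))"
      by (intro formula(3) conjI)
  }
qed (rule C1_smooth_on_kobayashi_metric_ellipsoid)

end
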